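(* Let $H_1,\ldots,H_L$ be Hermitian operators on a finite-dimensional Hilbert space and, for $\theta\in\mathbb{R}^L$, let $H(\theta):=\sum_{j=1}^L\theta_jH_j$ and $\rho(\theta):=e^{-H(\theta)}/\mathrm{Tr}[e^{-H(\theta)}]$. For all $\alpha\in(0,1)$ and $z>0$, the $\alpha$-$z$ information matrix of the family $(\rho(\theta))_{\theta\in\mathbb{R}^L}$ satisfies $$[I_{\alpha,z}(\theta)]_{i,j}=\frac12\left\langle\{\Phi_{q_{\alpha,z},\theta}(H_i),H_j\}\right\rangle_{\rho(\theta)}-\langle H_i\rangle_{\rho(\theta)}\langle H_j\rangle_{\rho(\theta)},$$ where the channel $\Phi_{q_{\alpha,z},\theta}$ is given by $$\Phi_{q_{\alpha,z},\theta}(X):=\int_{-\infty}^\infty dt\;q_{\alpha,z}(t)\,e^{-itH(\theta)}Xe^{itH(\theta)},$$ and $q_{\alpha,z}:=p*p_{\alpha,z}$ is the probability density function on $\mathbb{R}$ given by the convolution of the probability densities $$p(t):=\frac2\pi\ln\left|\coth\left(\frac{\pi t}{2}\right)\right|,\qquad p_{\alpha,z}(t):=\frac{z}{2\pi\alpha(1-\alpha)}\ln\left(1+\left(\frac{\sin(\pi\alpha)}{\sinh(\pi zt)}\right)^2\right).$$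
   Context: For positive definite states (unit-trace operators) $\rho,\sigma$, $\alpha\in(0,1)\cup(1,\infty)$ and $z>0$, the $\alpha$-$z$ Rényi relative entropy is $D_{\alpha,z}(\rho\|\sigma):=\frac{1}{\alpha-1}\ln\mathrm{Tr}\big[(\sigma^{\frac{1-\alpha}{2z}}\rho^{\frac\alpha z}\sigma^{\frac{1-\alpha}{2z}})^z\big]$, and the $\alpha$-$z$ information matrix has entries $[I_{\alpha,z}(\theta)]_{i,j}:=\frac1\alpha\left.\frac{\partial^2}{\partial\varepsilon_i\partial\varepsilon_j}D_{\alpha,z}(\rho(\theta)\|\rho(\theta+\varepsilon))\right|_{\varepsilon=0}$. Notation: $\langle X\rangle_\rho:=\mathrm{Tr}[X\rho]$, $\{A,B\}:=AB+BA$, and $(p*p_{\alpha,z})(t)=\int_{-\infty}^\infty d\tau\,p(\tau)p_{\alpha,z}(t-\tau)$. The densities $p,p_{\alpha,z}$ have an integrable logarithmic singularity at $t=0$. *)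

theory Defs
  imports "HOL-Analysis.Analysis"
begin

text \<open>
  Operators on a finite-dimensional (nonzero) Hilbert space are complex square matrices
  indexed by a finite type; parameters \<open>\<theta>\<close> are vectors in \<open>real ^ 'l\<close>.
\<close>

type_synonym 'n cmat = "complex ^ 'n ^ 'n"

definition smult_mat :: "complex \<Rightarrow> 'n::finite cmat \<Rightarrow> 'n cmat" where
  "smult_mat c A = (\<chi> i j. c * A $ i $ j)"

definition conj_transpose :: "'n::finite cmat \<Rightarrow> 'n cmat" where
  "conj_transpose A = (\<chi> i j. cnj (A $ j $ i))"

definition hermitian_mat :: "'n::finite cmat \<Rightarrow> bool" where
  "hermitian_mat A \<longleftrightarrow> conj_transpose A = A"

definition unitary_mat :: "'n::finite cmat \<Rightarrow> bool" where
  "unitary_mat U \<longleftrightarrow> conj_transpose U ** U = mat 1 \<and> U ** conj_transpose U = mat 1"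

definition mat_power :: "'n::finite cmat \<Rightarrow> nat \<Rightarrow> 'n cmat" where
  "mat_power A k = (((**) A) ^^ k) (mat 1)"

definition mat_exp :: "'n::finite cmat \<Rightarrow> 'n cmat" where
  "mat_exp A = (\<Sum>k. mat_power A k /\<^sub>R fact k)"

definition real_diag :: "('n::finite \<Rightarrow> real) \<Rightarrow> 'n cmat" where
  "real_diag d = (\<chi> i j. if i = j then complex_of_real (d i) else 0)"

text \<open>
  Functional calculus of Hermitian matrices. By the spectral theorem a matrix \<open>B\<close> as below
  exists for Hermitian \<open>A\<close>, and it does not depend on the chosen diagonalization;
  for other matrices the value is unspecified.
\<close>

definition mat_fun :: "(real \<Rightarrow> real) \<Rightarrow> 'n::finite cmat \<Rightarrow> 'n cmat" where
  "mat_fun f A = (THE B. \<exists>U d. unitary_mat U \<and>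
      A = U ** real_diag d ** conj_transpose U \<and>
      B = U ** real_diag (\<lambda>i. f (d i)) ** conj_transpose U)"

text \<open>Real powers, used for positive definite matrices only.\<close>

definition mat_powr :: "'n::finite cmat \<Rightarrow> real \<Rightarrow> 'n cmat" where
  "mat_powr A r = mat_fun (\<lambda>x. x powr r) A"

text \<open>
  For positive definite \<open>\<rho>\<close> and \<open>\<sigma>\<close> the trace below is a positive real number, so that taking
  its real part loses nothing.
\<close>

definition renyi_az :: "real \<Rightarrow> real \<Rightarrow> 'n::finite cmat \<Rightarrow> 'n cmat \<Rightarrow> real" where
  "renyi_az \<alpha> z \<rho> \<sigma> = 1 / (\<alpha> - 1) * ln (Re (trace (mat_powr
      (mat_powr \<sigma> ((1 - \<alpha>) / (2 * z)) ** mat_powr \<rho> (\<alpha> / z) ** mat_powr \<sigma> ((1 - \<alpha>) / (2 * z))) z)))"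

definition hamiltonian :: "('l::finite \<Rightarrow> 'n::finite cmat) \<Rightarrow> real ^ 'l \<Rightarrow> 'n cmat" where
  "hamiltonian H \<theta> = (\<Sum>j\<in>UNIV. (\<theta> $ j) *\<^sub>R H j)"

definition gibbs :: "('l::finite \<Rightarrow> 'n::finite cmat) \<Rightarrow> real ^ 'l \<Rightarrow> 'n cmat" where
  "gibbs H \<theta> = smult_mat (1 / trace (mat_exp (- hamiltonian H \<theta>))) (mat_exp (- hamiltonian H \<theta>))"

text \<open>
  Partial derivatives. Since \<^const>\<open>deriv\<close> is a total function, existence is expressed by a
  separate predicate.
\<close>

definition partial_differentiable :: "'l::finite \<Rightarrow> (real ^ 'l \<Rightarrow> real) \<Rightarrow> real ^ 'l \<Rightarrow> bool" where
  "partial_differentiable i f x \<longleftrightarrow> (\<lambda>s. f (x + s *\<^sub>R axis i 1)) field_differentiable (at 0)"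

definition partial_deriv :: "'l::finite \<Rightarrow> (real ^ 'l \<Rightarrow> real) \<Rightarrow> real ^ 'l \<Rightarrow> real" where
  "partial_deriv i f x = deriv (\<lambda>s. f (x + s *\<^sub>R axis i 1)) 0"

definition has_second_partials :: "(real ^ 'l::finite \<Rightarrow> real) \<Rightarrow> real ^ 'l \<Rightarrow> bool" where
  "has_second_partials f x \<longleftrightarrow>
     (\<forall>j. (\<forall>\<^sub>F y in nhds x. partial_differentiable j f y) \<and>
          (\<forall>i. partial_differentiable i (partial_deriv j f) x))"

definition info_matrix ::
  "real \<Rightarrow> real \<Rightarrow> (real ^ 'l::finite \<Rightarrow> 'n::finite cmat) \<Rightarrow> real ^ 'l \<Rightarrow> real ^ 'l ^ 'l" where
  "info_matrix \<alpha> z \<rho> \<theta> = (\<chi> i j. 1 / \<alpha> *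
     partial_deriv i (partial_deriv j (\<lambda>\<epsilon>. renyi_az \<alpha> z (\<rho> \<theta>) (\<rho> (\<theta> + \<epsilon>)))) 0)"

definition expect :: "'n::finite cmat \<Rightarrow> 'n cmat \<Rightarrow> complex" where
  "expect \<rho> X = trace (X ** \<rho>)"

definition anticomm :: "'n::finite cmat \<Rightarrow> 'n cmat \<Rightarrow> 'n cmat" where
  "anticomm A B = A ** B + B ** A"

definition prob_density :: "(real \<Rightarrow> real) \<Rightarrow> bool" where
  "prob_density f \<longleftrightarrow> f \<in> borel_measurable borel \<and> (\<forall>t. 0 \<le> f t) \<and> has_bochner_integral lborel f 1"

text \<open>
  Both densities have a logarithmic singularity at \<open>0\<close>; there division by zero and
  \<open>ln 0 = 0\<close> give them the irrelevant value \<open>0\<close>.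
\<close>

definition p_dens :: "real \<Rightarrow> real" where
  "p_dens t = 2 / pi * ln \<bar>cosh (pi * t / 2) / sinh (pi * t / 2)\<bar>"

definition p_az :: "real \<Rightarrow> real \<Rightarrow> real \<Rightarrow> real" where
  "p_az \<alpha> z t = z / (2 * pi * \<alpha> * (1 - \<alpha>)) * ln (1 + (sin (pi * \<alpha>) / sinh (pi * z * t))\<^sup>2)"

definition convolution :: "(real \<Rightarrow> real) \<Rightarrow> (real \<Rightarrow> real) \<Rightarrow> real \<Rightarrow> real" where
  "convolution f g t = (LINT \<tau>|lborel. f \<tau> * g (t - \<tau>))"

definition q_az :: "real \<Rightarrow> real \<Rightarrow> real \<Rightarrow> real" where
  "q_az \<alpha> z = convolution p_dens (p_az \<alpha> z)"

definition Phi :: "(real \<Rightarrow> real) \<Rightarrow> 'n::finite cmat \<Rightarrow> 'n cmat \<Rightarrow> 'n cmat" where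
  "Phi q K X = (LINT t|lborel. q t *\<^sub>R
     (mat_exp (smult_mat (- (\<i> * complex_of_real t)) K) ** X **
      mat_exp (smult_mat (\<i> * complex_of_real t) K)))"

text \<open>
  Quantum channels: linear, completely positive and trace-preserving maps. A block matrix
  with blocks \<open>X a b\<close> for \<open>a, b < m\<close> represents an operator on the tensor product with an
  \<open>m\<close>-dimensional ancilla, on which the ampliation of a map acts blockwise. Membership in
  \<open>\<real>\<^sub>\<ge>\<^sub>0\<close> makes the quadratic form real, so Hermiticity is implied.
\<close>

definition block_psd :: "nat \<Rightarrow> (nat \<Rightarrow> nat \<Rightarrow> 'n::finite cmat) \<Rightarrow> bool" where
  "block_psd m X \<longleftrightarrow> (\<forall>v :: nat \<Rightarrow> complex ^ 'n.
     (\<Sum>a<m. \<Sum>b<m. \<Sum>i\<in>UNIV. \<Sum>k\<in>UNIV. cnj (v a $ i) * X a b $ i $ k * v b $ k) \<in> \<real>\<^sub>\<ge>\<^sub>0)"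

definition quantum_channel :: "('n::finite cmat \<Rightarrow> 'n cmat) \<Rightarrow> bool" where
  "quantum_channel \<Phi> \<longleftrightarrow>
     (\<forall>X Y. \<Phi> (X + Y) = \<Phi> X + \<Phi> Y) \<and>
     (\<forall>c X. \<Phi> (smult_mat c X) = smult_mat c (\<Phi> X)) \<and>
     (\<forall>m X. block_psd m X \<longrightarrow> block_psd m (\<lambda>a b. \<Phi> (X a b))) \<and>
     (\<forall>X. trace (\<Phi> X) = trace X)"

end

theory Submission
  imports Defs
begin

text \<open>
  Put \<open>K = H(\<theta>)\<close> and \<open>K' = H(\<theta> + \<epsilon>)\<close>. Up to explicit normalizing terms the divergence is
  \<open>1 / (\<alpha> - 1) * ln T\<close> with \<open>T = Tr (G * exp (- (1 - \<alpha>) / z * K') * G) powr z\<close> and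
  \<open>G = exp (- \<alpha> / (2 z) * K)\<close>. Matrix functions satisfy the exact identity
  \<open>f(A) - f(B) = \<Sum> f[a, b] P\<^sub>a (A - B) Q\<^sub>b\<close> over the eigenprojections of \<open>A\<close> and \<open>B\<close>, where \<open>f[a, b]\<close>
  is a divided difference, and so their derivatives are Schur multipliers in an eigenbasis. In an
  eigenbasis of \<open>K\<close> the second derivative of \<open>T\<close> therefore has entries built from divided differences
  of exponentials, which collapse to
  \<open>4 z / (\<alpha> (1 - \<alpha>) w\<^sup>2) * tanh (w / 2) * sinh ((1 - \<alpha>) w / 2 z) * sinh (\<alpha> w / 2 z) / sinh (w / 2 z)\<close>
  at the difference \<open>w\<close> of two eigenvalues.

  This is the Fourier transform of \<open>q\<close>: expanding the logarithm,
  \<open>ln (1 + (sin (pi \<alpha>) / sinh u)\<^sup>2) = 2 * (\<Sum>n. (1 - cos (2 pi n \<alpha>)) / n * exp (- 2 n \<bar>u\<bar>))\<close>, reduces the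
  transform of the second density to the series \<open>\<Sum>n. cos (n x) / (n\<^sup>2 + v\<^sup>2)\<close>, and the first
  density is the second one for \<open>\<alpha> = z = 1/2\<close>. Since the channel conjugates by unitaries, it
  acts in the eigenbasis as multiplication by this Fourier transform.
\<close>

section \<open>Spectral theorem for Hermitian matrices\<close>

text \<open>Three obstacles shape the proof. Eigenvectors of \<open>K'\<close> need not vary
  continuously where eigenvalues cross, so none is ever differentiated. The matrix inside the trace
  has a power of \<open>\<sigma>\<close> on both sides and hence contains \<open>K'\<close> twice;
  it is similar to \<open>G * exp (- (1 - \<alpha>) / z * K') * G\<close>, which has the same traces
  of functions and contains \<open>K'\<close> once. Away from the base point this matrix does not
  commute with \<open>K'\<close>, but at the base point every operator is a function of
  \<open>K\<close>, so all first variations there are multipliers in one common eigenbasis.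

  The two densities have separate tasks. Up to sign, the difference quotient of
  \<open>exp (- x)\<close> is the logarithmic mean of the weights \<open>exp (- x)\<close> and
  \<open>exp (- y)\<close>, whereas the anticommutator brings in their arithmetic mean. The ratio of
  these means is \<open>tanh (w / 2) / (w / 2)\<close>, the transform of \<open>p\<close>. The
  remaining hyperbolic factor is the transform of the density that depends on
  \<open>\<alpha>\<close> and \<open>z\<close>. The product of expectations comes from the
  logarithms; the second derivatives of the partition function cancel.\<close>

abbreviation ct :: "'n::finite cmat \<Rightarrow> 'n cmat" where "ct \<equiv> conj_transpose"

lemma ct_nth [simp]: "ct A $ i $ j = cnj (A $ j $ i)"
  by (simp add: conj_transpose_def)

lemma ct_ct [simp]: "ct (ct A) = A"
  by (simp add: vec_eq_iff)

lemma ct_mult: "ct (A ** B) = ct B ** ct A"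
  by (simp add: vec_eq_iff matrix_matrix_mult_def mult.commute)

lemma ct_scaleR: "ct (r *\<^sub>R A) = r *\<^sub>R ct A"
  by (simp add: vec_eq_iff)

lemma ct_sum: "ct (sum f S) = (\<Sum>x\<in>S. ct (f x))"
  by (simp add: vec_eq_iff)

lemma real_diag_nth: "real_diag d $ i $ j = (if i = j then complex_of_real (d i) else 0)"
  by (simp add: real_diag_def)

lemma ct_real_diag [simp]: "ct (real_diag d) = real_diag d"
  by (auto simp: vec_eq_iff real_diag_nth)

lemma real_diag_mult_left_nth: "(real_diag d ** X) $ i $ j = complex_of_real (d i) * X $ i $ j"
  by (simp add: matrix_matrix_mult_def real_diag_nth if_distrib if_distribR sum.delta cong: if_cong)

lemma real_diag_mult_right_nth: "(X ** real_diag d) $ i $ j = X $ i $ j * complex_of_real (d j)"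
  by (simp add: matrix_matrix_mult_def real_diag_nth if_distrib if_distribR sum.delta' cong: if_cong)

lemma real_diag_mult: "real_diag d ** real_diag e = real_diag (\<lambda>i. d i * e i)"
  by (auto simp: vec_eq_iff real_diag_mult_left_nth) (auto simp: real_diag_nth)

lemma real_diag_1: "real_diag (\<lambda>i. 1) = mat 1"
  by (auto simp: vec_eq_iff real_diag_nth mat_def)

lemma real_diag_scaleR: "c *\<^sub>R real_diag d = real_diag (\<lambda>i. c * d i)"
  by (auto simp: vec_eq_iff real_diag_def) (simp_all add: scaleR_conv_of_real)

section \<open>The complex inner product and its real part\<close>

definition cinner :: "complex ^ 'n::finite \<Rightarrow> complex ^ 'n \<Rightarrow> complex" where
  "cinner x y = (\<Sum>i\<in>UNIV. cnj (x $ i) * y $ i)"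

lemma inner_eq_Re_cinner: "x \<bullet> y = Re (cinner x y)"
  by (simp add: inner_vec_def cinner_def inner_complex_def)

lemma cinner_self: "cinner x x = complex_of_real (x \<bullet> x)"
  by (simp add: inner_vec_def cinner_def complex_mult_cnj inner_complex_def mult.commute power2_eq_square[symmetric])

lemma cinner_add_right: "cinner x (y + w) = cinner x y + cinner x w"
  by (simp add: cinner_def sum.distrib algebra_simps)

lemma cinner_diff_right: "cinner x (y - w) = cinner x y - cinner x w"
  by (simp add: cinner_def sum_subtractf algebra_simps)

lemma cinner_scaleR_right: "cinner x (r *\<^sub>R y) = r *\<^sub>R cinner x y"
  by (simp add: cinner_def scaleR_sum_right)

lemma cinner_scaleR_left: "cinner (r *\<^sub>R x) y = r *\<^sub>R cinner x y"
  by (simp add: cinner_def scaleR_sum_right)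

lemma cinner_i_left: "cinner (\<i> *s x) y = - \<i> * cinner x y"
  by (simp add: cinner_def sum_distrib_left algebra_simps)

lemma cinner_commute: "cinner y x = cnj (cinner x y)"
  by (simp add: cinner_def mult.commute)

lemma cinner_matrix: "cinner x (A *v y) = cinner (ct A *v x) y"
proof -
  have "cinner x (A *v y) = (\<Sum>i\<in>UNIV. \<Sum>j\<in>UNIV. cnj (x $ i) * A $ i $ j * y $ j)"
    by (simp add: cinner_def matrix_vector_mult_def sum_distrib_left mult.assoc)
  also have "\<dots> = (\<Sum>j\<in>UNIV. \<Sum>i\<in>UNIV. cnj (x $ i) * A $ i $ j * y $ j)"
    by (rule sum.swap)
  also have "\<dots> = cinner (ct A *v x) y"
    by (simp add: cinner_def matrix_vector_mult_def sum_distrib_left mult_ac)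
  finally show ?thesis .
qed

lemma matrix_vector_scaleR: "A *v (r *\<^sub>R x) = r *\<^sub>R (A *v x)" for A :: "'n::finite cmat"
  by (simp add: vec_eq_iff matrix_vector_mult_def scaleR_sum_right)

lemma scaleR_vec_nth: "(r *\<^sub>R x) $ i = complex_of_real r * x $ i"
  by (simp only: vector_scaleR_component) (simp add: scaleR_conv_of_real)

lemma linear_matrix_vector: "linear (\<lambda>x. A *v x)" for A :: "'n::finite cmat"
  by (intro linearI) (simp_all add: matrix_vector_right_distrib matrix_vector_scaleR)

lemma continuous_on_matrix_vector [continuous_intros]:
  "continuous_on S f \<Longrightarrow> continuous_on S (\<lambda>x. A *v f x)" for A :: "'n::finite cmat"
  by (rule bounded_linear.continuous_on) (simp_all add: linear_matrix_vector flip: linear_conv_bounded_linear)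

text \<open>Real orthogonality to both \<open>v\<close> and \<open>\<i> *s v\<close> amounts to
  complex orthogonality to \<open>v\<close>. Doubling the set in this way still leaves fewer vectors
  than the real dimension \<open>2 * CARD('n)\<close>.\<close>

lemma complex_orthogonal_exists:
  fixes S :: "(complex ^ 'n::finite) set"
  assumes "finite S" and "card S < CARD('n)"
  obtains x where "x \<noteq> 0" "\<And>v. v \<in> S \<Longrightarrow> cinner v x = 0"
proof -
  let ?T = "S \<union> (\<lambda>v. \<i> *s v) ` S"
  have "dim (span ?T) \<le> card ?T"
    using assms by (simp add: dim_le_card')
  also have "card ?T \<le> card S + card S"
    using card_Un_le[of S "(\<lambda>v. \<i> *s v) ` S"] card_image_le[OF assms(1), of "\<lambda>v. \<i> *s v"] by linarith
  also have "\<dots> < DIM(complex ^ 'n)"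
    using assms by simp
  finally have "dim (span ?T) < DIM(complex ^ 'n)" .
  then obtain x where x: "x \<noteq> 0" "\<And>y. y \<in> span (span ?T) \<Longrightarrow> orthogonal x y"
    using orthogonal_to_subspace_exists by blast
  show thesis
  proof (rule that[OF x(1)])
    fix v assume v: "v \<in> S"
    have "orthogonal x v" "orthogonal x (\<i> *s v)"
      using v by (auto intro!: x(2) span_base)
    then have "v \<bullet> x = 0" "(\<i> *s v) \<bullet> x = 0"
      by (simp_all add: orthogonal_def inner_commute)
    then show "cinner v x = 0"
      by (simp add: inner_eq_Re_cinner cinner_i_left complex_eq_iff)
  qed
qed

text \<open>For small \<open>t\<close> the linear term dominates, so a nonnegative slope along which
  the functional never increases must be zero. This is the first-variation argument behind the
  eigenvalue equation below.\<close>

lemma quadratic_nonpos_imp_zero: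
  fixes a c :: real
  assumes "a \<ge> 0" and "\<And>t. t > 0 \<Longrightarrow> 2 * t * a + t\<^sup>2 * c \<le> 0"
  shows "a = 0"
proof (rule ccontr)
  assume "a \<noteq> 0"
  with assms have a: "a > 0" by simp
  define t where "t = a / (\<bar>c\<bar> + 1)"
  have t: "t > 0" using a by (simp add: t_def)
  have tc: "t * \<bar>c\<bar> < a"
    using a by (simp add: t_def field_simps)
  have "t * (2 * a + t * c) \<le> 0"
    using assms(2)[OF t] by (simp add: power2_eq_square algebra_simps)
  then have "2 * a + t * c \<le> 0"
    using t by (simp add: mult_le_0_iff)
  moreover have "- (t * c) \<le> t * \<bar>c\<bar>"
    using t by (metis abs_ge_minus_self abs_mult abs_of_pos)
  ultimately show False using tc a by linarith
qed

text \<open>The quadratic form \<open>(A *v x) \<bullet> x\<close> attains its maximum on the unit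
  sphere of the orthogonal complement \<open>W\<close> of \<open>S\<close>, which is compact. A
  maximizer is an eigenvector because \<open>W\<close> is invariant under \<open>A\<close>, the
  vectors in \<open>S\<close> being eigenvectors themselves.\<close>

lemma hermitian_eigenvector_orthogonal:
  fixes A :: "'n::finite cmat"
  assumes A: "hermitian_mat A" and S: "finite S" "card S < CARD('n)"
    and eig: "\<And>v. v \<in> S \<Longrightarrow> \<exists>l::real. A *v v = l *\<^sub>R v"
  obtains u l where "cinner u u = 1" "A *v u = (l::real) *\<^sub>R u" "\<And>v. v \<in> S \<Longrightarrow> cinner v u = 0"
proof -
  define W where "W = {x. \<forall>v\<in>S. cinner v x = 0}"
  have W_add: "x + y \<in> W" if "x \<in> W" "y \<in> W" for x y
    using that by (simp add: W_def cinner_add_right)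
  have W_diff: "x - y \<in> W" if "x \<in> W" "y \<in> W" for x y
    using that by (simp add: W_def cinner_diff_right)
  have W_scale: "r *\<^sub>R x \<in> W" if "x \<in> W" for x and r :: real
    using that by (simp add: W_def cinner_scaleR_right)
  have W_A: "A *v x \<in> W" if x: "x \<in> W" for x
    unfolding W_def
  proof safe
    fix v assume v: "v \<in> S"
    obtain l :: real where l: "A *v v = l *\<^sub>R v" using eig[OF v] by blast
    have "cinner v (A *v x) = cinner (A *v v) x"
      using A by (simp add: cinner_matrix hermitian_mat_def)
    then show "cinner v (A *v x) = 0"
      using x v by (simp add: l cinner_scaleR_left W_def)
  qed
  have sym: "(A *v x) \<bullet> y = x \<bullet> (A *v y)" for x y
    using A by (simp add: inner_eq_Re_cinner cinner_matrix hermitian_mat_def)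
  obtain x where "x \<noteq> 0" "\<And>v. v \<in> S \<Longrightarrow> cinner v x = 0"
    using complex_orthogonal_exists[OF S] by metis
  then have x: "x \<noteq> 0" "x \<in> W" by (simp_all add: W_def)
  let ?C = "sphere 0 1 \<inter> W"
  have "W = (\<Inter>v\<in>S. {x. cinner v x = 0})"
    by (auto simp: W_def)
  then have "closed W"
    by (auto simp: cinner_def intro!: closed_INT closed_Collect_eq continuous_intros)
  then have C: "compact ?C"
    by (intro compact_Int_closed compact_sphere)
  have "(1 / norm x) *\<^sub>R x \<in> ?C"
    using x W_scale by simp
  then have "?C \<noteq> {}" by blast
  moreover have "continuous_on ?C (\<lambda>x. (A *v x) \<bullet> x)"
    by (intro continuous_intros)
  ultimately obtain u where u: "u \<in> ?C" "\<And>y. y \<in> ?C \<Longrightarrow> (A *v y) \<bullet> y \<le> (A *v u) \<bullet> u"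
    using continuous_attains_sup[OF C] by blast
  define l where "l = (A *v u) \<bullet> u"
  have uu: "u \<bullet> u = 1" using u(1) by (simp add: norm_eq_1)
  have le: "(A *v y) \<bullet> y \<le> l * (y \<bullet> y)" if y: "y \<in> W" for y
  proof (cases "y = 0")
    case False
    have "(1 / norm y) *\<^sub>R y \<in> ?C"
      using False y W_scale by simp
    from u(2)[OF this] have "(A *v y) \<bullet> y / (norm y)\<^sup>2 \<le> l"
      by (simp add: matrix_vector_scaleR l_def power2_eq_square)
    then show ?thesis
      using False by (simp add: field_simps power2_norm_eq_inner)
  qed (simp add: matrix_vector_mult_def)
  \<comment> \<open>The residual of the eigenvalue equation serves as the direction of variation: it
    stays in \<open>W\<close>, and the first-order change of the form along it is twice its own
    squared norm.\<close>
  define w where "w = A *v u - l *\<^sub>R u"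
  have wW: "w \<in> W"
    unfolding w_def using u(1) by (intro W_diff W_A W_scale) auto
  define c where "c = (A *v w) \<bullet> w - l * (w \<bullet> w)"
  have "w \<bullet> w = 0"
  proof (rule quadratic_nonpos_imp_zero[of _ c])
    fix t :: real assume "t > 0"
    have "u + t *\<^sub>R w \<in> W"
      using u(1) wW by (intro W_add W_scale) auto
    from le[OF this]
    have *: "(A *v u + t *\<^sub>R (A *v w)) \<bullet> (u + t *\<^sub>R w) \<le> l * ((u + t *\<^sub>R w) \<bullet> (u + t *\<^sub>R w))"
      by (simp add: matrix_vector_right_distrib matrix_vector_scaleR)
    have **: "(A *v w) \<bullet> u = (A *v u) \<bullet> w"
      using sym[of w u] by (simp add: inner_commute)
    have ww: "w \<bullet> w = (A *v u) \<bullet> w - l * (u \<bullet> w)"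
      by (subst (1) w_def) (simp add: inner_diff_left)
    have "2 * t * (w \<bullet> w) = 2 * t * ((A *v u) \<bullet> w) - 2 * t * (l * (u \<bullet> w))"
      by (subst ww) (simp add: algebra_simps)
    then show "2 * t * (w \<bullet> w) + t\<^sup>2 * c \<le> 0"
      using * unfolding c_def
      by (simp add: inner_add_left inner_add_right ** uu l_def[symmetric] inner_commute[of w u] algebra_simps power2_eq_square)
  qed simp
  then have "A *v u = l *\<^sub>R u" by (simp add: w_def)
  moreover have "cinner u u = 1" using uu by (simp add: cinner_self)
  moreover have "cinner v u = 0" if "v \<in> S" for v using u(1) that by (auto simp: W_def)
  ultimately show thesis using that by blast
qed

lemma hermitian_orthonormal_eigenvectors:
  fixes A :: "'n::finite cmat"
  assumes A: "hermitian_mat A" and "k \<le> CARD('n)"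
  shows "\<exists>S. finite S \<and> card S = k \<and> (\<forall>v\<in>S. \<exists>l::real. A *v v = l *\<^sub>R v) \<and>
           (\<forall>v\<in>S. cinner v v = 1) \<and> (\<forall>v\<in>S. \<forall>w\<in>S. v \<noteq> w \<longrightarrow> cinner v w = 0)"
  using assms(2)
proof (induction k)
  case 0
  show ?case by (intro exI[of _ "{}"]) auto
next
  case (Suc k)
  then obtain S where S: "finite S" "card S = k" "\<And>v. v \<in> S \<Longrightarrow> \<exists>l::real. A *v v = l *\<^sub>R v"
    "\<forall>v\<in>S. cinner v v = 1" "\<forall>v\<in>S. \<forall>w\<in>S. v \<noteq> w \<longrightarrow> cinner v w = 0"
    by auto
  obtain u l where u: "cinner u u = 1" "A *v u = (l::real) *\<^sub>R u" "\<And>v. v \<in> S \<Longrightarrow> cinner v u = 0"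
    using hermitian_eigenvector_orthogonal[OF A S(1) _ S(3)] S(2) Suc.prems by auto
  have "u \<notin> S" using u(1,3) by fastforce
  moreover have "cinner u v = 0" if "v \<in> S" for v
    using u(3)[OF that] by (metis cinner_commute complex_cnj_zero)
  ultimately show ?case
    using S u by (intro exI[of _ "insert u S"]) auto
qed

definition diagonalizes :: "'n::finite cmat \<Rightarrow> ('n \<Rightarrow> real) \<Rightarrow> 'n cmat \<Rightarrow> bool" where
  "diagonalizes U d A \<longleftrightarrow> unitary_mat U \<and> A = U ** real_diag d ** ct U"

theorem hermitian_diagonalizable:
  fixes A :: "'n::finite cmat"
  assumes "hermitian_mat A"
  obtains U d where "diagonalizes U d A"
proof -
  obtain S where S: "finite S" "card S = CARD('n)" "\<forall>v\<in>S. \<exists>l::real. A *v v = l *\<^sub>R v"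
    "\<forall>v\<in>S. cinner v v = 1" "\<forall>v\<in>S. \<forall>w\<in>S. v \<noteq> w \<longrightarrow> cinner v w = 0"
    using hermitian_orthonormal_eigenvectors[OF assms order.refl] by blast
  obtain f where f: "bij_betw f (UNIV :: 'n set) S"
    using finite_same_card_bij[of "UNIV :: 'n set" S] S by auto
  then have fS: "f j \<in> S" for j by (auto simp: bij_betw_def)
  then have "\<forall>j. \<exists>l::real. A *v f j = l *\<^sub>R f j" using S(3) by blast
  then obtain d where d: "A *v f j = (d j :: real) *\<^sub>R f j" for j
    using choice[of "\<lambda>j l. A *v f j = l *\<^sub>R f j"] by blast
  define U :: "'n cmat" where "U = (\<chi> i j. f j $ i)"
  have inj: "f i = f j \<longleftrightarrow> i = j" for i j using f by (auto simp: bij_betw_def inj_on_def)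
  have "(ct U ** U) $ i $ j = cinner (f i) (f j)" for i j
    by (simp add: matrix_matrix_mult_def U_def cinner_def)
  then have 1: "ct U ** U = mat 1"
    using S(4,5) fS by (subst vec_eq_iff, subst vec_eq_iff) (simp add: mat_def inj)
  then have 2: "U ** ct U = mat 1" by (simp add: matrix_left_right_inverse)
  have "(A ** U) $ i $ j = (A *v f j) $ i" for i j
    by (simp add: matrix_matrix_mult_def U_def matrix_vector_mult_def)
  then have "A ** U = U ** real_diag d"
    by (simp add: vec_eq_iff real_diag_mult_right_nth d U_def scaleR_vec_nth mult.commute del: vector_scaleR_component)
  then have "A ** (U ** ct U) = U ** real_diag d ** ct U"
    by (simp add: matrix_mul_assoc)
  then show thesis
    using that[of U d] 1 2 by (simp add: diagonalizes_def unitary_mat_def)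
qed

section \<open>Functional calculus and its derivative\<close>

lemma matrix_add_rdistrib': "(A + B) ** C = A ** C + B ** C" for A :: "'n::finite cmat"
  by (simp add: vec_eq_iff matrix_matrix_mult_def sum.distrib algebra_simps)

lemma bounded_bilinear_matrix_mult: "bounded_bilinear ((**) :: 'n::finite cmat \<Rightarrow> 'n cmat \<Rightarrow> 'n cmat)"
  unfolding bilinear_conv_bounded_bilinear[symmetric] bilinear_def
  by (auto intro!: linearI simp: matrix_add_ldistrib matrix_add_rdistrib')
    (simp_all add: vec_eq_iff matrix_matrix_mult_def scaleR_sum_right)

lemmas tendsto_matrix_mult = bounded_bilinear.tendsto[OF bounded_bilinear_matrix_mult]
lemmas matrix_mult_scaleR_left = bounded_bilinear.scaleR_left[OF bounded_bilinear_matrix_mult]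
lemmas matrix_mult_scaleR_right = bounded_bilinear.scaleR_right[OF bounded_bilinear_matrix_mult]
lemmas matrix_mult_diff_left = bounded_bilinear.diff_left[OF bounded_bilinear_matrix_mult]
lemmas matrix_mult_diff_right = bounded_bilinear.diff_right[OF bounded_bilinear_matrix_mult]

lemma tendsto_ct: "(f \<longlongrightarrow> A) F \<Longrightarrow> ((\<lambda>x. ct (f x)) \<longlongrightarrow> ct A) F" for A :: "'n::finite cmat"
  by (intro vec_tendstoI) (simp, intro tendsto_intros)

lemma tendsto_real_diag:
  "(\<And>i. ((\<lambda>x. f x i) \<longlongrightarrow> d i) F) \<Longrightarrow> ((\<lambda>x. real_diag (f x)) \<longlongrightarrow> real_diag d) F"
  by (intro vec_tendstoI) (auto simp: real_diag_nth intro!: tendsto_intros)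

lemma unitary_ct_mult: "unitary_mat U \<Longrightarrow> ct U ** U = mat 1"
  and unitary_mult_ct: "unitary_mat U \<Longrightarrow> U ** ct U = mat 1"
  by (simp_all add: unitary_mat_def)

lemma unitary_cancel_left: "unitary_mat U \<Longrightarrow> U ** (ct U ** X) = X"
  by (simp add: matrix_mul_assoc unitary_mat_def)

lemma unitary_cancel_right: "unitary_mat U \<Longrightarrow> X ** U ** ct U = X"
  and unitary_cancel_right': "unitary_mat U \<Longrightarrow> X ** ct U ** U = X"
  by (simp_all add: matrix_mul_assoc[symmetric] unitary_mat_def)

lemma unitary_nth_le_1:
  assumes "unitary_mat U"
  shows "norm (U $ i $ j) \<le> 1"
proof -
  have "(ct U ** U) $ j $ j = complex_of_real (\<Sum>k\<in>UNIV. (norm (U $ k $ j))\<^sup>2)"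
    by (simp add: matrix_matrix_mult_def complex_norm_square mult.commute flip: of_real_power)
  then have "(\<Sum>k\<in>UNIV. (norm (U $ k $ j))\<^sup>2) = 1"
    using assms by (simp add: unitary_ct_mult mat_def del: of_real_sum of_real_power)
  moreover have "(norm (U $ i $ j))\<^sup>2 \<le> (\<Sum>k\<in>UNIV. (norm (U $ k $ j))\<^sup>2)"
    by (rule member_le_sum) auto
  ultimately show ?thesis
    by (simp add: power_le_one_iff abs_le_square_iff flip: abs_le_square_iff)
qed

lemma hermitian_diag: "diagonalizes U d A \<Longrightarrow> hermitian_mat A"
  by (simp add: diagonalizes_def hermitian_mat_def ct_mult matrix_mul_assoc)

lemma diagonalizes_unitary: "diagonalizes U d A \<Longrightarrow> unitary_mat U"
  by (simp add: diagonalizes_def)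

lemma diagonalizes_conj: "diagonalizes U d A \<Longrightarrow> ct U ** A ** U = real_diag d"
  by (simp add: diagonalizes_def matrix_mul_assoc unitary_ct_mult unitary_cancel_right')

lemma diagonalizes_mult: "diagonalizes U d A \<Longrightarrow> A ** U = U ** real_diag d"
  by (simp add: diagonalizes_def unitary_cancel_right')

lemma diagonalizes_ct_mult: "diagonalizes U d A \<Longrightarrow> ct U ** A = real_diag d ** ct U"
  by (simp add: diagonalizes_def matrix_mul_assoc unitary_ct_mult)

text \<open>Read in the two eigenbases, \<open>A ** X = X ** B\<close> says that
  \<open>d i - e j\<close> annihilates the entry of \<open>X\<close> at \<open>i, j\<close>.
  Independence of the chosen diagonalization rests on the case \<open>X = mat 1\<close>.\<close>

lemma diagonalizes_intertwine:
  assumes A: "diagonalizes U d A" and B: "diagonalizes V e B" and X: "A ** X = X ** B"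
    and nz: "(ct U ** X ** V) $ i $ j \<noteq> 0"
  shows "d i = e j"
proof -
  have "real_diag d ** (ct U ** X ** V) = ct U ** (A ** X) ** V"
    by (simp add: matrix_mul_assoc diagonalizes_ct_mult[OF A])
  also have "\<dots> = ct U ** X ** (B ** V)"
    by (simp add: X matrix_mul_assoc)
  also have "\<dots> = (ct U ** X ** V) ** real_diag e"
    by (simp add: matrix_mul_assoc diagonalizes_mult[OF B])
  finally have "(real_diag d ** (ct U ** X ** V)) $ i $ j = ((ct U ** X ** V) ** real_diag e) $ i $ j"
    by simp
  then show ?thesis
    using nz by (simp add: real_diag_mult_left_nth real_diag_mult_right_nth)
qed

text \<open>Only entries of \<open>X\<close> that join equal eigenvalues survive, and on those
  \<open>f (d i) = f (e j)\<close>. With \<open>X = mat 1\<close> this shows that the functional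
  calculus is well defined.\<close>

lemma mat_fun_form_intertwine:
  assumes A: "diagonalizes U d A" and B: "diagonalizes V e B" and X: "A ** X = X ** B"
  shows "(U ** real_diag (\<lambda>i. f (d i)) ** ct U) ** X = X ** (V ** real_diag (\<lambda>i. f (e i)) ** ct V)"
proof -
  note U = diagonalizes_unitary[OF A] and V = diagonalizes_unitary[OF B]
  let ?W = "ct U ** X ** V"
  have *: "real_diag (\<lambda>i. f (d i)) ** ?W = ?W ** real_diag (\<lambda>i. f (e i))"
  proof -
    have "complex_of_real (f (d i)) * ?W $ i $ j = ?W $ i $ j * complex_of_real (f (e j))" for i j
      using diagonalizes_intertwine[OF A B X, of i j] by (cases "?W $ i $ j = 0") auto
    then show ?thesis
      by (simp add: vec_eq_iff real_diag_mult_left_nth real_diag_mult_right_nth)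
  qed
  have "U ** (real_diag (\<lambda>i. f (d i)) ** ?W) ** ct V = U ** (?W ** real_diag (\<lambda>i. f (e i))) ** ct V"
    by (simp only: *)
  then show ?thesis
    by (simp add: matrix_mul_assoc unitary_cancel_right[OF V] unitary_mult_ct[OF U])
qed

lemma mat_fun_eq:
  assumes "diagonalizes U d A"
  shows "mat_fun f A = U ** real_diag (\<lambda>i. f (d i)) ** ct U"
  unfolding mat_fun_def
proof (rule the_equality)
  show "\<exists>U' d'. unitary_mat U' \<and> A = U' ** real_diag d' ** ct U' \<and>
      U ** real_diag (\<lambda>i. f (d i)) ** ct U = U' ** real_diag (\<lambda>i. f (d' i)) ** ct U'"
    using assms[unfolded diagonalizes_def] by (intro exI[of _ U] exI[of _ d] conjI) auto
next
  fix B assume "\<exists>U' d'. unitary_mat U' \<and> A = U' ** real_diag d' ** ct U' \<and>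
      B = U' ** real_diag (\<lambda>i. f (d' i)) ** ct U'"
  then obtain U' d' where 1: "unitary_mat U'" "A = U' ** real_diag d' ** ct U'"
    and B: "B = U' ** real_diag (\<lambda>i. f (d' i)) ** ct U'"
    by (elim exE conjE)
  from 1 have "diagonalizes U' d' A" unfolding diagonalizes_def by (rule conjI)
  from mat_fun_form_intertwine[OF this assms, of "mat 1" f]
  show "B = U ** real_diag (\<lambda>i. f (d i)) ** ct U" by (simp add: B)
qed

lemma diagonalizes_mat_fun:
  "diagonalizes U d A \<Longrightarrow> diagonalizes U (\<lambda>i. f (d i)) (mat_fun f A)"
  by (simp add: mat_fun_eq) (simp add: diagonalizes_def)

lemma hermitian_mat_fun: "hermitian_mat A \<Longrightarrow> hermitian_mat (mat_fun f A)"
  by (metis diagonalizes_mat_fun hermitian_diag hermitian_diagonalizable)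

lemma mat_fun_compose:
  assumes "hermitian_mat A"
  shows "mat_fun f (mat_fun g A) = mat_fun (\<lambda>x. f (g x)) A"
proof -
  obtain U d where d: "diagonalizes U d A" using hermitian_diagonalizable[OF assms] .
  show ?thesis
    unfolding mat_fun_eq[OF d, of "\<lambda>x. f (g x)"] by (rule mat_fun_eq[OF diagonalizes_mat_fun[OF d]])
qed

lemma mat_fun_mult:
  assumes "hermitian_mat A"
  shows "mat_fun f A ** mat_fun g A = mat_fun (\<lambda>x. f x * g x) A"
proof -
  obtain U d where d: "diagonalizes U d A" using hermitian_diagonalizable[OF assms] .
  then have U: "unitary_mat U" by (rule diagonalizes_unitary)
  have "mat_fun f A ** mat_fun g A = U ** real_diag (\<lambda>i. f (d i)) ** (ct U ** U) ** real_diag (\<lambda>i. g (d i)) ** ct U"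
    by (simp add: mat_fun_eq[OF d] matrix_mul_assoc)
  also have "\<dots> = U ** (real_diag (\<lambda>i. f (d i)) ** real_diag (\<lambda>i. g (d i))) ** ct U"
    by (simp add: unitary_ct_mult[OF U] matrix_mul_assoc)
  finally show ?thesis
    by (simp add: mat_fun_eq[OF d] real_diag_mult)
qed

lemma mat_fun_scaleR:
  assumes "hermitian_mat A"
  shows "c *\<^sub>R mat_fun f A = mat_fun (\<lambda>x. c * f x) A"
proof -
  obtain U d where d: "diagonalizes U d A" using hermitian_diagonalizable[OF assms] .
  show ?thesis
    unfolding mat_fun_eq[OF d] real_diag_scaleR[symmetric] by (simp add: matrix_mult_scaleR_left matrix_mult_scaleR_right)
qed

lemma mat_fun_1:
  assumes "hermitian_mat A"
  shows "mat_fun (\<lambda>x. 1) A = mat 1"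
proof -
  obtain U d where d: "diagonalizes U d A" using hermitian_diagonalizable[OF assms] .
  show ?thesis
    by (simp add: mat_fun_eq[OF d] real_diag_1 unitary_mult_ct[OF diagonalizes_unitary[OF d]])
qed

text \<open>Ranging over all diagonalizations puts \<open>d i\<close> into the set for whichever
  diagonalization is at hand.\<close>

definition eigvals :: "'n::finite cmat \<Rightarrow> real set" where
  "eigvals A = {x. \<exists>U d i. diagonalizes U d A \<and> x = d i}"

lemma mat_fun_intertwine:
  assumes "hermitian_mat A" "hermitian_mat B" "A ** X = X ** B"
  shows "mat_fun f A ** X = X ** mat_fun f B"
proof -
  obtain U d where d: "diagonalizes U d A" using hermitian_diagonalizable[OF assms(1)] .
  obtain V e where e: "diagonalizes V e B" using hermitian_diagonalizable[OF assms(2)] .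
  show ?thesis using mat_fun_form_intertwine[OF d e assms(3)] by (simp add: mat_fun_eq[OF d] mat_fun_eq[OF e])
qed

lemma mat_fun_scaled_arg:
  assumes "hermitian_mat A"
  shows "mat_fun f (c *\<^sub>R A) = mat_fun (\<lambda>x. f (c * x)) A"
proof -
  obtain U d where d: "diagonalizes U d A" using hermitian_diagonalizable[OF assms] .
  have "diagonalizes U (\<lambda>i. c * d i) (c *\<^sub>R A)"
    using d unfolding diagonalizes_def real_diag_scaleR[symmetric]
    by (simp add: matrix_mult_scaleR_left matrix_mult_scaleR_right)
  from mat_fun_eq[OF this] show ?thesis by (simp add: mat_fun_eq[OF d])
qed

section \<open>Double operator integrals\<close>

definition schur_form ::
  "(real \<Rightarrow> real \<Rightarrow> real) \<Rightarrow> 'n::finite cmat \<Rightarrow> ('n \<Rightarrow> real) \<Rightarrow> 'n cmat \<Rightarrow> ('n \<Rightarrow> real) \<Rightarrow> 'n cmat \<Rightarrow> 'n cmat" where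
  "schur_form \<phi> U d V e X =
     U ** (\<chi> i j. complex_of_real (\<phi> (d i) (e j)) * (ct U ** X ** V) $ i $ j) ** ct V"

text \<open>A double operator integral: \<open>\<phi>\<close> evaluated at the spectra of \<open>A\<close> (acting from the left) and
  \<open>B\<close> (from the right). The value does not depend on the diagonalizations, so the choice operator
  is harmless for Hermitian \<open>A\<close> and \<open>B\<close>.\<close>
definition schur :: "(real \<Rightarrow> real \<Rightarrow> real) \<Rightarrow> 'n::finite cmat \<Rightarrow> 'n cmat \<Rightarrow> 'n cmat \<Rightarrow> 'n cmat" where
  "schur \<phi> A B X = (SOME Y. \<exists>U d V e. diagonalizes U d A \<and> diagonalizes V e B \<and> Y = schur_form \<phi> U d V e X)"

text \<open>The transition matrices \<open>P\<close> and \<open>Q\<close> between two eigenbases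
  have nonzero entries only between equal eigenvalues. The factor \<open>\<phi>\<close> is therefore
  constant along every nonzero term and can be moved through them.\<close>

lemma schur_form_unique:
  assumes A: "diagonalizes U d A" "diagonalizes U' d' A" and B: "diagonalizes V e B" "diagonalizes V' e' B"
  shows "schur_form \<phi> U d V e X = schur_form \<phi> U' d' V' e' X"
proof -
  note U = diagonalizes_unitary[OF A(1)] and U' = diagonalizes_unitary[OF A(2)]
    and V = diagonalizes_unitary[OF B(1)] and V' = diagonalizes_unitary[OF B(2)]
  define P Q Y where "P = ct U' ** U" and "Q = ct V ** V'" and "Y = ct U ** X ** V"
  have P: "P $ i $ j \<noteq> 0 \<Longrightarrow> d' i = d j" for i j
    using diagonalizes_intertwine[OF A(2) A(1), of "mat 1" i j] by (simp add: P_def)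
  have Q: "Q $ i $ j \<noteq> 0 \<Longrightarrow> e i = e' j" for i j
    using diagonalizes_intertwine[OF B, of "mat 1" i j] by (simp add: Q_def)
  have PYQ: "ct U' ** X ** V' = P ** Y ** Q"
    by (simp add: P_def Q_def Y_def matrix_mul_assoc unitary_cancel_right[OF U] unitary_cancel_right[OF V])
  have Pn: "(P ** Z ** Q) $ i $ l = (\<Sum>k\<in>UNIV. \<Sum>j\<in>UNIV. P $ i $ j * Z $ j $ k * Q $ k $ l)" for Z i l
    by (simp add: matrix_matrix_mult_def sum_distrib_right)
  have "(\<chi> i j. complex_of_real (\<phi> (d' i) (e' j)) * (P ** Y ** Q) $ i $ j)
      = P ** (\<chi> i j. complex_of_real (\<phi> (d i) (e j)) * Y $ i $ j) ** Q"
  proof -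
    have "complex_of_real (\<phi> (d' i) (e' l)) * (P $ i $ j * Y $ j $ k * Q $ k $ l)
        = P $ i $ j * (complex_of_real (\<phi> (d j) (e k)) * Y $ j $ k) * Q $ k $ l" for i j k l
      using P[of i j] Q[of k l] by (cases "P $ i $ j = 0"; cases "Q $ k $ l = 0") auto
    then show ?thesis
      unfolding vec_eq_iff Pn vec_lambda_beta sum_distrib_left by (intro allI sum.cong refl)
  qed
  then have "schur_form \<phi> U' d' V' e' X
      = U' ** (P ** (\<chi> i j. complex_of_real (\<phi> (d i) (e j)) * Y $ i $ j) ** Q) ** ct V'"
    by (simp add: schur_form_def PYQ)
  also have "\<dots> = schur_form \<phi> U d V e X"
    by (simp add: schur_form_def P_def Q_def matrix_mul_assoc unitary_mult_ct[OF U'] unitary_cancel_right[OF V'] flip: Y_def)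
  finally show ?thesis by simp
qed

lemma schur_eq:
  assumes "diagonalizes U d A" "diagonalizes V e B"
  shows "schur \<phi> A B X = schur_form \<phi> U d V e X"
  unfolding schur_def
  by (rule some_equality) (use assms schur_form_unique in blast)+

section \<open>Compactness of diagonalizations and continuity of double operator integrals\<close>

lemma tendsto_subsequence_criterion:
  fixes f :: "nat \<Rightarrow> 'a::metric_space"
  assumes "\<And>r :: nat \<Rightarrow> nat. strict_mono r \<Longrightarrow> \<exists>s :: nat \<Rightarrow> nat. strict_mono s \<and> (\<lambda>n. f (r (s n))) \<longlonglongrightarrow> l"
  shows "f \<longlonglongrightarrow> l"
proof (rule ccontr)
  assume "\<not> f \<longlonglongrightarrow> l"
  then obtain \<epsilon> where \<epsilon>: "\<epsilon> > 0" "\<not> (\<forall>\<^sub>F n in sequentially. dist (f n) l < \<epsilon>)"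
    by (auto simp: tendsto_iff)
  obtain r where r: "strict_mono (r :: nat \<Rightarrow> nat)" "\<forall>n. \<not> dist (f (r n)) l < \<epsilon>"
    using not_eventually_sequentiallyD[OF \<epsilon>(2)] by blast
  obtain s where "(\<lambda>n. f (r (s n))) \<longlonglongrightarrow> l" using assms[OF r(1)] by auto
  then have "\<forall>\<^sub>F n in sequentially. dist (f (r (s n))) l < \<epsilon>" using \<epsilon>(1) by (rule tendstoD)
  then show False using r(2) by auto
qed

lemma norm_cmat_le:
  assumes "\<And>i j. norm (U $ i $ j) \<le> c"
  shows "norm (U :: 'n::finite cmat) \<le> (\<Sum>i\<in>(UNIV::'n set). \<Sum>j\<in>(UNIV::'n set). c)"
proof -
  have "norm U \<le> (\<Sum>i\<in>UNIV. norm (U $ i))"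
    by (simp add: norm_vec_def L2_set_le_sum)
  also have "\<dots> \<le> (\<Sum>i\<in>UNIV. \<Sum>j\<in>UNIV. norm (U $ i $ j))"
    by (intro sum_mono) (simp add: norm_vec_def L2_set_le_sum)
  also have "\<dots> \<le> (\<Sum>i\<in>(UNIV::'n set). \<Sum>j\<in>(UNIV::'n set). c)"
    by (intro sum_mono assms)
  finally show ?thesis .
qed

lemma bounded_unitary: "bounded {U :: 'n::finite cmat. unitary_mat U}"
  using norm_cmat_le[OF unitary_nth_le_1] unfolding bounded_iff by blast

lemma diagonal_le_norm:
  fixes A :: "'n::finite cmat"
  assumes "diagonalizes U d A"
  shows "\<bar>d i\<bar> \<le> (\<Sum>j\<in>(UNIV::'n set). \<Sum>k\<in>(UNIV::'n set). norm A)"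
proof -
  note U = diagonalizes_unitary[OF assms]
  have "complex_of_real (d i) = (ct U ** A ** U) $ i $ i"
    by (simp add: diagonalizes_conj[OF assms] real_diag_nth)
  also have "\<dots> = (\<Sum>j\<in>UNIV. \<Sum>k\<in>UNIV. cnj (U $ k $ i) * A $ k $ j * U $ j $ i)"
    by (simp add: matrix_matrix_mult_def sum_distrib_right)
  also have "norm \<dots> \<le> (\<Sum>j\<in>(UNIV::'n set). \<Sum>k\<in>(UNIV::'n set). 1 * norm A * 1)"
    by (intro sum_norm_le, unfold norm_mult, intro mult_mono)
      (auto intro: unitary_nth_le_1[OF U] order.trans[OF Finite_Cartesian_Product.norm_nth_le Finite_Cartesian_Product.norm_nth_le])
  finally show ?thesis by simp
qed

text \<open>The unitary and the eigenvalues are paired in one Euclidean space so that a single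
  subsequence makes both converge.\<close>

lemma diagonalizes_bounded:
  assumes "convergent A" "\<And>n. diagonalizes (U n) (d n) (A n)"
  shows "bounded (range (\<lambda>n. (U n, (\<chi> i. d n i) :: real ^ 'n::finite)))"
proof -
  have "bounded (range A)"
    using assms(1) by (auto simp: convergent_def intro: convergent_imp_bounded)
  then obtain b where b: "norm (A n) \<le> b" for n by (auto simp: bounded_iff)
  have "norm ((\<chi> i. d n i) :: real ^ 'n) \<le> (\<Sum>i\<in>(UNIV::'n set). \<Sum>j\<in>(UNIV::'n set). \<Sum>k\<in>(UNIV::'n set). b)" for n
  proof -
    have "norm ((\<chi> i. d n i) :: real ^ 'n) \<le> (\<Sum>i\<in>UNIV. \<bar>d n i\<bar>)"
      using norm_le_l1_cart[of "(\<chi> i. d n i) :: real ^ 'n"] by simp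
    also have "\<dots> \<le> (\<Sum>i\<in>(UNIV::'n set). \<Sum>j\<in>(UNIV::'n set). \<Sum>k\<in>(UNIV::'n set). b)"
      by (intro sum_mono order.trans[OF diagonal_le_norm[OF assms(2)]] b)
    finally show ?thesis .
  qed
  then have "bounded (range (\<lambda>n. (\<chi> i. d n i) :: real ^ 'n))"
    unfolding bounded_iff by blast
  moreover have "bounded (range U)"
    by (rule bounded_subset[OF bounded_unitary]) (use assms(2) diagonalizes_unitary in blast)
  ultimately have "bounded (range U \<times> range (\<lambda>n. (\<chi> i. d n i) :: real ^ 'n))"
    by (rule bounded_Times[rotated])
  then show ?thesis by (rule bounded_subset) auto
qed

lemma diagonalizes_subsequence:
  fixes A :: "nat \<Rightarrow> 'n::finite cmat"
  assumes A: "A \<longlonglongrightarrow> A0" and UA: "\<And>n. diagonalizes (U n) (d n) (A n)"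
  obtains r U0 d0 where "strict_mono (r :: nat \<Rightarrow> nat)" "(\<lambda>n. U (r n)) \<longlonglongrightarrow> U0"
    "\<And>i. (\<lambda>n. d (r n) i) \<longlonglongrightarrow> d0 i" "diagonalizes U0 d0 A0"
proof -
  have "bounded (range (\<lambda>n. (U n, (\<chi> i. d n i) :: real ^ 'n)))"
    using A UA by (intro diagonalizes_bounded) (auto simp: convergent_def)
  then obtain l r where r: "strict_mono r" and lim: "((\<lambda>n. (U n, (\<chi> i. d n i) :: real ^ 'n)) \<circ> r) \<longlonglongrightarrow> l"
    using bounded_imp_convergent_subsequence by blast
  define U0 d0 where "U0 = fst l" and "d0 = (\<lambda>i. snd l $ i)"
  have U0: "(\<lambda>n. U (r n)) \<longlonglongrightarrow> U0"
    using tendsto_fst[OF lim] by (simp add: o_def U0_def)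
  have d0: "(\<lambda>n. d (r n) i) \<longlonglongrightarrow> d0 i" for i
    using tendsto_vec_nth[OF tendsto_snd[OF lim], of i] by (simp add: o_def d0_def)
  have 1: "(\<lambda>n. ct (U (r n)) ** U (r n)) \<longlonglongrightarrow> ct U0 ** U0"
    "(\<lambda>n. U (r n) ** ct (U (r n))) \<longlonglongrightarrow> U0 ** ct U0"
    by (intro tendsto_matrix_mult tendsto_ct U0)+
  have 2: "ct (U (r n)) ** U (r n) = mat 1" "U (r n) ** ct (U (r n)) = mat 1" for n
    using UA diagonalizes_unitary unitary_ct_mult unitary_mult_ct by blast+
  have "unitary_mat U0"
    using 1 unfolding 2 unitary_mat_def by (simp add: LIMSEQ_const_iff)
  moreover have "(\<lambda>n. U (r n) ** real_diag (d (r n)) ** ct (U (r n))) \<longlonglongrightarrow> U0 ** real_diag d0 ** ct U0"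
    by (intro tendsto_matrix_mult tendsto_ct tendsto_real_diag U0 d0)
  then have "(\<lambda>n. A (r n)) \<longlonglongrightarrow> U0 ** real_diag d0 ** ct U0"
    using UA by (simp add: diagonalizes_def)
  then have "A0 = U0 ** real_diag d0 ** ct U0"
    using LIMSEQ_unique LIMSEQ_subseq_LIMSEQ[OF A r] by (fastforce simp: o_def)
  ultimately show thesis
    using that[OF r U0 d0] by (simp add: diagonalizes_def)
qed

text \<open>Eigenvectors need not converge along with the matrices; compactness of the unitary group
  gives convergent subsequences, and the limit does not depend on the diagonalization reached.\<close>
lemma schur_tendsto_sequentially:
  fixes A B X :: "nat \<Rightarrow> 'n::finite cmat"
  assumes A: "A \<longlonglongrightarrow> A0" "\<And>n. hermitian_mat (A n)" and B: "B \<longlonglongrightarrow> B0" "\<And>n. hermitian_mat (B n)"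
    and X: "X \<longlonglongrightarrow> X0"
    and cont: "\<And>x y. x \<in> eigvals A0 \<Longrightarrow> y \<in> eigvals B0 \<Longrightarrow> isCont (\<lambda>p. \<phi> (fst p) (snd p)) (x, y)"
  shows "(\<lambda>n. schur \<phi> (A n) (B n) (X n)) \<longlonglongrightarrow> schur \<phi> A0 B0 X0"
proof (rule tendsto_subsequence_criterion)
  fix r :: "nat \<Rightarrow> nat" assume r: "strict_mono r"
  have "\<exists>U d. diagonalizes U d (A n)" "\<exists>V e. diagonalizes V e (B n)" for n
    by (rule hermitian_diagonalizable[OF A(2)], blast) (rule hermitian_diagonalizable[OF B(2)], blast)
  then have "\<forall>n. \<exists>p. diagonalizes (fst p) (snd p) (A n)" "\<forall>n. \<exists>p. diagonalizes (fst p) (snd p) (B n)"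
    by auto
  then obtain pA pB where "\<forall>n. diagonalizes (fst (pA n)) (snd (pA n)) (A n)" "\<forall>n. diagonalizes (fst (pB n)) (snd (pB n)) (B n)"
    using choice[of "\<lambda>n p. diagonalizes (fst p) (snd p) (A n)"] choice[of "\<lambda>n p. diagonalizes (fst p) (snd p) (B n)"] by blast
  then obtain U d V e where UA: "\<And>n. diagonalizes (U n) (d n) (A n)" and VB: "\<And>n. diagonalizes (V n) (e n) (B n)"
    using that[of "\<lambda>n. fst (pA n)" "\<lambda>n. snd (pA n)" "\<lambda>n. fst (pB n)" "\<lambda>n. snd (pB n)"] by blast
  have Ar: "(\<lambda>n. A (r n)) \<longlonglongrightarrow> A0" using LIMSEQ_subseq_LIMSEQ[OF A(1) r] by (simp add: o_def)
  obtain s U0 d0 where s: "strict_mono (s :: nat \<Rightarrow> nat)" and U0: "(\<lambda>n. U (r (s n))) \<longlonglongrightarrow> U0"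
    and d0: "\<And>i. (\<lambda>n. d (r (s n)) i) \<longlonglongrightarrow> d0 i" and UA0: "diagonalizes U0 d0 A0"
    using diagonalizes_subsequence[OF Ar, of "\<lambda>n. U (r n)" "\<lambda>n. d (r n)", OF UA] by metis
  have rs: "strict_mono (\<lambda>n. r (s n))" using strict_mono_o[OF r s] by (simp add: o_def)
  have Bs: "(\<lambda>n. B (r (s n))) \<longlonglongrightarrow> B0" using LIMSEQ_subseq_LIMSEQ[OF B(1) rs] by (simp add: o_def)
  obtain t V0 e0 where t: "strict_mono (t :: nat \<Rightarrow> nat)" and V0: "(\<lambda>n. V (r (s (t n)))) \<longlonglongrightarrow> V0"
    and e0: "\<And>i. (\<lambda>n. e (r (s (t n))) i) \<longlonglongrightarrow> e0 i" and VB0: "diagonalizes V0 e0 B0"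
    using diagonalizes_subsequence[OF Bs, of "\<lambda>n. V (r (s n))" "\<lambda>n. e (r (s n))", OF VB] by metis
  define q where "q n = r (s (t n))" for n
  have q: "strict_mono q" using strict_mono_o[OF rs t] by (simp add: o_def q_def[abs_def])
  have U0q: "(\<lambda>n. U (q n)) \<longlonglongrightarrow> U0" and d0q: "(\<lambda>n. d (q n) i) \<longlonglongrightarrow> d0 i" for i
    using LIMSEQ_subseq_LIMSEQ[OF U0 t] LIMSEQ_subseq_LIMSEQ[OF d0 t] by (simp_all add: o_def q_def)
  have V0q: "(\<lambda>n. V (q n)) \<longlonglongrightarrow> V0" and e0q: "(\<lambda>n. e (q n) i) \<longlonglongrightarrow> e0 i" for i
    using V0 e0 by (simp_all add: q_def)
  have Xq: "(\<lambda>n. X (q n)) \<longlonglongrightarrow> X0"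
    using LIMSEQ_subseq_LIMSEQ[OF X q] by (simp add: o_def)
  have phi: "(\<lambda>n. \<phi> (d (q n) i) (e (q n) j)) \<longlonglongrightarrow> \<phi> (d0 i) (e0 j)" for i j
  proof -
    have "isCont (\<lambda>p. \<phi> (fst p) (snd p)) (d0 i, e0 j)"
      using UA0 VB0 by (intro cont) (auto simp: eigvals_def)
    from isCont_tendsto_compose[OF this tendsto_Pair[OF d0q e0q]] show ?thesis by simp
  qed
  have "(\<lambda>n. schur_form \<phi> (U (q n)) (d (q n)) (V (q n)) (e (q n)) (X (q n))) \<longlonglongrightarrow> schur_form \<phi> U0 d0 V0 e0 X0"
    unfolding schur_form_def
    by (intro tendsto_matrix_mult tendsto_ct U0q V0q vec_tendstoI)
      (simp, intro tendsto_intros phi tendsto_matrix_mult tendsto_ct U0q V0q Xq)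
  then have "(\<lambda>n. schur \<phi> (A (q n)) (B (q n)) (X (q n))) \<longlonglongrightarrow> schur \<phi> A0 B0 X0"
    by (simp add: schur_eq[OF UA VB] schur_eq[OF UA0 VB0])
  then show "\<exists>s. strict_mono s \<and> (\<lambda>n. schur \<phi> (A (r (s n))) (B (r (s n))) (X (r (s n)))) \<longlonglongrightarrow> schur \<phi> A0 B0 X0"
    using strict_mono_o[OF s t] by (intro exI[of _ "\<lambda>n. s (t n)"]) (simp add: q_def o_def)
qed

lemma schur_tendsto:
  fixes A B X :: "'a::first_countable_topology \<Rightarrow> 'n::finite cmat"
  assumes "(A \<longlongrightarrow> A0) (at a)" "\<And>s. hermitian_mat (A s)" "(B \<longlongrightarrow> B0) (at a)" "\<And>s. hermitian_mat (B s)"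
    and "(X \<longlongrightarrow> X0) (at a)"
    and cont: "\<And>x y. x \<in> eigvals A0 \<Longrightarrow> y \<in> eigvals B0 \<Longrightarrow> isCont (\<lambda>p. \<phi> (fst p) (snd p)) (x, y)"
  shows "((\<lambda>s. schur \<phi> (A s) (B s) (X s)) \<longlongrightarrow> schur \<phi> A0 B0 X0) (at a)"
  using assms(1,3,5) unfolding tendsto_at_iff_sequentially o_def
  by (auto intro!: schur_tendsto_sequentially assms(2,4) cont)

section \<open>Divided differences and the derivative of a matrix function\<close>

definition divdiff :: "(real \<Rightarrow> real) \<Rightarrow> (real \<Rightarrow> real) \<Rightarrow> real \<Rightarrow> real \<Rightarrow> real" where
  "divdiff f f' x y = (if x = y then f' x else (f x - f y) / (x - y))"

lemma divdiff_commute: "divdiff f f' x y = divdiff f f' y x"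
  by (auto simp: divdiff_def) (metis minus_diff_eq minus_divide_divide)

text \<open>Off the diagonal this is continuity of a quotient. Near a diagonal point the mean value
  theorem writes every value as \<open>f'\<close> at some point between the arguments, so continuity
  of \<open>f'\<close> there suffices.\<close>

lemma isCont_divdiff:
  assumes S: "open S" and f: "\<And>x. x \<in> S \<Longrightarrow> (f has_real_derivative f' x) (at x)"
    and f': "\<And>x. x \<in> S \<Longrightarrow> isCont f' x" and ab: "a \<in> S" "b \<in> S"
  shows "isCont (\<lambda>p. divdiff f f' (fst p) (snd p)) (a, b)"
proof (cases "a = b")
  case False
  have f1: "isCont (\<lambda>p. f (fst p)) (a, b)"
    by (rule isCont_o2) (use DERIV_isCont[OF f[OF ab(1)]] in \<open>auto intro: continuous_intros\<close>)
  have f2: "isCont (\<lambda>p. f (snd p)) (a, b)"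
    by (rule isCont_o2) (use DERIV_isCont[OF f[OF ab(2)]] in \<open>auto intro: continuous_intros\<close>)
  have "isCont (\<lambda>p. (f (fst p) - f (snd p)) / (fst p - snd p)) (a, b)"
    using False f1 f2 by (intro continuous_intros) auto
  moreover have "\<forall>\<^sub>F p in nhds (a, b). divdiff f f' (fst p) (snd p) = (f (fst p) - f (snd p)) / (fst p - snd p)"
  proof -
    have "open {p :: real \<times> real. fst p \<noteq> snd p}"
      by (intro open_Collect_neq continuous_intros)
    then have "\<forall>\<^sub>F p in nhds (a, b). p \<in> {p :: real \<times> real. fst p \<noteq> snd p}"
      using False by (intro eventually_nhds_in_open) auto
    then show ?thesis by eventually_elim (simp add: divdiff_def)
  qed
  ultimately show ?thesis by (subst isCont_cong)
next
  case True
  show ?thesis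
    unfolding continuous_at_eps_delta
  proof (intro allI impI)
    fix \<epsilon> :: real assume "\<epsilon> > 0"
    then obtain \<delta>1 where \<delta>1: "\<delta>1 > 0" "\<And>x. dist x a < \<delta>1 \<Longrightarrow> dist (f' x) (f' a) < \<epsilon>"
      using f'[OF ab(1)] unfolding continuous_at_eps_delta by blast
    obtain \<delta>2 where \<delta>2: "\<delta>2 > 0" "ball a \<delta>2 \<subseteq> S"
      using S ab(1) open_contains_ball by blast
    define \<delta> where "\<delta> = min \<delta>1 \<delta>2"
    show "\<exists>d>0. \<forall>p. dist p (a, b) < d \<longrightarrow> dist (divdiff f f' (fst p) (snd p)) (divdiff f f' (fst (a, b)) (snd (a, b))) < \<epsilon>"
    proof (intro exI[of _ \<delta>] conjI allI impI)
      show "\<delta> > 0" using \<delta>1 \<delta>2 by (simp add: \<delta>_def)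
      fix p assume p: "dist p (a, b) < \<delta>"
      obtain x y where xy: "p = (x, y)" by (cases p)
      have x: "\<bar>x - a\<bar> < \<delta>" and y: "\<bar>y - a\<bar> < \<delta>"
        using p dist_fst_le[of p "(a, b)"] dist_snd_le[of p "(a, b)"] True by (auto simp: xy dist_real_def)
      have mvt: "\<exists>\<xi>. u \<le> \<xi> \<and> \<xi> \<le> v \<and> divdiff f f' u v = f' \<xi>" if "\<bar>u - a\<bar> < \<delta>" "\<bar>v - a\<bar> < \<delta>" "u \<le> v" for u v
      proof (cases "u = v")
        case False
        have "\<exists>\<xi>. u < \<xi> \<and> \<xi> < v \<and> f v - f u = (v - u) * f' \<xi>"
        proof (rule MVT2)
          show "u < v" using False that by simp
          fix w assume "u \<le> w" "w \<le> v"
          then have "w \<in> ball a \<delta>2" using that by (auto simp: \<delta>_def dist_real_def)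
          then show "(f has_real_derivative f' w) (at w)" using \<delta>2(2) by (intro f) auto
        qed
        then obtain \<xi> where \<xi>: "u < \<xi>" "\<xi> < v" "f v - f u = (v - u) * f' \<xi>" by blast
        then have "divdiff f f' u v = f' \<xi>"
          unfolding divdiff_commute[of f f' u v] using False by (simp add: divdiff_def)
        then show ?thesis using \<xi>(1,2) by (intro exI[of _ \<xi>]) simp
      qed (auto simp: divdiff_def)
      have "\<exists>\<xi>. \<bar>\<xi> - a\<bar> < \<delta> \<and> divdiff f f' x y = f' \<xi>"
      proof (cases "x \<le> y")
        case True
        obtain \<xi> where "x \<le> \<xi>" "\<xi> \<le> y" "divdiff f f' x y = f' \<xi>" using mvt[OF x y True] by blast
        then show ?thesis using x y by (intro exI[of _ \<xi>]) auto
      next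
        case False
        then obtain \<xi> where "y \<le> \<xi>" "\<xi> \<le> x" "divdiff f f' y x = f' \<xi>" using mvt[OF y x] by auto
        then show ?thesis using x y divdiff_commute[of f f' x y] by (intro exI[of _ \<xi>]) auto
      qed
      then obtain \<xi> where \<xi>: "\<bar>\<xi> - a\<bar> < \<delta>" "divdiff f f' x y = f' \<xi>" by blast
      have "dist (f' \<xi>) (f' a) < \<epsilon>" using \<xi>(1) by (intro \<delta>1(2)) (simp add: \<delta>_def dist_real_def)
      then show "dist (divdiff f f' (fst p) (snd p)) (divdiff f f' (fst (a, b)) (snd (a, b))) < \<epsilon>"
        using True \<xi>(2) by (simp add: xy divdiff_def)
    qed
  qed
qed

text \<open>An exact difference formula, so that differentiating a matrix function only needs the
  continuity of \<^const>\<open>schur\<close>.\<close>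
lemma mat_fun_diff:
  assumes "hermitian_mat A" "hermitian_mat B"
  shows "mat_fun f A - mat_fun f B = schur (divdiff f f') A B (A - B)"
proof -
  obtain U d where d: "diagonalizes U d A" using hermitian_diagonalizable[OF assms(1)] .
  obtain V e where e: "diagonalizes V e B" using hermitian_diagonalizable[OF assms(2)] .
  note U = diagonalizes_unitary[OF d] and V = diagonalizes_unitary[OF e]
  define W where "W = ct U ** V"
  have *: "ct U ** (mat_fun g A - mat_fun g B) ** V = real_diag (\<lambda>i. g (d i)) ** W - W ** real_diag (\<lambda>i. g (e i))" for g
    by (simp add: mat_fun_eq[OF d] mat_fun_eq[OF e] matrix_mult_diff_left matrix_mult_diff_right W_def matrix_mul_assoc
        unitary_ct_mult[OF U] unitary_cancel_right'[OF V])
  have id: "mat_fun (\<lambda>x. x) A = A" "mat_fun (\<lambda>x. x) B = B"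
    unfolding mat_fun_eq[OF d] mat_fun_eq[OF e] using d e by (simp_all add: diagonalizes_def)
  \<comment> \<open>The entry of \<open>A - B\<close> in the two bases is \<open>d i - e j\<close>
    times that of \<open>W\<close>, and the divided difference turns it into
    \<open>f (d i) - f (e j)\<close> times that of \<open>W\<close>; both vanish where the
    eigenvalues agree.\<close>
  have "ct U ** (mat_fun f A - mat_fun f B) ** V
      = (\<chi> i j. complex_of_real (divdiff f f' (d i) (e j)) * (ct U ** (A - B) ** V) $ i $ j)"
    unfolding * *[of "\<lambda>x. x", unfolded id]
    by (simp add: vec_eq_iff real_diag_mult_left_nth real_diag_mult_right_nth divdiff_def algebra_simps flip: of_real_diff)
      (simp add: field_simps)
  then have "U ** (ct U ** (mat_fun f A - mat_fun f B) ** V) ** ct V = schur_form (divdiff f f') U d V e (A - B)"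
    by (simp add: schur_form_def)
  then show ?thesis
    by (simp add: schur_eq[OF d e] matrix_mul_assoc unitary_mult_ct[OF U] unitary_cancel_right[OF V])
qed

text \<open>In this form the scalar factor of the difference quotient can be pulled inside
  \<open>schur\<close> by linearity, which turns differentiation into a limit covered by
  \<open>schur_tendsto\<close>.\<close>

lemma has_vector_derivative_at_iff:
  "(f has_vector_derivative D) (at x) \<longleftrightarrow> ((\<lambda>y. (1 / (y - x)) *\<^sub>R (f y - f x)) \<longlongrightarrow> D) (at x)"
proof -
  have "(f has_vector_derivative D) (at x) \<longleftrightarrow> ((\<lambda>y. norm (f y - f x - (y - x) *\<^sub>R D) / norm (y - x)) \<longlongrightarrow> 0) (at x)"
    by (simp add: has_vector_derivative_def has_derivative_iff_norm bounded_linear_scaleR_left)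
  also have "\<dots> \<longleftrightarrow> ((\<lambda>y. norm ((1 / (y - x)) *\<^sub>R (f y - f x) - D)) \<longlongrightarrow> 0) (at x)"
  proof (rule filterlim_cong[OF refl refl])
    have "norm (f y - f x - (y - x) *\<^sub>R D) / norm (y - x) = norm ((1 / (y - x)) *\<^sub>R (f y - f x) - D)" if "y \<noteq> x" for y
    proof -
      from that have "(1 / (y - x)) *\<^sub>R (f y - f x) - D = (1 / (y - x)) *\<^sub>R (f y - f x - (y - x) *\<^sub>R D)"
        by (simp add: scaleR_diff_right)
      then show ?thesis by simp
    qed
    then show "\<forall>\<^sub>F y in at x. norm (f y - f x - (y - x) *\<^sub>R D) / norm (y - x) = norm ((1 / (y - x)) *\<^sub>R (f y - f x) - D)"
      by (simp add: eventually_at_filter)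
  qed
  also have "\<dots> \<longleftrightarrow> ((\<lambda>y. (1 / (y - x)) *\<^sub>R (f y - f x)) \<longlongrightarrow> D) (at x)"
    unfolding tendsto_norm_zero_iff by (rule LIM_zero_iff)
  finally show ?thesis .
qed

lemma schur_scaleR:
  assumes "hermitian_mat A" "hermitian_mat B"
  shows "schur \<phi> A B (c *\<^sub>R X) = c *\<^sub>R schur \<phi> A B X"
proof -
  obtain U d where d: "diagonalizes U d A" using hermitian_diagonalizable[OF assms(1)] .
  obtain V e where e: "diagonalizes V e B" using hermitian_diagonalizable[OF assms(2)] .
  have *: "(\<chi> i j. complex_of_real (\<phi> (d i) (e j)) * (c *\<^sub>R (ct U ** X ** V)) $ i $ j) =
     c *\<^sub>R (\<chi> i j. complex_of_real (\<phi> (d i) (e j)) * (ct U ** X ** V) $ i $ j)"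
    by (simp add: vec_eq_iff)
  show ?thesis
    by (simp add: schur_eq[OF d e] schur_form_def matrix_mult_scaleR_left matrix_mult_scaleR_right * del: vector_scaleR_component)
qed

lemma schur_add:
  assumes "hermitian_mat A" "hermitian_mat B"
  shows "schur \<phi> A B (X + Y) = schur \<phi> A B X + schur \<phi> A B Y"
proof -
  obtain U d where d: "diagonalizes U d A" using hermitian_diagonalizable[OF assms(1)] .
  obtain V e where e: "diagonalizes V e B" using hermitian_diagonalizable[OF assms(2)] .
  have *: "(\<chi> i j. complex_of_real (\<phi> (d i) (e j)) * (ct U ** X ** V + ct U ** Y ** V) $ i $ j) =
     (\<chi> i j. complex_of_real (\<phi> (d i) (e j)) * (ct U ** X ** V) $ i $ j) + (\<chi> i j. complex_of_real (\<phi> (d i) (e j)) * (ct U ** Y ** V) $ i $ j)"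
    by (simp add: vec_eq_iff algebra_simps)
  show ?thesis
    by (simp add: schur_eq[OF d e] schur_form_def matrix_add_ldistrib matrix_add_rdistrib' * del: vector_add_component)
qed

text \<open>The Daleckii-Krein formula. The open set \<open>S\<close> asks for smoothness only
  around the spectrum at the base point, which is what real powers of positive matrices
  require.\<close>

theorem mat_fun_has_vector_derivative:
  fixes M :: "real \<Rightarrow> 'n::finite cmat"
  assumes M: "\<And>s. hermitian_mat (M s)" "(M has_vector_derivative M') (at a)"
    and S: "open S" "eigvals (M a) \<subseteq> S" and f: "\<And>x. x \<in> S \<Longrightarrow> (f has_real_derivative f' x) (at x)"
    and f': "\<And>x. x \<in> S \<Longrightarrow> isCont f' x"
  shows "((\<lambda>s. mat_fun f (M s)) has_vector_derivative schur (divdiff f f') (M a) (M a) M') (at a)"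
  unfolding has_vector_derivative_at_iff mat_fun_diff[OF M(1) M(1), of f _ _ f'] schur_scaleR[OF M(1) M(1), symmetric]
proof (rule schur_tendsto)
  show "(M \<longlongrightarrow> M a) (at a)"
    using has_vector_derivative_continuous[OF M(2)] by (simp add: continuous_at)
  show "((\<lambda>y. (1 / (y - a)) *\<^sub>R (M y - M a)) \<longlongrightarrow> M') (at a)"
    using M(2) by (simp add: has_vector_derivative_at_iff)
  show "isCont (\<lambda>p. divdiff f f' (fst p) (snd p)) (x, y)" if "x \<in> eigvals (M a)" "y \<in> eigvals (M a)" for x y
    using that S(2) by (intro isCont_divdiff[OF S(1) f f']) auto
qed (use M in auto)

lemma schur_zero:
  assumes "hermitian_mat A" "hermitian_mat B"
  shows "schur \<phi> A B 0 = 0"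
  using schur_scaleR[OF assms, of \<phi> 0 0] by simp

text \<open>A product rule in which one term drops out: as \<open>X\<close> vanishes at
  \<open>a\<close>, the motion of \<open>A\<close> contributes only to higher order. Continuity of
  \<open>\<phi>\<close> is then enough, and no derivative of the multiplier appears.\<close>

lemma schur_has_vector_derivative_zero:
  fixes A X :: "real \<Rightarrow> 'n::finite cmat"
  assumes A: "\<And>s. hermitian_mat (A s)" "(A \<longlongrightarrow> A a) (at a)"
    and X: "X a = 0" "(X has_vector_derivative X') (at a)"
    and cont: "\<And>x y. x \<in> eigvals (A a) \<Longrightarrow> y \<in> eigvals (A a) \<Longrightarrow> isCont (\<lambda>p. \<phi> (fst p) (snd p)) (x, y)"
  shows "((\<lambda>s. schur \<phi> (A s) (A s) (X s)) has_vector_derivative schur \<phi> (A a) (A a) X') (at a)"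
  unfolding has_vector_derivative_at_iff X(1) schur_zero[OF A(1) A(1)] diff_zero schur_scaleR[OF A(1) A(1), symmetric]
  using X(2)[unfolded has_vector_derivative_at_iff X(1) diff_zero]
  by (intro schur_tendsto A cont)

section \<open>Multipliers in an eigenbasis and under the trace\<close>

lemma schur_nth:
  assumes d: "diagonalizes U d A"
  shows "(ct U ** schur \<phi> A A X ** U) $ i $ j = complex_of_real (\<phi> (d i) (d j)) * (ct U ** X ** U) $ i $ j"
proof -
  note U = diagonalizes_unitary[OF d]
  have "ct U ** schur \<phi> A A X ** U = (\<chi> i j. complex_of_real (\<phi> (d i) (d j)) * (ct U ** X ** U) $ i $ j)"
    by (simp add: schur_eq[OF d d] schur_form_def matrix_mul_assoc unitary_ct_mult[OF U] unitary_cancel_right'[OF U])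
  then show ?thesis by simp
qed

lemma trace_unitary_conj:
  fixes X :: "'n::finite cmat"
  assumes "unitary_mat U"
  shows "trace (ct U ** X ** U) = trace X"
proof -
  have "trace (ct U ** X ** U) = trace (U ** (ct U ** X))" by (rule trace_mul_sym)
  then show ?thesis by (simp add: unitary_cancel_left[OF assms])
qed

lemma unitary_conj_mult:
  assumes "unitary_mat U"
  shows "ct U ** (X ** Y) ** U = (ct U ** X ** U) ** (ct U ** Y ** U)"
  by (simp add: matrix_mul_assoc unitary_cancel_right[OF assms])

lemma trace_mult_unitary_conj:
  fixes X :: "'n::finite cmat"
  assumes "unitary_mat U"
  shows "trace (X ** Y) = (\<Sum>i\<in>UNIV. \<Sum>j\<in>UNIV. (ct U ** X ** U) $ i $ j * (ct U ** Y ** U) $ j $ i)"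
proof -
  have "trace (X ** Y) = trace ((ct U ** X ** U) ** (ct U ** Y ** U))"
    using trace_unitary_conj[OF assms, of "X ** Y"] by (simp only: unitary_conj_mult[OF assms])
  then show ?thesis
    by (simp only: trace_def matrix_matrix_mult_def[of "ct U ** X ** U" "ct U ** Y ** U"] vec_lambda_beta)
qed

text \<open>The trace pairs the entry at \<open>i, j\<close> with the one at \<open>j, i\<close>, so
  a symmetric multiplier is self-adjoint for this pairing. In the gradient of \<open>T\<close> it
  moves a divided difference from the direction \<open>H j\<close> onto the operator
  \<open>B y\<close>.\<close>

lemma trace_schur_symmetric:
  assumes A: "hermitian_mat A" and \<phi>: "\<And>x y. \<phi> x y = \<phi> y x"
  shows "trace (Y ** schur \<phi> A A X) = trace (X ** schur \<phi> A A Y)"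
proof -
  obtain U d where d: "diagonalizes U d A" using hermitian_diagonalizable[OF A] .
  show ?thesis
    unfolding trace_mult_unitary_conj[OF diagonalizes_unitary[OF d]] schur_nth[OF d]
    by (subst sum.swap) (auto intro!: sum.cong simp: \<phi> mult_ac)
qed

lemma mat_fun_nth:
  assumes d: "diagonalizes U d A"
  shows "(ct U ** mat_fun f A ** U) $ i $ j = (if i = j then complex_of_real (f (d i)) else 0)"
  by (simp add: diagonalizes_conj[OF diagonalizes_mat_fun[OF d]] real_diag_nth)

lemma trace_mat_fun:
  assumes d: "diagonalizes U d A"
  shows "trace (mat_fun f A) = complex_of_real (\<Sum>i\<in>UNIV. f (d i))"
  using trace_unitary_conj[OF diagonalizes_unitary[OF d], of "mat_fun f A"]
  by (simp add: trace_def mat_fun_nth[OF d])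

text \<open>The trace sees only the diagonal entries, where the divided difference equals
  \<open>f'\<close>. Combined with the Daleckii-Krein formula this is the familiar derivative of the
  trace of a matrix function.\<close>

lemma trace_schur_divdiff:
  assumes A: "hermitian_mat A"
  shows "trace (schur (divdiff f f') A A X) = trace (mat_fun f' A ** X)"
proof -
  obtain U d where d: "diagonalizes U d A" using hermitian_diagonalizable[OF A] .
  have "trace (schur (divdiff f f') A A X) = (\<Sum>i\<in>UNIV. complex_of_real (f' (d i)) * (ct U ** X ** U) $ i $ i)"
    using trace_unitary_conj[OF diagonalizes_unitary[OF d], of "schur (divdiff f f') A A X"]
    by (simp add: trace_def schur_nth[OF d] divdiff_def)
  also have "\<dots> = trace (mat_fun f' A ** X)"
    unfolding trace_mult_unitary_conj[OF diagonalizes_unitary[OF d]] mat_fun_nth[OF d]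
    by (simp add: if_distrib if_distribR sum.delta cong: if_cong)
  finally show ?thesis .
qed

section \<open>A trigonometric series\<close>

lemma trig_series_summable:
  fixes a b :: "nat \<Rightarrow> real"
  assumes "summable (\<lambda>n. \<bar>a n\<bar>)"
  shows "summable (\<lambda>n. a n * cos (b n))" "summable (\<lambda>n. a n * sin (b n))"
  by (auto intro!: summable_comparison_test'[OF assms, of 0] mult_left_le simp: abs_mult)

lemma trig_series_derivative:
  fixes a :: "nat \<Rightarrow> real"
  assumes "summable (\<lambda>n. \<bar>a n\<bar> * real (Suc n))"
  shows "((\<lambda>x. \<Sum>n. a n * cos (real (Suc n) * x)) has_real_derivative (\<Sum>n. - a n * real (Suc n) * sin (real (Suc n) * x))) (at x)"
    and "((\<lambda>x. \<Sum>n. a n * sin (real (Suc n) * x)) has_real_derivative (\<Sum>n. a n * real (Suc n) * cos (real (Suc n) * x))) (at x)"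
proof -
  have "summable (\<lambda>n. \<bar>a n\<bar>)"
    by (rule summable_comparison_test'[OF assms, of 0]) (simp add: mult_le_cancel_left1)
  note sm = trig_series_summable[OF this]
  show "((\<lambda>x. \<Sum>n. a n * cos (real (Suc n) * x)) has_real_derivative (\<Sum>n. - a n * real (Suc n) * sin (real (Suc n) * x))) (at x)"
  proof (rule has_field_derivative_series'(2)[where S = UNIV and x0 = x])
    show "uniformly_convergent_on UNIV (\<lambda>n x. \<Sum>i<n. - a i * real (Suc i) * sin (real (Suc i) * x))"
      by (rule Weierstrass_m_test'[OF _ assms]) (auto simp: abs_mult intro!: mult_left_le)
  qed (use sm in \<open>auto intro!: derivative_eq_intros\<close>)
  show "((\<lambda>x. \<Sum>n. a n * sin (real (Suc n) * x)) has_real_derivative (\<Sum>n. a n * real (Suc n) * cos (real (Suc n) * x))) (at x)"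
  proof (rule has_field_derivative_series'(2)[where S = UNIV and x0 = x])
    show "uniformly_convergent_on UNIV (\<lambda>n x. \<Sum>i<n. a i * real (Suc i) * cos (real (Suc i) * x))"
      by (rule Weierstrass_m_test'[OF _ assms]) (auto simp: abs_mult intro!: mult_left_le)
  qed (use sm in \<open>auto intro!: derivative_eq_intros\<close>)
qed

lemma Ln_one_minus_cis_series:
  assumes "0 \<le> r" "r < 1"
  shows "(\<lambda>n. - (r ^ Suc n / real (Suc n) * cos (real (Suc n) * t))) sums Re (Ln (1 - of_real r * cis t))"
    and "(\<lambda>n. - (r ^ Suc n / real (Suc n) * sin (real (Suc n) * t))) sums Im (Ln (1 - of_real r * cis t))"
proof -
  have "(\<lambda>n. - ((- (- (of_real r * cis t)))^n) / of_nat n) sums ln (1 + - (of_real r * cis t))"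
    using assms by (intro Ln_series') (simp add: norm_mult)
  then have "(\<lambda>n. - ((of_real r * cis t) ^ Suc n / of_nat (Suc n))) sums ln (1 - of_real r * cis t)"
    using sums_Suc_iff[of "\<lambda>n. - ((of_real r * cis t) ^ n) / of_nat n" "ln (1 - of_real r * cis t)"] by simp
  then have *: "(\<lambda>n. - (of_real (r ^ Suc n / real (Suc n)) * cis (real (Suc n) * t))) sums ln (1 - of_real r * cis t)"
    by (simp add: power_mult_distrib Complex.DeMoivre del: power_Suc of_nat_Suc)
  show "(\<lambda>n. - (r ^ Suc n / real (Suc n) * cos (real (Suc n) * t))) sums Re (Ln (1 - of_real r * cis t))"
    using sums_Re[OF *] by (simp del: power_Suc of_nat_Suc)
  show "(\<lambda>n. - (r ^ Suc n / real (Suc n) * sin (real (Suc n) * t))) sums Im (Ln (1 - of_real r * cis t))"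
    using sums_Im[OF *] by (simp del: power_Suc of_nat_Suc)
qed

lemma one_minus_cis: "1 - cis t = of_real (2 * sin (t / 2)) * cis ((t - pi) / 2)"
proof -
  have "cos t = 1 - 2 * (sin (t / 2))\<^sup>2" using cos_double_sin[of "t / 2"] by simp
  moreover have "sin t = 2 * sin (t / 2) * cos (t / 2)" using sin_double[of "t / 2"] by simp
  moreover have "cos ((t - pi) / 2) = sin (t / 2)" "sin ((t - pi) / 2) = - cos (t / 2)"
    by (simp_all add: diff_divide_distrib cos_diff sin_diff)
  ultimately show ?thesis
    by (simp add: complex_eq_iff power2_eq_square)
qed

text \<open>In the polar form of \<open>1 - cis t\<close> the angle \<open>(t - pi) / 2\<close> lies
  strictly between \<open>- pi / 2\<close> and \<open>pi / 2\<close>, so the principal logarithm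
  returns exactly this angle. Integrating this sawtooth produces the quadratic polynomial of the
  next lemma.\<close>

lemma Im_Ln_one_minus_cis:
  assumes "0 < t" "t < 2 * pi"
  shows "1 - cis t \<notin> \<real>\<^sub>\<le>\<^sub>0" "Im (Ln (1 - cis t)) = (t - pi) / 2"
proof -
  have s: "sin (t / 2) > 0" using assms by (intro sin_gt_zero) auto
  have eq: "1 - cis t = exp (Complex (ln (2 * sin (t / 2))) ((t - pi) / 2))"
    using s by (simp add: one_minus_cis exp_eq_polar exp_ln)
  show "Im (Ln (1 - cis t)) = (t - pi) / 2"
    unfolding eq using assms by (subst Ln_exp) auto
  have "cos t < 1"
    using s cos_double_sin[of "t / 2"] by (simp add: power2_eq_square)
  then show "1 - cis t \<notin> \<real>\<^sub>\<le>\<^sub>0" by (simp add: complex_nonpos_Reals_iff)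
qed

lemma summable_inverse_Suc_squared: "summable (\<lambda>n. 1 / (real (Suc n))\<^sup>2)"
  using inverse_squares_sums by (simp add: sums_iff add.commute)

text \<open>Abel summation: for \<open>r < 1\<close> the derivative of the damped series is
  \<open>Im (Ln (1 - r * cis t))\<close>, which stays bounded as \<open>r\<close> tends to \<open>1\<close>.\<close>
lemma sum_cos_over_square:
  fixes \<theta> :: real
  assumes \<theta>: "0 \<le> \<theta>" "\<theta> \<le> 2 * pi"
  shows "(\<Sum>n. cos (real (Suc n) * \<theta>) / (real (Suc n))\<^sup>2) = (\<Sum>n. 1 / (real (Suc n))\<^sup>2) + ((\<theta> - pi)\<^sup>2 - pi\<^sup>2) / 4"
proof -
  define r where "r k = 1 - 1 / real (k + 2)" for k
  have r: "0 \<le> r k" "r k < 1" for k by (simp_all add: r_def)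
  have r_lim: "r \<longlonglongrightarrow> 1"
    unfolding r_def by real_asymp
  define B where "B \<rho> x = (\<Sum>n. \<rho> ^ Suc n / (real (Suc n))\<^sup>2 * cos (real (Suc n) * x))" for \<rho> x
  define L where "L k t = Im (Ln (1 - of_real (r k) * cis t))" for k t
  have B_deriv: "(B (r k) has_real_derivative L k t) (at t)" for k t
  proof -
    have "summable (\<lambda>n. r k ^ Suc n)" using r[of k] by (simp add: summable_geometric summable_mult)
    then have "summable (\<lambda>n. \<bar>r k ^ Suc n / (real (Suc n))\<^sup>2\<bar> * real (Suc n))"
    proof (rule summable_comparison_test'[of _ 0])
      fix n
      have "norm (\<bar>r k ^ Suc n / (real (Suc n))\<^sup>2\<bar> * real (Suc n)) = r k ^ Suc n / real (Suc n)"
        using r[of k] by (simp add: power2_eq_square abs_mult del: power_Suc of_nat_Suc)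
      also have "\<dots> \<le> r k ^ Suc n / 1"
        using r[of k] by (intro divide_left_mono) auto
      finally show "norm (\<bar>r k ^ Suc n / (real (Suc n))\<^sup>2\<bar> * real (Suc n)) \<le> r k ^ Suc n" by simp
    qed
    from trig_series_derivative(1)[OF this, of t]
    have "(B (r k) has_real_derivative (\<Sum>n. - (r k ^ Suc n / (real (Suc n))\<^sup>2) * real (Suc n) * sin (real (Suc n) * t))) (at t)"
      by (simp add: B_def[abs_def])
    also have "(\<lambda>n. - (r k ^ Suc n / (real (Suc n))\<^sup>2) * real (Suc n) * sin (real (Suc n) * t))
        = (\<lambda>n. - (r k ^ Suc n / real (Suc n) * sin (real (Suc n) * t)))"
      by (simp add: power2_eq_square del: power_Suc of_nat_Suc)
    also have "(\<Sum>n. - (r k ^ Suc n / real (Suc n) * sin (real (Suc n) * t))) = L k t"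
      using Ln_one_minus_cis_series(2)[OF r[of k], of t] by (simp add: sums_iff L_def)
    finally show ?thesis .
  qed
  have int_L: "(L k has_integral (B (r k) \<theta> - B (r k) 0)) {0<..<\<theta>}" for k
    unfolding has_integral_Icc_iff_Ioo[symmetric]
    using \<theta>(1) B_deriv by (intro fundamental_theorem_of_calculus)
      (auto simp: has_real_derivative_iff_has_vector_derivative intro: has_vector_derivative_at_within)
  have lim: "(\<lambda>k. integral {0<..<\<theta>} (L k)) \<longlonglongrightarrow> integral {0<..<\<theta>} (\<lambda>t. (t - pi) / 2)"
  proof (rule dominated_convergence(2))
    show "L k integrable_on {0<..<\<theta>}" for k using int_L by blast
    show "(\<lambda>_. pi) integrable_on {0<..<\<theta>}"
      using integrable_const_ivl by (simp add: integrable_on_Icc_iff_Ioo[symmetric])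
    show "norm (L k t) \<le> pi" for k t
    proof -
      have "norm (of_real (r k) * cis t) < 1" using r[of k] by (simp add: norm_mult)
      then have "1 - of_real (r k) * cis t \<noteq> 0" by auto
      from Im_Ln_le_pi[OF this] mpi_less_Im_Ln[OF this] show ?thesis by (simp add: L_def)
    qed
    show "(\<lambda>k. L k t) \<longlonglongrightarrow> (t - pi) / 2" if "t \<in> {0<..<\<theta>}" for t
    proof -
      have t: "0 < t" "t < 2 * pi" using that \<theta> by auto
      have "(\<lambda>k. 1 - of_real (r k) * cis t) \<longlonglongrightarrow> 1 - of_real 1 * cis t"
        by (intro tendsto_intros r_lim)
      then have "(\<lambda>k. L k t) \<longlonglongrightarrow> Im (Ln (1 - of_real 1 * cis t))"
        unfolding L_def using Im_Ln_one_minus_cis(1)[OF t]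
        by (intro tendsto_Im isCont_tendsto_compose[OF continuous_at_Ln]) auto
      then show ?thesis by (simp add: Im_Ln_one_minus_cis(2)[OF t])
    qed
  qed
  have "((\<lambda>t. (t - pi) / 2) has_integral ((\<theta> - pi)\<^sup>2 / 4 - (0 - pi)\<^sup>2 / 4)) {0..\<theta>}"
    using \<theta>(1) by (intro fundamental_theorem_of_calculus)
      (auto simp flip: has_real_derivative_iff_has_vector_derivative intro!: derivative_eq_intros)
  then have int: "integral {0<..<\<theta>} (\<lambda>t. (t - pi) / 2) = (\<theta> - pi)\<^sup>2 / 4 - pi\<^sup>2 / 4"
    by (intro integral_unique) (simp add: has_integral_Icc_iff_Ioo)
  have B_lim: "(\<lambda>k. B (r k) x) \<longlonglongrightarrow> B 1 x" for x
    unfolding B_def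
  proof (rule tannerys_theorem[THEN conjunct2, THEN conjunct2, OF _ _ summable_inverse_Suc_squared])
    show "(\<lambda>k. r k ^ Suc n / (real (Suc n))\<^sup>2 * cos (real (Suc n) * x)) \<longlonglongrightarrow> 1 ^ Suc n / (real (Suc n))\<^sup>2 * cos (real (Suc n) * x)" for n
      by (intro tendsto_intros r_lim) auto
    have "norm (r k ^ Suc n / (real (Suc n))\<^sup>2 * cos (real (Suc n) * x)) \<le> 1 / (real (Suc n))\<^sup>2" for n k
    proof -
      have "r k ^ Suc n * \<bar>cos (real (Suc n) * x)\<bar> \<le> 1 * 1"
        using r[of k] by (intro mult_mono power_le_one) (auto simp: less_imp_le)
      then show ?thesis using r[of k]
        by (simp add: abs_mult divide_right_mono del: power_Suc of_nat_Suc)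
    qed
    then show "\<forall>\<^sub>F (n, k) in sequentially \<times>\<^sub>F sequentially. norm (r k ^ Suc n / (real (Suc n))\<^sup>2 * cos (real (Suc n) * x)) \<le> 1 / (real (Suc n))\<^sup>2"
      by (intro always_eventually) auto
  qed simp
  have "(\<lambda>k. integral {0<..<\<theta>} (L k)) \<longlonglongrightarrow> B 1 \<theta> - B 1 0"
    unfolding integral_unique[OF int_L] by (intro tendsto_diff B_lim)
  from LIMSEQ_unique[OF this lim] show ?thesis
    unfolding int B_def by (simp add: algebra_simps del: of_nat_Suc) (simp add: diff_divide_distrib)
qed

text \<open>The series \<open>G\<close> below, shifted by \<open>1 / (2 v\<^sup>2)\<close>, solves \<open>y'' = v\<^sup>2 y\<close> on \<open>(0, 2 pi)\<close> and is
  determined by its periodicity.\<close>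
lemma sum_cos_over_square_plus:
  fixes \<theta> v :: real
  assumes \<theta>: "0 \<le> \<theta>" "\<theta> \<le> 2 * pi" and v: "v \<noteq> 0"
  shows "(\<Sum>n. cos (real (Suc n) * \<theta>) / ((real (Suc n))\<^sup>2 + v\<^sup>2)) + 1 / (2 * v\<^sup>2)
    = pi / (2 * v) * cosh (v * (pi - \<theta>)) / sinh (pi * v)"
proof -
  define m where "m n = real (Suc n)" for n
  have m: "m n \<ge> 1" for n by (simp add: m_def)
  have m': "m n > 0" for n by (simp add: m_def)
  have v2: "v\<^sup>2 > 0" using v by simp
  have sq_pos: "(m n)\<^sup>2 + v\<^sup>2 > 0" for n using v2 by (simp add: add_nonneg_pos)
  \<comment> \<open>Termwise differentiation of \<open>G\<close> would destroy absolute convergence.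
    Instead \<open>D' = G\<close> and \<open>E' = - D\<close> are obtained by termwise
    differentiation, and \<open>G = B - v^2 * E\<close> with the closed form of \<open>B\<close>
    makes \<open>G\<close> differentiable on the period.\<close>
  define B D E G where "B x = (\<Sum>n. cos (m n * x) / (m n)\<^sup>2)"
    and "D x = (\<Sum>n. 1 / (m n * ((m n)\<^sup>2 + v\<^sup>2)) * sin (m n * x))"
    and "E x = (\<Sum>n. 1 / ((m n)\<^sup>2 * ((m n)\<^sup>2 + v\<^sup>2)) * cos (m n * x))"
    and "G x = (\<Sum>n. cos (m n * x) / ((m n)\<^sup>2 + v\<^sup>2))" for x
  have sm2: "summable (\<lambda>n. 1 / (m n)\<^sup>2)"
    unfolding m_def by (rule summable_inverse_Suc_squared)
  have le1: "1 / ((m n)\<^sup>2 + v\<^sup>2) \<le> 1 / (m n)\<^sup>2" for n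
    using v2 m'[of n] sq_pos[of n] by (intro divide_left_mono mult_pos_pos) auto
  have smD: "summable (\<lambda>n. \<bar>1 / (m n * ((m n)\<^sup>2 + v\<^sup>2))\<bar> * m n)"
    by (rule summable_comparison_test'[OF sm2, of 0]) (use le1 m' sq_pos in \<open>simp add: abs_mult less_imp_le\<close>)
  have smE: "summable (\<lambda>n. \<bar>1 / ((m n)\<^sup>2 * ((m n)\<^sup>2 + v\<^sup>2))\<bar> * m n)"
  proof (rule summable_comparison_test'[OF smD, of 0])
    fix n
    have "1 / ((m n)\<^sup>2 * ((m n)\<^sup>2 + v\<^sup>2)) \<le> 1 / (m n * ((m n)\<^sup>2 + v\<^sup>2))"
      using m[of n] sq_pos[of n] by (intro divide_left_mono mult_right_mono mult_pos_pos) (auto simp: power2_eq_square)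
    from mult_right_mono[OF this, of "m n"]
    show "norm (\<bar>1 / ((m n)\<^sup>2 * ((m n)\<^sup>2 + v\<^sup>2))\<bar> * m n) \<le> \<bar>1 / (m n * ((m n)\<^sup>2 + v\<^sup>2))\<bar> * m n"
      using m'[of n] sq_pos[of n] by (simp add: abs_mult)
  qed
  have D_deriv: "(D has_real_derivative G x) (at x)" for x
  proof -
    have "(D has_real_derivative (\<Sum>n. 1 / (m n * ((m n)\<^sup>2 + v\<^sup>2)) * m n * cos (m n * x))) (at x)"
      using trig_series_derivative(2)[OF smD[unfolded m_def], of x] by (simp add: D_def[abs_def] m_def)
    also have "(\<lambda>n. 1 / (m n * ((m n)\<^sup>2 + v\<^sup>2)) * m n * cos (m n * x)) = (\<lambda>n. cos (m n * x) / ((m n)\<^sup>2 + v\<^sup>2))"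
    proof
      fix n show "1 / (m n * ((m n)\<^sup>2 + v\<^sup>2)) * m n * cos (m n * x) = cos (m n * x) / ((m n)\<^sup>2 + v\<^sup>2)"
        using m'[of n] by simp
    qed
    finally show ?thesis by (simp add: G_def)
  qed
  have E_deriv: "(E has_real_derivative - D x) (at x)" for x
  proof -
    have smD': "summable (\<lambda>n. 1 / (m n * ((m n)\<^sup>2 + v\<^sup>2)) * sin (m n * x))"
    proof (rule summable_comparison_test'[OF smD, of 0])
      fix n
      have "\<bar>1 / (m n * ((m n)\<^sup>2 + v\<^sup>2))\<bar> * \<bar>sin (m n * x)\<bar> \<le> \<bar>1 / (m n * ((m n)\<^sup>2 + v\<^sup>2))\<bar> * m n"
        using m[of n] abs_sin_le_one[of "m n * x"] by (intro mult_left_mono) linarith+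
      then show "norm (1 / (m n * ((m n)\<^sup>2 + v\<^sup>2)) * sin (m n * x)) \<le> \<bar>1 / (m n * ((m n)\<^sup>2 + v\<^sup>2))\<bar> * m n"
        by (simp only: real_norm_def abs_mult)
    qed
    have "(E has_real_derivative (\<Sum>n. - (1 / ((m n)\<^sup>2 * ((m n)\<^sup>2 + v\<^sup>2))) * m n * sin (m n * x))) (at x)"
      using trig_series_derivative(1)[OF smE[unfolded m_def], of x] by (simp add: E_def[abs_def] m_def)
    also have "(\<lambda>n. - (1 / ((m n)\<^sup>2 * ((m n)\<^sup>2 + v\<^sup>2))) * m n * sin (m n * x)) = (\<lambda>n. - (1 / (m n * ((m n)\<^sup>2 + v\<^sup>2)) * sin (m n * x)))"
    proof
      fix n show "- (1 / ((m n)\<^sup>2 * ((m n)\<^sup>2 + v\<^sup>2))) * m n * sin (m n * x) = - (1 / (m n * ((m n)\<^sup>2 + v\<^sup>2)) * sin (m n * x))"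
        using m'[of n] by (simp add: power2_eq_square)
    qed
    also have "(\<Sum>n. - (1 / (m n * ((m n)\<^sup>2 + v\<^sup>2)) * sin (m n * x))) = - D x"
      using suminf_minus[OF smD'] by (simp add: D_def)
    finally show ?thesis .
  qed
  have GBE: "G x = B x - v\<^sup>2 * E x" for x
  proof -
    have 1: "summable (\<lambda>n. cos (m n * x) / (m n)\<^sup>2)"
      using trig_series_summable(1)[of "\<lambda>n. 1 / (m n)\<^sup>2" "\<lambda>n. m n * x"] sm2 by simp
    have "summable (\<lambda>n. \<bar>1 / ((m n)\<^sup>2 * ((m n)\<^sup>2 + v\<^sup>2))\<bar>)"
      by (rule summable_comparison_test'[OF smE, of 0]) (use m sq_pos in \<open>simp add: divide_right_mono less_imp_le\<close>)
    from trig_series_summable(1)[OF this, of "\<lambda>n. m n * x"]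
    have 2: "summable (\<lambda>n. 1 / ((m n)\<^sup>2 * ((m n)\<^sup>2 + v\<^sup>2)) * cos (m n * x))" .
    have "cos (m n * x) / ((m n)\<^sup>2 + v\<^sup>2) = cos (m n * x) / (m n)\<^sup>2 - v\<^sup>2 * (1 / ((m n)\<^sup>2 * ((m n)\<^sup>2 + v\<^sup>2)) * cos (m n * x))" for n
    proof -
      have *: "c / s = c / a - (s - a) * (1 / (a * s) * c)" if "a \<noteq> 0" "s \<noteq> 0" for a s c :: real
        using that by (simp add: field_simps)
      show ?thesis
        using *[of "(m n)\<^sup>2" "(m n)\<^sup>2 + v\<^sup>2" "cos (m n * x)"] m'[of n] sq_pos[of n] by simp
    qed
    then show ?thesis
      unfolding G_def B_def E_def by (simp only: suminf_mult[OF 2, symmetric] suminf_diff[OF 1 summable_mult[OF 2]])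
  qed
  define b where "b = (\<Sum>n. 1 / (m n)\<^sup>2)"
  have B_eq: "B x = b + ((x - pi)\<^sup>2 - pi\<^sup>2) / 4" if "0 \<le> x" "x \<le> 2 * pi" for x
    using sum_cos_over_square[OF that] by (simp add: B_def b_def m_def)
  \<comment> \<open>\<open>B\<close> is quadratic only on \<open>[0, 2 * pi]\<close>. Using the
    polynomial everywhere gives a function differentiable on the whole line that agrees with
    \<open>G\<close> on this interval, so one-sided derivatives at the endpoints are
    avoided.\<close>
  define Gp where "Gp x = b + ((x - pi)\<^sup>2 - pi\<^sup>2) / 4 - v\<^sup>2 * E x" for x
  have G_eq: "G x = Gp x" if "0 \<le> x" "x \<le> 2 * pi" for x
    using that by (simp add: GBE B_eq Gp_def)
  have G_deriv: "(Gp has_real_derivative (x - pi) / 2 + v\<^sup>2 * D x) (at x)" for x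
    unfolding Gp_def by (auto intro!: derivative_eq_intros E_deriv)
  \<comment> \<open>With \<open>y = Gp + 1 / (2 * v^2)\<close> this is
    \<open>(y + y' / c) * exp (- c * x)\<close>, a first integral of \<open>y'' = c^2 * y\<close>.
    The choices \<open>c = v\<close> and \<open>c = - v\<close> give two linear equations from which
    \<open>y'\<close> is eliminated.\<close>
  define P where "P c x = (Gp x + 1 / (2 * v\<^sup>2) + c * (D x + (x - pi) / (2 * v\<^sup>2))) * exp (- c * x)" for c x
  have P_const: "P c x = P c 0" if c: "c\<^sup>2 = v\<^sup>2" and x: "0 \<le> x" "x \<le> 2 * pi" for c x
  proof -
    have P_deriv: "(P c has_real_derivative
       ((x - pi) / 2 + v\<^sup>2 * D x + c * (G x + 1 / (2 * v\<^sup>2))) * exp (- c * x)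
        + (Gp x + 1 / (2 * v\<^sup>2) + c * (D x + (x - pi) / (2 * v\<^sup>2))) * (- c * exp (- c * x))) (at x)" for x
    proof -
      have 1: "((\<lambda>x. (x - pi) / (2 * v\<^sup>2)) has_real_derivative 1 / (2 * v\<^sup>2)) (at x)"
        by (intro DERIV_cdivide) (auto intro!: derivative_eq_intros)
      have 2: "((\<lambda>x. Gp x + 1 / (2 * v\<^sup>2) + c * (D x + (x - pi) / (2 * v\<^sup>2))) has_real_derivative
         ((x - pi) / 2 + v\<^sup>2 * D x) + 0 + c * (G x + 1 / (2 * v\<^sup>2))) (at x)"
        by (intro DERIV_add DERIV_cmult DERIV_const G_deriv D_deriv 1)
      have 3: "((\<lambda>x. exp (- c * x)) has_real_derivative - c * exp (- c * x)) (at x)"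
        by (auto intro!: derivative_eq_intros)
      show ?thesis
        unfolding P_def by (rule DERIV_cong[OF DERIV_mult[OF 2 3]]) (simp add: algebra_simps)
    qed
    show ?thesis
    proof (rule DERIV_isconst2[of 0 "2 * pi"])
      show "continuous_on {0..2 * pi} (P c)"
        using P_deriv by (meson DERIV_isCont continuous_at_imp_continuous_on)
      fix y :: real assume y: "0 < y" "y < 2 * pi"
      have "((y - pi) / 2 + v\<^sup>2 * D y + c * (G y + 1 / (2 * v\<^sup>2))) * exp (- c * y)
        + (Gp y + 1 / (2 * v\<^sup>2) + c * (D y + (y - pi) / (2 * v\<^sup>2))) * (- c * exp (- c * y))
        = ((y - pi) / 2 + v\<^sup>2 * D y - c\<^sup>2 * (D y + (y - pi) / (2 * v\<^sup>2))) * exp (- c * y)"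
      proof -
        have *: "(X + c * Z) * e + (Z + c * Y) * (- c * e) = (X - c\<^sup>2 * Y) * e" for X Y Z e :: real
          by (simp add: algebra_simps power2_eq_square)
        have "G y = Gp y" using y by (intro G_eq) auto
        then show ?thesis using * by simp
      qed
      also have "\<dots> = 0" using v by (simp add: c field_simps)
      finally show "(P c has_real_derivative 0) (at y)" using P_deriv[of y] by metis
    qed (use x in auto)
  qed
  have D0: "D 0 = 0" "D (2 * pi) = 0"
  proof -
    have "sin (m n * (2 * pi)) = 0" for n
      using sin_npi[of "2 * Suc n"] by (simp add: m_def mult_ac)
    then show "D 0 = 0" "D (2 * pi) = 0" by (simp_all add: D_def)
  qed
  have G0: "Gp (2 * pi) = Gp 0"
  proof -
    have "cos (m n * (2 * pi)) = 1" for n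
      using cos_npi[of "2 * Suc n"] by (simp add: m_def mult_ac)
    then show ?thesis by (simp add: G_eq[symmetric] G_def)
  qed
  define J where "J = Gp 0 + 1 / (2 * v\<^sup>2)"
  have P0: "P c 0 = J - c * pi / (2 * v\<^sup>2)" for c
    by (simp add: P_def J_def D0)
  have P1: "P v (2 * pi) = (J + pi / (2 * v)) * exp (- (2 * pi * v))"
  proof -
    have "v * (0 + (2 * pi - pi) / (2 * v\<^sup>2)) = pi / (2 * v)" "- v * (2 * pi) = - (2 * pi * v)"
      using v by (simp_all add: power2_eq_square)
    then show ?thesis unfolding P_def J_def D0 G0 by simp
  qed
  have ne: "exp (- (2 * pi * v)) \<noteq> 1" using v by simp
  have sh: "sinh (pi * v) \<noteq> 0" using v by simp
  \<comment> \<open>Equating the first integral for \<open>c = v\<close> at the two ends of the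
    period, where \<open>y\<close> takes the same value \<open>J\<close> and \<open>D\<close> is
    zero, gives a linear equation for \<open>J\<close>.\<close>
  have J: "J = pi / (2 * v) * cosh (pi * v) / sinh (pi * v)"
  proof -
    have "(J + pi / (2 * v)) * exp (- (2 * pi * v)) = J - pi / (2 * v)"
      using P_const[of v "2 * pi"] P0[of v] v unfolding P1 by (simp add: power2_eq_square)
    then have "(J + pi / (2 * v)) * exp (- (2 * pi * v)) * exp (pi * v) = (J - pi / (2 * v)) * exp (pi * v)" by simp
    then have "(J + pi / (2 * v)) * exp (- (pi * v)) = (J - pi / (2 * v)) * exp (pi * v)"
      by (simp add: mult.assoc flip: exp_add)
    then have "J * sinh (pi * v) = pi / (2 * v) * cosh (pi * v)"
      by (simp add: sinh_def cosh_def algebra_simps)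
    then show ?thesis using sh by (simp add: field_simps)
  qed
  have P\<theta>: "P c \<theta> = P c 0" if "c\<^sup>2 = v\<^sup>2" for c by (rule P_const[OF that \<theta>])
  have 1: "Gp \<theta> + 1 / (2 * v\<^sup>2) + v * (D \<theta> + (\<theta> - pi) / (2 * v\<^sup>2)) = (J - pi / (2 * v)) * exp (v * \<theta>)"
  proof -
    have "P v \<theta> * exp (v * \<theta>) = (J - pi / (2 * v)) * exp (v * \<theta>)"
      using P\<theta>[of v] P0[of v] v by (simp add: power2_eq_square)
    then show ?thesis by (simp add: P_def mult.assoc flip: exp_add)
  qed
  have 2: "Gp \<theta> + 1 / (2 * v\<^sup>2) - v * (D \<theta> + (\<theta> - pi) / (2 * v\<^sup>2)) = (J + pi / (2 * v)) * exp (- (v * \<theta>))"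
  proof -
    have "P (- v) \<theta> * exp (- (v * \<theta>)) = (J + pi / (2 * v)) * exp (- (v * \<theta>))"
      using P\<theta>[of "- v"] P0[of "- v"] v by (simp add: power2_eq_square)
    then show ?thesis by (simp add: P_def mult.assoc flip: exp_add)
  qed
  have "Gp \<theta> + 1 / (2 * v\<^sup>2) = ((J - pi / (2 * v)) * exp (v * \<theta>) + (J + pi / (2 * v)) * exp (- (v * \<theta>))) / 2"
  proof -
    have "A = (X + Y) / 2" if "A + B = X" "A - B = Y" for A B X Y :: real
      using that by simp
    from this[OF 1 2] show ?thesis .
  qed
  also have "\<dots> = J * cosh (v * \<theta>) - pi / (2 * v) * sinh (v * \<theta>)"
    by (simp add: cosh_def sinh_def algebra_simps add_divide_distrib diff_divide_distrib)
  also have "\<dots> = pi / (2 * v) * (cosh (pi * v) * cosh (v * \<theta>) - sinh (pi * v) * sinh (v * \<theta>)) / sinh (pi * v)"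
    using v sh by (simp add: J field_simps)
  also have "cosh (pi * v) * cosh (v * \<theta>) - sinh (pi * v) * sinh (v * \<theta>) = cosh (v * (pi - \<theta>))"
    using cosh_diff[of "pi * v" "v * \<theta>"] by (simp add: algebra_simps)
  finally show ?thesis using \<theta> by (simp add: G_eq[symmetric] G_def m_def)
qed

section \<open>Fourier transforms of the densities\<close>

lemma summable_cos_over_square_plus: "summable (\<lambda>n. cos (real (Suc n) * \<theta>) / ((real (Suc n))\<^sup>2 + v\<^sup>2))"
proof (rule summable_comparison_test'[OF summable_inverse_Suc_squared, of 0])
  fix n
  have "\<bar>cos (real (Suc n) * \<theta>)\<bar> / ((real (Suc n))\<^sup>2 + v\<^sup>2) \<le> 1 / (real (Suc n))\<^sup>2"
    by (intro frac_le) (auto simp: power2_eq_square)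
  then show "norm (cos (real (Suc n) * \<theta>) / ((real (Suc n))\<^sup>2 + v\<^sup>2)) \<le> 1 / (real (Suc n))\<^sup>2"
    by (simp add: abs_div add_nonneg_nonneg del: of_nat_Suc)
qed

text \<open>Subtracting the cosine series at \<open>2 * pi * \<alpha>\<close> from the one at
  \<open>0\<close> cancels the shift \<open>1 / (2 * v^2)\<close>, and the difference of two values
  of \<open>cosh\<close> factors into two values of \<open>sinh\<close>. For \<open>v = 0\<close>
  the quadratic formula takes over.\<close>

lemma sums_one_minus_cos:
  fixes \<alpha> v :: real
  assumes \<alpha>: "0 \<le> \<alpha>" "\<alpha> \<le> 1"
  shows "(\<lambda>n. (1 - cos (real (Suc n) * (2 * pi * \<alpha>))) / ((real (Suc n))\<^sup>2 + v\<^sup>2)) sums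
    (if v = 0 then pi\<^sup>2 * \<alpha> * (1 - \<alpha>) else pi / v * sinh (pi * v * \<alpha>) * sinh (pi * v * (1 - \<alpha>)) / sinh (pi * v))"
proof -
  let ?S = "\<lambda>\<theta>. \<Sum>n. cos (real (Suc n) * \<theta>) / ((real (Suc n))\<^sup>2 + v\<^sup>2)"
  have \<theta>: "0 \<le> 2 * pi * \<alpha>" "2 * pi * \<alpha> \<le> 2 * pi" using \<alpha> by auto
  have "(\<lambda>n. cos (real (Suc n) * 0) / ((real (Suc n))\<^sup>2 + v\<^sup>2) - cos (real (Suc n) * (2 * pi * \<alpha>)) / ((real (Suc n))\<^sup>2 + v\<^sup>2))
      sums (?S 0 - ?S (2 * pi * \<alpha>))"
    by (intro sums_diff summable_sums summable_cos_over_square_plus)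
  then have *: "(\<lambda>n. (1 - cos (real (Suc n) * (2 * pi * \<alpha>))) / ((real (Suc n))\<^sup>2 + v\<^sup>2)) sums (?S 0 - ?S (2 * pi * \<alpha>))"
    by (simp add: diff_divide_distrib del: of_nat_Suc)
  show ?thesis
  proof (cases "v = 0")
    case True
    have "?S 0 - ?S (2 * pi * \<alpha>) = - (((2 * pi * \<alpha> - pi)\<^sup>2 - pi\<^sup>2) / 4)"
      using sum_cos_over_square[OF \<theta>] sum_cos_over_square[of 0] by (simp add: True del: of_nat_Suc)
    also have "\<dots> = pi\<^sup>2 * \<alpha> * (1 - \<alpha>)" by (simp add: field_simps power2_eq_square)
    finally show ?thesis using * True by simp
  next
    case False
    have "?S 0 - ?S (2 * pi * \<alpha>) = pi / (2 * v) * cosh (v * (pi - 0)) / sinh (pi * v) - pi / (2 * v) * cosh (v * (pi - 2 * pi * \<alpha>)) / sinh (pi * v)"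
      using sum_cos_over_square_plus[OF \<theta> False] sum_cos_over_square_plus[of 0 v] False
      by (simp del: of_nat_Suc)
    also have "\<dots> = pi / (2 * v) * (cosh (pi * v * (1 - \<alpha>) + pi * v * \<alpha>) - cosh (pi * v * (1 - \<alpha>) - pi * v * \<alpha>)) / sinh (pi * v)"
      by (simp add: algebra_simps diff_divide_distrib)
    also have "cosh (pi * v * (1 - \<alpha>) + pi * v * \<alpha>) - cosh (pi * v * (1 - \<alpha>) - pi * v * \<alpha>) = 2 * sinh (pi * v * \<alpha>) * sinh (pi * v * (1 - \<alpha>))"
      by (simp only: cosh_add cosh_diff) simp
    finally show ?thesis using * False by (simp add: mult_ac)
  qed
qed

lemma measurable_cis [measurable]: "cis \<in> borel_measurable borel"
  by (intro borel_measurable_continuous_onI continuous_intros)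

lemma exp_decay_half_line:
  fixes a w :: real
  assumes a: "a > 0"
  shows "has_bochner_integral lborel (\<lambda>t. indicator {0<..} t *\<^sub>R exp (- Complex a w * of_real t)) (1 / Complex a w)"
proof -
  let ?c = "Complex a w"
  have c: "?c \<noteq> 0" using a by (simp add: complex_eq_iff)
  have "set_integrable lborel (einterval 0 \<infinity>) (\<lambda>t. exp (- (a * t)))"
  proof (rule interval_integral_FTC_nonneg(1)[where F = "\<lambda>t. - exp (- (a * t)) / a" and A = "- 1 / a" and B = 0])
    show "DERIV (\<lambda>t. - exp (- (a * t)) / a) t :> exp (- (a * t))" for t
      using a by (auto intro!: derivative_eq_intros)
    show "(((\<lambda>t. - exp (- (a * t)) / a) \<circ> real_of_ereal) \<longlongrightarrow> - 1 / a) (at_right 0)"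
    proof -
      have "((\<lambda>t. - exp (- (a * t)) / a) \<longlongrightarrow> - exp (- (a * 0)) / a) (at_right 0)"
        using a by (intro tendsto_intros) auto
      then show ?thesis unfolding zero_ereal_def ereal_tendsto_simps by simp
    qed
    show "(((\<lambda>t. - exp (- (a * t)) / a) \<circ> real_of_ereal) \<longlongrightarrow> 0) (at_left \<infinity>)"
      unfolding ereal_tendsto_simps using a by real_asymp
  qed (auto intro!: continuous_intros)
  then have int_real: "set_integrable lborel {0<..} (\<lambda>t. exp (- (a * t)))"
    by (simp add: zero_ereal_def)
  have norm_exp: "norm (exp (- ?c * of_real t)) = exp (- (a * t))" for t
    by simp
  have int: "set_integrable lborel (einterval 0 \<infinity>) (\<lambda>t. exp (- ?c * of_real t))"
    unfolding set_integrable_def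
  proof (rule Bochner_Integration.integrable_bound)
    show "integrable lborel (\<lambda>t. indicator {0<..} t *\<^sub>R exp (- (a * t)))"
      using int_real by (simp add: set_integrable_def)
    show "AE t in lborel. norm (indicator (einterval 0 \<infinity>) t *\<^sub>R exp (- ?c * of_real t)) \<le> norm (indicator {0<..} t *\<^sub>R exp (- (a * t)))"
      unfolding norm_scaleR norm_exp by (simp add: zero_ereal_def)
  qed simp
  have "(LBINT t=0..\<infinity>. exp (- ?c * of_real t)) = 0 - (- (1 / ?c))"
  proof (rule interval_integral_FTC_integrable[where F = "\<lambda>t. - exp (- ?c * of_real t) / ?c"])
    show "((\<lambda>t. - exp (- ?c * of_real t) / ?c) has_vector_derivative exp (- ?c * of_real t)) (at t)" for t
    proof -
      have "((\<lambda>s. - exp (- ?c * s) / ?c) has_field_derivative exp (- ?c * of_real t)) (at (of_real t))"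
        using c by (auto intro!: derivative_eq_intros)
      from has_vector_derivative_real_field[OF this] show ?thesis .
    qed
    show "isCont (\<lambda>t. exp (- ?c * of_real t)) t" for t by (intro continuous_intros)
    show "set_integrable lborel (einterval 0 \<infinity>) (\<lambda>t. exp (- ?c * of_real t))" by (rule int)
    have "((\<lambda>t. - exp (- ?c * of_real t) / ?c) \<longlongrightarrow> - exp (- ?c * of_real 0) / ?c) (at_right 0)"
      using c by (intro tendsto_intros)
    then show "(((\<lambda>t. - exp (- ?c * of_real t) / ?c) \<circ> real_of_ereal) \<longlongrightarrow> - (1 / ?c)) (at_right 0)"
      unfolding zero_ereal_def ereal_tendsto_simps by simp
    have "((\<lambda>t. exp (- (a * t))) \<longlongrightarrow> 0) at_top"
      using a by real_asymp
    then have "((\<lambda>t. norm (exp (- ?c * of_real t))) \<longlongrightarrow> 0) at_top"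
      by (simp only: norm_exp)
    then have "((\<lambda>t. exp (- ?c * of_real t)) \<longlongrightarrow> 0) at_top"
      by (rule tendsto_norm_zero_cancel)
    then have "((\<lambda>t. - exp (- ?c * of_real t) / ?c) \<longlongrightarrow> - 0 / ?c) at_top"
      using c by (intro tendsto_intros)
    then show "(((\<lambda>t. - exp (- ?c * of_real t) / ?c) \<circ> real_of_ereal) \<longlongrightarrow> 0) (at_left \<infinity>)"
      unfolding ereal_tendsto_simps by simp
  qed simp
  then show ?thesis
    using int by (simp add: has_bochner_integral_iff interval_lebesgue_integral_def set_lebesgue_integral_def set_integrable_def zero_ereal_def)
qed

lemma has_bochner_integral_reflect:
  fixes f :: "real \<Rightarrow> 'a::{banach, second_countable_topology}"
  assumes "has_bochner_integral lborel f I"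
  shows "has_bochner_integral lborel (\<lambda>t. f (- t)) I"
  using assms lborel_integrable_real_affine[of f "-1" 0] lborel_integral_real_affine[of "-1" f 0]
  by (simp add: has_bochner_integral_iff)

lemma two_sided_exp_fourier:
  fixes a w :: real
  assumes a: "a > 0"
  shows "has_bochner_integral lborel (\<lambda>t. of_real (exp (- a * \<bar>t\<bar>)) * cis (- (w * t))) (of_real (2 * a / (a\<^sup>2 + w\<^sup>2)))"
proof -
  let ?f = "\<lambda>w t. indicator {0<..} t *\<^sub>R exp (- Complex a w * complex_of_real t)"
  have pos: "a\<^sup>2 + w\<^sup>2 > 0" using a by (simp add: add_pos_nonneg)
  have "has_bochner_integral lborel (\<lambda>t. ?f w t + ?f (- w) (- t)) (1 / Complex a w + 1 / Complex a (- w))"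
    by (intro has_bochner_integral_add exp_decay_half_line a has_bochner_integral_reflect[OF exp_decay_half_line])
  also have "1 / Complex a w + 1 / Complex a (- w) = of_real (2 * a / (a\<^sup>2 + w\<^sup>2))"
  proof -
    have "1 / Complex a w + 1 / Complex a (- w) = (Complex a (- w) + Complex a w) / (Complex a w * Complex a (- w))"
      using a by (simp add: add_frac_eq complex_eq_iff)
    also have "Complex a (- w) + Complex a w = of_real (2 * a)" by (simp add: complex_eq_iff)
    also have "Complex a w * Complex a (- w) = of_real (a\<^sup>2 + w\<^sup>2)" by (simp add: complex_eq_iff power2_eq_square)
    finally show ?thesis by (simp only: of_real_divide)
  qed
  finally have *: "has_bochner_integral lborel (\<lambda>t. ?f w t + ?f (- w) (- t)) (of_real (2 * a / (a\<^sup>2 + w\<^sup>2)))" .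
  show ?thesis
  proof (rule has_bochner_integral_cong_AE[THEN iffD1, OF _ _ _ *])
    \<comment> \<open>At \<open>t = 0\<close> both indicators are zero although the right side is
      \<open>1\<close>; this is the only point of disagreement.\<close>
    have "AE t in lborel. t \<noteq> (0::real)" by (rule AE_lborel_singleton)
    then show "AE t in lborel. ?f w t + ?f (- w) (- t) = of_real (exp (- a * \<bar>t\<bar>)) * cis (- (w * t))"
      by eventually_elim (auto simp: complex_eq_iff Re_exp Im_exp cis.ctr abs_if)
  qed auto
qed

text \<open>The Fourier transform of \<open>p_az\<close>, extended continuously by \<open>1\<close>
  at \<open>w = 0\<close>. For \<open>\<alpha> = z = 1/2\<close> it reduces to
  \<open>tanh (w / 2) / (w / 2)\<close>.\<close>

definition p_az_hat :: "real \<Rightarrow> real \<Rightarrow> real \<Rightarrow> real" where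
  "p_az_hat \<alpha> z w = (if w = 0 then 1 else
     2 * z / (\<alpha> * (1 - \<alpha>) * w) * sinh ((1 - \<alpha>) * w / (2 * z)) * sinh (\<alpha> * w / (2 * z)) / sinh (w / (2 * z)))"

text \<open>With \<open>r = exp (- 2 * pi * z * \<bar>t\<bar>)\<close> and
  \<open>\<theta> = 2 * pi * \<alpha>\<close>, the argument of the logarithm is the squared modulus
  of \<open>(1 - r * cis \<theta>) / (1 - r)\<close>. Its logarithm is twice a difference of real
  parts of \<open>Ln\<close>, each of which is a power series in \<open>r\<close>.\<close>

lemma p_az_series:
  assumes t: "t \<noteq> 0" and z: "z > 0"
  shows "(\<lambda>n. z / (2 * pi * \<alpha> * (1 - \<alpha>)) * (2 * (1 - cos (real (Suc n) * (2 * pi * \<alpha>))) / real (Suc n))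
    * exp (- (2 * pi * z * real (Suc n)) * \<bar>t\<bar>)) sums p_az \<alpha> z t"
proof -
  define r where "r = exp (- (2 * pi * z * \<bar>t\<bar>))"
  have r: "0 < r" "r < 1" using t z by (simp_all add: r_def)
  define \<theta> where "\<theta> = 2 * pi * \<alpha>"
  have rpow: "r ^ Suc n = exp (- (2 * pi * z * real (Suc n)) * \<bar>t\<bar>)" for n
    by (simp add: r_def exp_of_nat_mult[symmetric] algebra_simps del: power_Suc)
  have "(\<lambda>n. 2 * (- (r ^ Suc n / real (Suc n) * cos (real (Suc n) * \<theta>)) - (- (r ^ Suc n / real (Suc n) * cos (real (Suc n) * 0)))))
     sums (2 * (Re (Ln (1 - of_real r * cis \<theta>)) - Re (Ln (1 - of_real r * cis 0))))"
    using r by (intro sums_mult sums_diff Ln_one_minus_cis_series) auto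
  moreover have "2 * (- (r ^ Suc n / real (Suc n) * cos (real (Suc n) * \<theta>)) - (- (r ^ Suc n / real (Suc n) * cos (real (Suc n) * 0))))
     = 2 * (1 - cos (real (Suc n) * \<theta>)) / real (Suc n) * r ^ Suc n" for n
    by (simp add: algebra_simps diff_divide_distrib del: of_nat_Suc power_Suc)
  moreover have "2 * (Re (Ln (1 - of_real r * cis \<theta>)) - Re (Ln (1 - of_real r * cis 0))) = ln (1 + (sin (pi * \<alpha>) / sinh (pi * z * t))\<^sup>2)"
  proof -
    have nz: "1 - of_real r * cis \<phi> \<noteq> 0" for \<phi>
    proof
      assume "1 - of_real r * cis \<phi> = 0"
      then have "norm (of_real r * cis \<phi>) = 1" by (metis eq_iff_diff_eq_0 norm_one)
      then show False using r by (simp add: norm_mult)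
    qed
    have nrm: "(norm (1 - of_real r * cis \<phi>))\<^sup>2 = 1 - 2 * r * cos \<phi> + r\<^sup>2" for \<phi>
    proof -
      have "(norm (1 - of_real r * cis \<phi>))\<^sup>2 = (1 - r * cos \<phi>)\<^sup>2 + (r * sin \<phi>)\<^sup>2"
        by (simp add: cmod_power2)
      also have "\<dots> = 1 - 2 * r * cos \<phi> + r\<^sup>2 * ((sin \<phi>)\<^sup>2 + (cos \<phi>)\<^sup>2)"
        by algebra
      finally show ?thesis by simp
    qed
    have "2 * (Re (Ln (1 - of_real r * cis \<theta>)) - Re (Ln (1 - of_real r * cis 0)))
        = ln ((norm (1 - of_real r * cis \<theta>))\<^sup>2 / (norm (1 - of_real r * cis 0))\<^sup>2)"
      using nz[of \<theta>] nz[of 0] by (simp add: Re_Ln ln_div ln_realpow)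
    also have "(norm (1 - of_real r * cis \<theta>))\<^sup>2 / (norm (1 - of_real r * cis 0))\<^sup>2 = (1 - 2 * r * cos \<theta> + r\<^sup>2) / (1 - r)\<^sup>2"
      unfolding nrm by (simp add: power2_eq_square algebra_simps)
    also have "\<dots> = 1 + (sin (pi * \<alpha>) / sinh (pi * z * t))\<^sup>2"
    proof -
      have cos: "cos \<theta> = 1 - 2 * (sin (pi * \<alpha>))\<^sup>2"
        using cos_double_sin[of "pi * \<alpha>"] by (simp add: \<theta>_def mult_ac)
      define e where "e = exp (- (pi * z * \<bar>t\<bar>))"
      have e: "e > 0" "r = e\<^sup>2" by (simp_all add: e_def r_def power2_eq_square flip: exp_add)
      have "(sinh (pi * z * t))\<^sup>2 = (sinh (pi * z * \<bar>t\<bar>))\<^sup>2"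
        by (cases "t \<ge> 0") auto
      also have "sinh (pi * z * \<bar>t\<bar>) = (1 / e - e) / 2"
        by (simp add: sinh_def e_def exp_minus field_simps)
      finally have sh: "(sinh (pi * z * t))\<^sup>2 = (1 - r)\<^sup>2 / (4 * r)"
        using e by (simp add: field_simps power2_eq_square)
      have "(sin (pi * \<alpha>) / sinh (pi * z * t))\<^sup>2 = 4 * r * (sin (pi * \<alpha>))\<^sup>2 / (1 - r)\<^sup>2"
        unfolding power_divide sh by simp
      then have "1 + (sin (pi * \<alpha>) / sinh (pi * z * t))\<^sup>2 = ((1 - r)\<^sup>2 + 4 * r * (sin (pi * \<alpha>))\<^sup>2) / (1 - r)\<^sup>2"
        using r by (simp add: add_divide_distrib)
      also have "(1 - r)\<^sup>2 + 4 * r * (sin (pi * \<alpha>))\<^sup>2 = 1 - 2 * r * cos \<theta> + r\<^sup>2"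
        unfolding cos by algebra
      finally show ?thesis by simp
    qed
    finally show ?thesis .
  qed
  ultimately have "(\<lambda>n. 2 * (1 - cos (real (Suc n) * \<theta>)) / real (Suc n) * r ^ Suc n) sums ln (1 + (sin (pi * \<alpha>) / sinh (pi * z * t))\<^sup>2)"
    by simp
  from sums_mult[OF this, of "z / (2 * pi * \<alpha> * (1 - \<alpha>))"] show ?thesis
    unfolding rpow \<theta>_def p_az_def by (simp add: mult.assoc del: of_nat_Suc)
qed

lemma measurable_p_az [measurable]: "p_az \<alpha> z \<in> borel_measurable borel"
  unfolding p_az_def[abs_def] sinh_def by measurable

text \<open>The coefficients contain \<open>1 - cos\<close> and are nonnegative, so the norms of the
  terms sum to the density itself away from \<open>0\<close>. The integrals of these norms are of
  order \<open>1 / n^2\<close>, and this allows integrating the series term by term in spite of the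
  singularity at \<open>0\<close>.\<close>

theorem p_az_fourier:
  assumes \<alpha>: "0 < \<alpha>" "\<alpha> < 1" and z: "0 < z"
  shows "has_bochner_integral lborel (\<lambda>t. of_real (p_az \<alpha> z t) * cis (- (w * t))) (of_real (p_az_hat \<alpha> z w))"
proof -
  define \<kappa> where "\<kappa> = z / (2 * pi * \<alpha> * (1 - \<alpha>))"
  define c where "c n = \<kappa> * (2 * (1 - cos (real (Suc n) * (2 * pi * \<alpha>))) / real (Suc n))" for n
  define a where "a n = 2 * pi * z * real (Suc n)" for n
  define f where "f n t = of_real (c n) * (of_real (exp (- a n * \<bar>t\<bar>)) * cis (- (w * t)))" for n t
  have \<kappa>: "\<kappa> > 0" using \<alpha> z by (simp add: \<kappa>_def)
  have c: "c n \<ge> 0" for n using \<kappa> by (simp add: c_def)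
  have a: "a n > 0" for n using z by (simp add: a_def)
  have norm_f: "norm (f n t) = c n * exp (- a n * \<bar>t\<bar>)" for n t
    using c[of n] by (simp add: f_def norm_mult)
  have f_int: "has_bochner_integral lborel (f n) (of_real (c n) * of_real (2 * a n / ((a n)\<^sup>2 + w\<^sup>2)))" for n
    unfolding f_def by (intro has_bochner_integral_mult_right two_sided_exp_fourier a)
  have exp_int: "has_bochner_integral lborel (\<lambda>t. exp (- a n * \<bar>t\<bar>)) (2 / a n)" for n
    using has_bochner_integral_Re[OF two_sided_exp_fourier[OF a[of n], of 0]] a[of n] by (simp add: power2_eq_square)
  have norm_int: "has_bochner_integral lborel (\<lambda>t. norm (f n t)) (c n * (2 / a n))" for n
    unfolding norm_f by (intro has_bochner_integral_mult_right exp_int)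
  have series: "(\<lambda>n. c n * exp (- a n * \<bar>t\<bar>)) sums p_az \<alpha> z t" if "t \<noteq> 0" for t
    using p_az_series[OF that z, of \<alpha>] by (simp only: c_def a_def \<kappa>_def)
  have AE0: "AE t in lborel. t \<noteq> (0::real)" by (rule AE_lborel_singleton)
  have norm_summable: "AE t in lborel. summable (\<lambda>n. norm (f n t))"
    using AE0 unfolding norm_f by eventually_elim (rule sums_summable[OF series])
  have int_summable: "summable (\<lambda>n. \<integral>t. norm (f n t) \<partial>lborel)"
  proof (rule summable_comparison_test'[of "\<lambda>n. 4 * \<kappa> / (pi * z) * (1 / (real (Suc n))\<^sup>2)" 0])
    fix n
    have "(\<integral>t. norm (f n t) \<partial>lborel) = c n * (2 / a n)"
      using norm_int by (simp add: has_bochner_integral_iff)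
    also have "\<dots> = 2 * \<kappa> / (pi * z) * ((1 - cos (real (Suc n) * (2 * pi * \<alpha>))) / (real (Suc n))\<^sup>2)"
    proof -
      have "\<kappa> * (2 * (1 - C) / m) * (2 / (2 * pi * z * m)) = 2 * \<kappa> / (pi * z) * ((1 - C) / m\<^sup>2)" if "m > 0" for C m
        using that z by (simp add: field_simps power2_eq_square)
      then show ?thesis by (simp only: c_def a_def of_nat_0_less_iff zero_less_Suc)
    qed
    also have "\<dots> \<le> 2 * \<kappa> / (pi * z) * (2 / (real (Suc n))\<^sup>2)"
      using \<kappa> z cos_ge_minus_one[of "real (Suc n) * (2 * pi * \<alpha>)"]
      by (intro mult_left_mono divide_right_mono) (linarith, simp_all)
    finally show "norm (\<integral>t. norm (f n t) \<partial>lborel) \<le> 4 * \<kappa> / (pi * z) * (1 / (real (Suc n))\<^sup>2)"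
      by simp
  qed (intro summable_mult summable_inverse_Suc_squared)
  have f_integrable: "integrable lborel (f n)" for n
    using f_int by (simp add: has_bochner_integral_iff)
  note si = f_integrable norm_summable int_summable
  have S_eq: "AE t in lborel. (\<Sum>n. f n t) = of_real (p_az \<alpha> z t) * cis (- (w * t))"
    using AE0
  proof eventually_elim
    case (elim t)
    have "(\<lambda>n. of_real (c n * exp (- a n * \<bar>t\<bar>)) * cis (- (w * t))) sums (of_real (p_az \<alpha> z t) * cis (- (w * t)))"
      by (intro sums_mult2 sums_of_real series elim)
    then show ?case by (simp add: sums_iff f_def mult.assoc)
  qed
  have I: "has_bochner_integral lborel (\<lambda>t. \<Sum>n. f n t) (\<Sum>n. integral\<^sup>L lborel (f n))"
    using integrable_suminf[OF si] integral_suminf[OF si] by (simp add: has_bochner_integral_iff)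
  have "(\<lambda>n. integral\<^sup>L lborel (f n)) sums of_real (p_az_hat \<alpha> z w)"
  proof -
    \<comment> \<open>Taking \<open>(2 * pi * z)^2\<close> out of the denominators brings the sum to
      the form of \<open>sums_one_minus_cos\<close>, with
      \<open>pi * v = w / (2 * z)\<close>.\<close>
    define v where "v = w / (2 * pi * z)"
    have "c n * (2 * a n / ((a n)\<^sup>2 + w\<^sup>2)) = 1 / (pi\<^sup>2 * \<alpha> * (1 - \<alpha>)) * ((1 - cos (real (Suc n) * (2 * pi * \<alpha>))) / ((real (Suc n))\<^sup>2 + v\<^sup>2))" for n
    proof -
      define m where "m = real (Suc n)"
      have m: "m > 0" by (simp add: m_def)
      have den: "m\<^sup>2 + v\<^sup>2 \<noteq> 0" using m by (metis add_eq_0_iff less_irrefl neg_le_0_iff_le not_sum_power2_lt_zero sum_power2_eq_zero_iff zero_le_power2)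
      have "(a n)\<^sup>2 + w\<^sup>2 = (2 * pi * z)\<^sup>2 * (m\<^sup>2 + v\<^sup>2)"
        using z by (simp add: a_def v_def m_def power_mult_distrib power_divide distrib_left del: of_nat_Suc)
      then show ?thesis
        using z \<alpha> m den unfolding c_def a_def \<kappa>_def m_def[symmetric]
        by (simp add: power2_eq_square divide_simps)
    qed
    moreover have "integral\<^sup>L lborel (f n) = of_real (c n * (2 * a n / ((a n)\<^sup>2 + w\<^sup>2)))" for n
      using f_int[of n] by (simp add: has_bochner_integral_iff)
    ultimately have "integral\<^sup>L lborel (f n) = of_real (1 / (pi\<^sup>2 * \<alpha> * (1 - \<alpha>)) * ((1 - cos (real (Suc n) * (2 * pi * \<alpha>))) / ((real (Suc n))\<^sup>2 + v\<^sup>2)))" for n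
      by simp
    moreover have "1 / (pi\<^sup>2 * \<alpha> * (1 - \<alpha>)) * (if v = 0 then pi\<^sup>2 * \<alpha> * (1 - \<alpha>) else pi / v * sinh (pi * v * \<alpha>) * sinh (pi * v * (1 - \<alpha>)) / sinh (pi * v)) = p_az_hat \<alpha> z w"
    proof (cases "w = 0")
      case False
      then have v: "v \<noteq> 0" using z by (simp add: v_def)
      have pv: "pi * v = w / (2 * z)" by (simp add: v_def)
      have "1 / (pi\<^sup>2 * \<alpha> * (1 - \<alpha>)) * (pi / v) = 2 * z / (\<alpha> * (1 - \<alpha>) * w)"
        using z False by (simp add: v_def power2_eq_square)
      then have "1 / (pi\<^sup>2 * \<alpha> * (1 - \<alpha>)) * (pi / v * S1 * S2 / S3) = 2 * z / (\<alpha> * (1 - \<alpha>) * w) * S2 * S1 / S3" for S1 S2 S3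
        by (metis (no_types, opaque_lifting) mult.assoc mult.commute times_divide_eq_right)
      moreover have "w / (2 * z) * \<alpha> = \<alpha> * w / (2 * z)" "w / (2 * z) * (1 - \<alpha>) = (1 - \<alpha>) * w / (2 * z)" by simp_all
      ultimately show ?thesis using False v unfolding p_az_hat_def pv by presburger
    qed (use \<alpha> in \<open>simp add: v_def p_az_hat_def\<close>)
    ultimately show ?thesis
      using sums_of_real[OF sums_mult[OF sums_one_minus_cos[of \<alpha> v]], of "1 / (pi\<^sup>2 * \<alpha> * (1 - \<alpha>))", where 'a = complex] \<alpha>
      by simp
  qed
  then have "has_bochner_integral lborel (\<lambda>t. \<Sum>n. f n t) (of_real (p_az_hat \<alpha> z w))"
    using I by (simp add: sums_iff)
  then show ?thesis
    by (rule has_bochner_integral_cong_AE[THEN iffD1, OF _ _ S_eq, rotated 2])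
      (use borel_measurable_integrable[OF integrable_suminf[OF si]] in auto)
qed

lemma fourier_zero_imp_has_bochner_integral:
  assumes "has_bochner_integral lborel (\<lambda>t. of_real (f t) * cis (- (0 * t))) (of_real I)"
  shows "has_bochner_integral lborel f I"
  using has_bochner_integral_Re[OF assms] by simp

lemma p_az_nonneg:
  assumes "0 < \<alpha>" "\<alpha> < 1" "0 < z"
  shows "0 \<le> p_az \<alpha> z t"
  using assms unfolding p_az_def by (intro mult_nonneg_nonneg ln_ge_zero) auto

lemma prob_density_p_az:
  assumes "0 < \<alpha>" "\<alpha> < 1" "0 < z"
  shows "prob_density (p_az \<alpha> z)"
  using p_az_nonneg[OF assms] fourier_zero_imp_has_bochner_integral[of "p_az \<alpha> z" 1] p_az_fourier[OF assms, of 0]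
  by (simp add: prob_density_def p_az_hat_def)

lemma p_dens_eq_p_az: "p_dens = p_az (1/2) (1/2)"
proof
  fix t
  show "p_dens t = p_az (1/2) (1/2) t"
  proof (cases "t = 0")
    case True
    \<comment> \<open>Both sides are \<open>0\<close> here: division by zero gives
      \<open>ln 0 = 0\<close> on the left and \<open>ln 1 = 0\<close> on the right.\<close>
    then show ?thesis by (simp add: p_dens_def p_az_def)
  next
    case False
    define u where "u = pi * t / 2"
    have u: "sinh u \<noteq> 0" using False by (simp add: u_def)
    have "1 + (1 / sinh u)\<^sup>2 = \<bar>cosh u / sinh u\<bar>\<^sup>2"
      using u cosh_square_eq[of u] by (simp add: field_simps)
    then have "ln (1 + (1 / sinh u)\<^sup>2) = 2 * ln \<bar>cosh u / sinh u\<bar>"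
      using u by (simp add: ln_realpow)
    then show ?thesis
      by (simp add: p_dens_def p_az_def u_def field_simps)
  qed
qed

section \<open>The convolution theorem and the density \<open>q_az\<close>\<close>

lemma measurable_convolution_kernel [measurable]:
  assumes [measurable]: "f \<in> borel_measurable borel" "g \<in> borel_measurable borel"
  shows "(\<lambda>(s, t). complex_of_real (f s * g (t - s)) * cis (- (w * t))) \<in> borel_measurable (lborel \<Otimes>\<^sub>M lborel)"
  by measurable

text \<open>Fubini for the kernel \<open>h\<close>, whose modulus integrates to the product of the
  two integrals of absolute values. Integrability of the convolution also comes from the product
  space, so unbounded densities are covered.\<close>

theorem convolution_fourier:
  fixes f g :: "real \<Rightarrow> real"
  assumes f: "integrable lborel f" and g: "integrable lborel g"
  shows "has_bochner_integral lborel (\<lambda>t. of_real (convolution f g t) * cis (- (w * t)))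
    ((LINT t|lborel. of_real (f t) * cis (- (w * t))) * (LINT t|lborel. of_real (g t) * cis (- (w * t))))"
proof -
  have fm [measurable]: "f \<in> borel_measurable borel" and gm [measurable]: "g \<in> borel_measurable borel"
    using f g by (auto dest: borel_measurable_integrable)
  define h where "h s t = complex_of_real (f s * g (t - s)) * cis (- (w * t))" for s t
  have hm: "(\<lambda>(s, t). h s t) \<in> borel_measurable (lborel \<Otimes>\<^sub>M lborel)"
    unfolding h_def by (rule measurable_convolution_kernel[OF fm gm])
  have gc: "integrable lborel (\<lambda>t. of_real (g t) * cis (- (w * t)))"
    by (rule Bochner_Integration.integrable_bound[OF g]) (auto simp: norm_mult)
  have shift_int: "integrable lborel (\<lambda>t. g (t - s))" for s
    using lborel_integrable_real_affine[OF g, of 1 "- s"] by simp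
  have h_int: "integrable lborel (h s)" for s
    unfolding h_def
    by (rule Bochner_Integration.integrable_bound[OF integrable_mult_right[OF shift_int[of s], of "f s"]]) (auto simp: norm_mult abs_mult)
  have norm_h: "(\<integral>t. norm (h s t) \<partial>lborel) = \<bar>f s\<bar> * (\<integral>t. \<bar>g t\<bar> \<partial>lborel)" for s
    using lborel_integral_real_affine[of 1 "\<lambda>t. \<bar>g t\<bar>" "- s"] by (simp add: h_def norm_mult abs_mult)
  have h2: "integrable (lborel \<Otimes>\<^sub>M lborel) (\<lambda>(s, t). h s t)"
  proof (rule lborel_pair.Fubini_integrable[OF hm])
    show "integrable lborel (\<lambda>s. \<integral>t. norm (case (s, t) of (s, t) \<Rightarrow> h s t) \<partial>lborel)"
      unfolding prod.case norm_h by (intro integrable_mult_left integrable_abs f)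
  qed (use h_int in simp)
  have h2': "integrable (lborel \<Otimes>\<^sub>M lborel) (\<lambda>(t, s). h s t)"
    using lborel_pair.integrable_product_swap[OF h2] by (simp add: case_prod_unfold)
  have conv: "(\<integral>s. h s t \<partial>lborel) = of_real (convolution f g t) * cis (- (w * t))" for t
    by (simp add: h_def convolution_def flip: of_real_mult del: of_real_mult)
  have "integrable lborel (\<lambda>t. \<integral>s. h s t \<partial>lborel)"
    using lborel_pair.integrable_fst'[OF h2'] by simp
  then have 1: "integrable lborel (\<lambda>t. of_real (convolution f g t) * cis (- (w * t)))"
    by (simp add: conv)
  have inner: "(\<integral>t. h s t \<partial>lborel) = of_real (f s) * cis (- (w * s)) * (\<integral>t. of_real (g t) * cis (- (w * t)) \<partial>lborel)" for s
  proof -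
    have "(\<integral>t. h s t \<partial>lborel) = (\<integral>t. h s (s + 1 * t) \<partial>lborel)"
      using lborel_integral_real_affine[of 1 "h s" s] by simp
    also have "(\<lambda>t. h s (s + 1 * t)) = (\<lambda>t. of_real (f s) * cis (- (w * s)) * (of_real (g t) * cis (- (w * t))))"
      by (simp add: h_def fun_eq_iff algebra_simps cis_mult)
    finally show ?thesis by simp
  qed
  have "(\<integral>t. of_real (convolution f g t) * cis (- (w * t)) \<partial>lborel) = (\<integral>t. (\<integral>s. h s t \<partial>lborel) \<partial>lborel)"
    by (simp add: conv)
  also have "\<dots> = (\<integral>s. (\<integral>t. h s t \<partial>lborel) \<partial>lborel)"
    using lborel_pair.Fubini_integral[OF h2] .
  also have "\<dots> = (LINT t|lborel. of_real (f t) * cis (- (w * t))) * (LINT t|lborel. of_real (g t) * cis (- (w * t)))"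
    by (simp add: inner)
  finally show ?thesis using 1 by (simp add: has_bochner_integral_iff)
qed

theorem q_az_fourier:
  assumes "0 < \<alpha>" "\<alpha> < 1" "0 < z"
  shows "has_bochner_integral lborel (\<lambda>t. of_real (q_az \<alpha> z t) * cis (- (w * t))) (of_real (p_az_hat (1/2) (1/2) w * p_az_hat \<alpha> z w))"
proof -
  have p: "has_bochner_integral lborel (\<lambda>t. of_real (p_dens t) * cis (- (w * t))) (of_real (p_az_hat (1/2) (1/2) w))" for w
    unfolding p_dens_eq_p_az by (rule p_az_fourier) auto
  have int: "integrable lborel p_dens" "integrable lborel (p_az \<alpha> z)"
    using prob_density_p_az[of "1/2" "1/2"] prob_density_p_az[OF assms]
    by (auto simp: prob_density_def has_bochner_integral_iff p_dens_eq_p_az)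
  show ?thesis
    using convolution_fourier[OF int, of w] p[of w] p_az_fourier[OF assms, of w]
    unfolding q_az_def by (simp add: has_bochner_integral_iff)
qed

lemma prob_density_p_dens: "prob_density p_dens"
  unfolding p_dens_eq_p_az by (rule prob_density_p_az) auto

text \<open>The total mass is the transform at frequency \<open>0\<close>, where both factors equal
  \<open>1\<close>.\<close>

lemma prob_density_q_az:
  assumes "0 < \<alpha>" "\<alpha> < 1" "0 < z"
  shows "prob_density (q_az \<alpha> z)"
proof -
  have "has_bochner_integral lborel (q_az \<alpha> z) 1"
    using fourier_zero_imp_has_bochner_integral[of "q_az \<alpha> z" 1] q_az_fourier[OF assms, of 0] by (simp add: p_az_hat_def)
  moreover have "0 \<le> q_az \<alpha> z t" for t
    unfolding q_az_def convolution_def p_dens_eq_p_az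
    by (intro Bochner_Integration.integral_nonneg mult_nonneg_nonneg p_az_nonneg) (use assms in auto)
  ultimately show ?thesis
    by (auto simp: prob_density_def has_bochner_integral_iff dest: borel_measurable_integrable)
qed

section \<open>The channel\<close>

definition complex_diag :: "('n::finite \<Rightarrow> complex) \<Rightarrow> 'n cmat" where
  "complex_diag f = (\<chi> i j. if i = j then f i else 0)"

lemma complex_diag_nth: "complex_diag f $ i $ j = (if i = j then f i else 0)"
  by (simp add: complex_diag_def)

lemma complex_diag_of_real: "complex_diag (\<lambda>i. complex_of_real (d i)) = real_diag d"
  by (simp add: complex_diag_def real_diag_def)

lemma complex_diag_mult_left_nth: "(complex_diag f ** X) $ i $ j = f i * X $ i $ j"
  by (simp add: matrix_matrix_mult_def complex_diag_nth if_distrib if_distribR sum.delta cong: if_cong)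

lemma complex_diag_mult_right_nth: "(X ** complex_diag f) $ i $ j = X $ i $ j * f j"
  by (simp add: matrix_matrix_mult_def complex_diag_nth if_distrib if_distribR sum.delta' cong: if_cong)

lemma complex_diag_mult: "complex_diag f ** complex_diag g = complex_diag (\<lambda>i. f i * g i)"
  by (auto simp: vec_eq_iff complex_diag_mult_left_nth) (auto simp: complex_diag_nth)

lemma ct_complex_diag: "ct (complex_diag f) = complex_diag (\<lambda>i. cnj (f i))"
  by (auto simp: vec_eq_iff complex_diag_nth)

lemma smult_mat_nth: "smult_mat c A $ i $ j = c * A $ i $ j"
  by (simp add: smult_mat_def)

lemma smult_mat_mult_left: "smult_mat c A ** B = smult_mat c (A ** B)"
  by (simp add: vec_eq_iff matrix_matrix_mult_def smult_mat_nth sum_distrib_left mult.assoc)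

lemma smult_mat_mult_right: "A ** smult_mat c B = smult_mat c (A ** B)"
  by (simp add: vec_eq_iff matrix_matrix_mult_def smult_mat_nth sum_distrib_left mult_ac)

lemma smult_mat_complex_diag: "smult_mat c (complex_diag f) = complex_diag (\<lambda>i. c * f i)"
  by (simp add: vec_eq_iff smult_mat_nth complex_diag_nth)

lemma smult_mat_of_real: "smult_mat (complex_of_real r) A = r *\<^sub>R A"
  by (simp add: vec_eq_iff smult_mat_nth) (simp add: scaleR_conv_of_real)

lemma complex_diag_scaleR: "r *\<^sub>R complex_diag f = complex_diag (\<lambda>i. r *\<^sub>R f i)"
  by (simp add: vec_eq_iff complex_diag_nth)

lemma mat_power_unitary_conj:
  assumes U: "unitary_mat U"
  shows "mat_power (U ** complex_diag f ** ct U) k = U ** complex_diag (\<lambda>i. f i ^ k) ** ct U"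
proof (induction k)
  case 0
  have "complex_diag (\<lambda>i::'a. 1) = mat 1" by (simp add: vec_eq_iff complex_diag_nth mat_def)
  then show ?case by (simp add: mat_power_def unitary_mult_ct[OF U])
next
  case (Suc k)
  have "mat_power (U ** complex_diag f ** ct U) (Suc k) = (U ** complex_diag f ** ct U) ** (U ** complex_diag (\<lambda>i. f i ^ k) ** ct U)"
    using Suc by (simp add: mat_power_def)
  also have "\<dots> = U ** (complex_diag f ** complex_diag (\<lambda>i. f i ^ k)) ** ct U"
    by (simp add: matrix_mul_assoc unitary_cancel_right'[OF U])
  finally show ?case by (simp add: complex_diag_mult)
qed

lemma bounded_linear_sandwich: "bounded_linear (\<lambda>X. A ** X ** B)" for A B :: "'n::finite cmat"
  using bounded_linear_compose[OF bounded_bilinear.bounded_linear_left[OF bounded_bilinear_matrix_mult]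
      bounded_bilinear.bounded_linear_right[OF bounded_bilinear_matrix_mult]] .

lemma mat_exp_unitary_conj:
  assumes U: "unitary_mat U"
  shows "mat_exp (U ** complex_diag f ** ct U) = U ** complex_diag (\<lambda>i. exp (f i)) ** ct U"
proof -
  have "(\<lambda>k. complex_diag (\<lambda>i. f i ^ k /\<^sub>R fact k)) sums complex_diag (\<lambda>i. exp (f i))"
    unfolding sums_def
  proof (intro vec_tendstoI)
    fix i j
    show "(\<lambda>n. (\<Sum>k<n. complex_diag (\<lambda>i. f i ^ k /\<^sub>R fact k)) $ i $ j) \<longlonglongrightarrow> complex_diag (\<lambda>i. exp (f i)) $ i $ j"
      using exp_converges[of "f i"] by (cases "i = j") (simp_all add: complex_diag_nth sums_def)
  qed
  from bounded_linear.sums[OF bounded_linear_sandwich this]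
  have "(\<lambda>k. U ** complex_diag (\<lambda>i. f i ^ k /\<^sub>R fact k) ** ct U) sums (U ** complex_diag (\<lambda>i. exp (f i)) ** ct U)" .
  moreover have "U ** complex_diag (\<lambda>i. f i ^ k /\<^sub>R fact k) ** ct U = mat_power (U ** complex_diag f ** ct U) k /\<^sub>R fact k" for k
    unfolding mat_power_unitary_conj[OF U] complex_diag_scaleR[symmetric]
    by (simp add: matrix_mult_scaleR_left matrix_mult_scaleR_right)
  ultimately show ?thesis
    unfolding mat_exp_def by (simp add: sums_iff)
qed

lemma mat_exp_smult:
  assumes d: "diagonalizes U d K"
  shows "mat_exp (smult_mat c K) = U ** complex_diag (\<lambda>i. exp (c * complex_of_real (d i))) ** ct U"
proof -
  have "smult_mat c K = U ** complex_diag (\<lambda>i. c * complex_of_real (d i)) ** ct U"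
    using d by (simp add: diagonalizes_def smult_mat_mult_left smult_mat_mult_right
        smult_mat_complex_diag[symmetric] complex_diag_of_real)
  then show ?thesis by (simp add: mat_exp_unitary_conj[OF diagonalizes_unitary[OF d]])
qed

lemma mat_exp_uminus:
  assumes "hermitian_mat K"
  shows "mat_exp (- K) = mat_fun (\<lambda>x. exp (- x)) K"
proof -
  obtain U d where d: "diagonalizes U d K" using hermitian_diagonalizable[OF assms] .
  have "- K = smult_mat (- 1) K" by (simp add: vec_eq_iff smult_mat_nth)
  moreover have "exp (- 1 * complex_of_real (d i)) = complex_of_real (exp (- d i))" for i
    by (simp add: exp_of_real[symmetric])
  ultimately show ?thesis
    by (simp only: mat_exp_smult[OF d] mat_fun_eq[OF d] complex_diag_of_real[symmetric])
qed

lemma smult_mat_has_bochner_integral: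
  fixes A :: "'n::finite cmat"
  assumes "has_bochner_integral M f I"
  shows "has_bochner_integral M (\<lambda>t. smult_mat (f t) A) (smult_mat I A)"
proof -
  have "linear (\<lambda>c. smult_mat c A)"
    by (intro linearI) (simp_all add: vec_eq_iff smult_mat_nth algebra_simps)
  then show ?thesis
    by (intro has_bochner_integral_bounded_linear[OF _ assms]) (simp add: linear_conv_bounded_linear)
qed

definition evolve :: "'n::finite cmat \<Rightarrow> real \<Rightarrow> 'n cmat \<Rightarrow> 'n cmat" where
  "evolve K t X = mat_exp (smult_mat (- (\<i> * complex_of_real t)) K) ** X ** mat_exp (smult_mat (\<i> * complex_of_real t) K)"

lemma Phi_evolve: "Phi q K X = (LINT t|lborel. q t *\<^sub>R evolve K t X)"
  by (simp add: Phi_def evolve_def)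

lemma evolve_nth:
  assumes d: "diagonalizes U d K"
  shows "(ct U ** evolve K t X ** U) $ i $ j = cis (- ((d i - d j) * t)) * (ct U ** X ** U) $ i $ j"
proof -
  note U = diagonalizes_unitary[OF d]
  let ?D = "\<lambda>c. complex_diag (\<lambda>i. exp (c * complex_of_real (d i)))"
  have "ct U ** evolve K t X ** U = ?D (- (\<i> * complex_of_real t)) ** (ct U ** X ** U) ** ?D (\<i> * complex_of_real t)"
    unfolding evolve_def mat_exp_smult[OF d]
    by (simp add: matrix_mul_assoc unitary_cancel_right'[OF U] unitary_ct_mult[OF U])
  then have "(ct U ** evolve K t X ** U) $ i $ j
      = exp (- (\<i> * complex_of_real t) * complex_of_real (d i)) * exp (\<i> * complex_of_real t * complex_of_real (d j)) * (ct U ** X ** U) $ i $ j"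
    by (simp add: complex_diag_mult_left_nth complex_diag_mult_right_nth)
  also have "exp (- (\<i> * complex_of_real t) * complex_of_real (d i)) * exp (\<i> * complex_of_real t * complex_of_real (d j)) = cis (- ((d i - d j) * t))"
    by (simp add: cis_conv_exp algebra_simps flip: exp_add)
  finally show ?thesis .
qed

definition single :: "'n::finite \<Rightarrow> 'n \<Rightarrow> 'n cmat" where
  "single i j = (\<chi> a b. if a = i \<and> b = j then 1 else 0)"

lemma matrix_eq_sum_single: "A = (\<Sum>i\<in>UNIV. \<Sum>j\<in>UNIV. smult_mat (A $ i $ j) (single i j))"
proof -
  have "(\<Sum>i\<in>UNIV. \<Sum>j\<in>UNIV. A $ i $ j * (if a = i \<and> b = j then 1 else 0)) = A $ a $ b" for a b
  proof -
    have "(\<Sum>i\<in>UNIV. \<Sum>j\<in>UNIV. A $ i $ j * (if a = i \<and> b = j then 1 else 0)) = (\<Sum>i\<in>UNIV. if i = a then A $ i $ b else 0)"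
      by (intro sum.cong refl) (auto simp: if_distrib sum.delta cong: if_cong)
    then show ?thesis by simp
  qed
  then show ?thesis by (simp add: vec_eq_iff smult_mat_nth single_def)
qed

text \<open>Conjugation multiplies the entry at \<open>i, j\<close> by a phase of frequency
  \<open>d i - d j\<close>. Expanding in matrix units of the eigenbasis reduces the matrix-valued
  integral to finitely many scalar Fourier integrals.\<close>

theorem evolve_has_bochner_integral:
  assumes K: "hermitian_mat K"
    and q: "\<And>w. has_bochner_integral lborel (\<lambda>t. of_real (q t) * cis (- (w * t))) (of_real (qhat w))"
  shows "has_bochner_integral lborel (\<lambda>t. q t *\<^sub>R evolve K t X) (schur (\<lambda>x y. qhat (x - y)) K K X)"
proof -
  obtain U d where d: "diagonalizes U d K" using hermitian_diagonalizable[OF K] .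
  note U = diagonalizes_unitary[OF d]
  let ?X = "ct U ** X ** U"
  have expand: "A = U ** (\<Sum>i\<in>UNIV. \<Sum>j\<in>UNIV. smult_mat ((ct U ** A ** U) $ i $ j) (single i j)) ** ct U" for A
    unfolding matrix_eq_sum_single[symmetric]
    by (simp add: matrix_mul_assoc unitary_mult_ct[OF U] unitary_cancel_right[OF U])
  have "has_bochner_integral lborel
     (\<lambda>t. U ** (\<Sum>i\<in>UNIV. \<Sum>j\<in>UNIV. smult_mat (of_real (q t) * cis (- ((d i - d j) * t)) * ?X $ i $ j) (single i j)) ** ct U)
     (U ** (\<Sum>i\<in>UNIV. \<Sum>j\<in>UNIV. smult_mat (of_real (qhat (d i - d j)) * ?X $ i $ j) (single i j)) ** ct U)"
    by (intro has_bochner_integral_bounded_linear[OF bounded_linear_sandwich] has_bochner_integral_sum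
        smult_mat_has_bochner_integral has_bochner_integral_mult_left q)
  moreover have "q t *\<^sub>R evolve K t X =
     U ** (\<Sum>i\<in>UNIV. \<Sum>j\<in>UNIV. smult_mat (of_real (q t) * cis (- ((d i - d j) * t)) * ?X $ i $ j) (single i j)) ** ct U" for t
  proof -
    have "(ct U ** (q t *\<^sub>R evolve K t X) ** U) $ i $ j = of_real (q t) * cis (- ((d i - d j) * t)) * ?X $ i $ j" for i j
      by (simp add: matrix_mult_scaleR_left matrix_mult_scaleR_right evolve_nth[OF d]) (simp add: scaleR_conv_of_real mult.assoc)
    then show ?thesis by (subst expand[of "q t *\<^sub>R evolve K t X"]) simp
  qed
  moreover have "schur (\<lambda>x y. qhat (x - y)) K K X =
     U ** (\<Sum>i\<in>UNIV. \<Sum>j\<in>UNIV. smult_mat (of_real (qhat (d i - d j)) * ?X $ i $ j) (single i j)) ** ct U"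
    by (subst expand) (simp add: schur_nth[OF d])
  ultimately show ?thesis by simp
qed

lemma Phi_eq_schur:
  assumes K: "hermitian_mat K"
    and q: "\<And>w. has_bochner_integral lborel (\<lambda>t. of_real (q t) * cis (- (w * t))) (of_real (qhat w))"
  shows "Phi q K X = schur (\<lambda>x y. qhat (x - y)) K K X"
  using evolve_has_bochner_integral[OF K q] unfolding Phi_evolve
  by (simp add: has_bochner_integral_iff)

lemma schur_smult:
  assumes "hermitian_mat A" "hermitian_mat B"
  shows "schur \<phi> A B (smult_mat c X) = smult_mat c (schur \<phi> A B X)"
proof -
  obtain U d where d: "diagonalizes U d A" using hermitian_diagonalizable[OF assms(1)] .
  obtain V e where e: "diagonalizes V e B" using hermitian_diagonalizable[OF assms(2)] .
  have "(\<chi> i j. complex_of_real (\<phi> (d i) (e j)) * (c * (ct U ** X ** V) $ i $ j)) =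
     smult_mat c (\<chi> i j. complex_of_real (\<phi> (d i) (e j)) * (ct U ** X ** V) $ i $ j)"
    by (simp add: vec_eq_iff smult_mat_nth mult_ac)
  then show ?thesis
    by (simp add: schur_eq[OF d e] schur_form_def smult_mat_mult_left smult_mat_mult_right smult_mat_nth)
qed

lemma trace_schur_unit_diagonal:
  assumes A: "hermitian_mat A" and \<phi>: "\<And>x. \<phi> x x = 1"
  shows "trace (schur \<phi> A A X) = trace X"
proof -
  obtain U d where d: "diagonalizes U d A" using hermitian_diagonalizable[OF A] .
  note U = diagonalizes_unitary[OF d]
  have "trace (ct U ** schur \<phi> A A X ** U) = trace (ct U ** X ** U)"
    by (simp add: trace_def schur_nth[OF d] \<phi>)
  then show ?thesis by (simp add: trace_unitary_conj[OF U])
qed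

lemma evolve_adjoint:
  assumes K: "hermitian_mat K"
  shows "ct (mat_exp (smult_mat (- (\<i> * complex_of_real t)) K)) = mat_exp (smult_mat (\<i> * complex_of_real t) K)"
proof -
  obtain U d where d: "diagonalizes U d K" using hermitian_diagonalizable[OF K] .
  show ?thesis
    by (simp add: mat_exp_smult[OF d] ct_mult ct_complex_diag matrix_mul_assoc exp_cnj)
qed

definition block_form :: "nat \<Rightarrow> (nat \<Rightarrow> complex ^ 'n) \<Rightarrow> (nat \<Rightarrow> nat \<Rightarrow> 'n::finite cmat) \<Rightarrow> complex" where
  "block_form m v X = (\<Sum>a<m. \<Sum>b<m. cinner (v a) (X a b *v v b))"

lemma block_psd_iff: "block_psd m X \<longleftrightarrow> (\<forall>v. block_form m v X \<in> \<real>\<^sub>\<ge>\<^sub>0)"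
  by (simp add: block_psd_def block_form_def cinner_def matrix_vector_mult_def sum_distrib_left mult.assoc)

text \<open>The conjugating matrix can be moved onto the test vectors: the form of the evolved
  blocks at \<open>v\<close> is the form of the original blocks at the vectors
  \<open>ct ?W *v v a\<close>.\<close>

lemma block_psd_evolve:
  assumes K: "hermitian_mat K" and X: "block_psd m X"
  shows "block_psd m (\<lambda>a b. evolve K t (X a b))"
proof -
  let ?W = "mat_exp (smult_mat (- (\<i> * complex_of_real t)) K)"
  have "block_form m v (\<lambda>a b. evolve K t (X a b)) = block_form m (\<lambda>a. ct ?W *v v a) X" for v
    unfolding block_form_def evolve_def evolve_adjoint[OF K, symmetric]
    by (simp add: cinner_matrix[of _ ?W] flip: matrix_vector_mul_assoc)
  then show ?thesis using X by (simp add: block_psd_iff)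
qed

lemma bounded_linear_cinner_matrix: "bounded_linear (\<lambda>A. cinner u (A *v w))"
  for u w :: "complex ^ 'n::finite"
proof -
  have "linear (\<lambda>A :: 'n cmat. cinner u (A *v w))"
    by (intro linearI)
      (simp_all add: cinner_def matrix_vector_mult_def sum_distrib_left scaleR_sum_right sum.distrib algebra_simps)
  then show ?thesis by (simp add: linear_conv_bounded_linear)
qed

lemma has_bochner_integral_nonneg_Reals:
  fixes f :: "'a \<Rightarrow> complex"
  assumes "has_bochner_integral M f I" "\<And>t. f t \<in> \<real>\<^sub>\<ge>\<^sub>0"
  shows "I \<in> \<real>\<^sub>\<ge>\<^sub>0"
proof -
  have "has_bochner_integral M (\<lambda>t. Re (f t)) (Re I)" "has_bochner_integral M (\<lambda>t. Im (f t)) (Im I)"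
    using assms(1) by (auto intro: has_bochner_integral_Re has_bochner_integral_Im)
  moreover have "Im (f t) = 0" "Re (f t) \<ge> 0" for t
    using assms(2)[of t] by (auto simp: complex_nonneg_Reals_iff)
  ultimately have "Im I = 0" "Re I \<ge> 0"
    using Bochner_Integration.integral_nonneg[of M "\<lambda>t. Re (f t)"] by (auto simp: has_bochner_integral_iff)
  then show ?thesis by (simp add: complex_nonneg_Reals_iff)
qed

text \<open>Complete positivity holds because the block form of the image is an integral of
  nonnegative block forms against a nonnegative density. Linearity and trace preservation are read
  off the multiplier: its diagonal is \<open>qhat 0 = 1\<close>.\<close>

theorem quantum_channel_Phi:
  fixes K :: "'n::finite cmat"
  assumes K: "hermitian_mat K" and q0: "\<And>t. q t \<ge> 0" and qhat0: "qhat 0 = 1"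
    and q: "\<And>w. has_bochner_integral lborel (\<lambda>t. of_real (q t) * cis (- (w * t))) (of_real (qhat w))"
  shows "quantum_channel (Phi q K)"
proof -
  note int = evolve_has_bochner_integral[OF K q]
  note Phi_schur = Phi_eq_schur[OF K q]
  have "block_psd m (\<lambda>a b. Phi q K (X a b))" if X: "block_psd m X" for m and X :: "nat \<Rightarrow> nat \<Rightarrow> 'n cmat"
    unfolding block_psd_iff
  proof
    fix v :: "nat \<Rightarrow> complex ^ 'n"
    have 1: "has_bochner_integral lborel (\<lambda>t. block_form m v (\<lambda>a b. q t *\<^sub>R evolve K t (X a b))) (block_form m v (\<lambda>a b. Phi q K (X a b)))"
      unfolding block_form_def Phi_schur
      by (intro has_bochner_integral_sum has_bochner_integral_bounded_linear[OF bounded_linear_cinner_matrix] int)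
    have 2: "block_form m v (\<lambda>a b. q t *\<^sub>R evolve K t (X a b)) = of_real (q t) * block_form m v (\<lambda>a b. evolve K t (X a b))" for t
      unfolding block_form_def linear_cmul[OF bounded_linear.linear[OF bounded_linear_cinner_matrix]]
      by (simp add: sum_distrib_left scaleR_conv_of_real)
    have 3: "of_real (q t) * block_form m v (\<lambda>a b. evolve K t (X a b)) \<in> \<real>\<^sub>\<ge>\<^sub>0" for t
      using block_psd_evolve[OF K X, of t] q0[of t] by (intro nonneg_Reals_mult_I) (auto simp: block_psd_iff)
    show "block_form m v (\<lambda>a b. Phi q K (X a b)) \<in> \<real>\<^sub>\<ge>\<^sub>0"
      by (rule has_bochner_integral_nonneg_Reals[OF 1]) (simp only: 2 3)
  qed
  then show ?thesis
    unfolding quantum_channel_def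
    by (auto simp: Phi_schur schur_add[OF K K] schur_smult[OF K K] trace_schur_unit_diagonal[OF K] qhat0)
qed

section \<open>Scalar identities\<close>

lemma mat_fun_cong:
  assumes "hermitian_mat A" "\<And>x. x \<in> eigvals A \<Longrightarrow> f x = g x"
  shows "mat_fun f A = mat_fun g A"
proof -
  obtain U d where d: "diagonalizes U d A" using hermitian_diagonalizable[OF assms(1)] .
  then have "f (d i) = g (d i)" for i using assms(2)[of "d i"] by (auto simp: eigvals_def)
  then show ?thesis by (simp add: mat_fun_eq[OF d])
qed

lemma hermitian_ct_mult_self: "hermitian_mat (ct Q ** Q)"
  by (simp add: hermitian_mat_def ct_mult)

text \<open>An eigenvalue is the squared norm of a column of \<open>Q ** U\<close>, and a matrix
  with a left inverse has no zero column.\<close>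

lemma eigvals_ct_mult_self_pos:
  fixes Q :: "'n::finite cmat"
  assumes inv: "R ** Q = mat 1" and x: "x \<in> eigvals (ct Q ** Q)"
  shows "x > 0"
proof -
  obtain U d i where d: "diagonalizes U d (ct Q ** Q)" and xd: "x = d i"
    using x by (auto simp: eigvals_def)
  note U = diagonalizes_unitary[OF d]
  define P where "P = Q ** U"
  have "ct P ** P = real_diag d"
    using diagonalizes_conj[OF d] by (simp add: P_def ct_mult matrix_mul_assoc)
  then have "(ct P ** P) $ i $ i = complex_of_real (d i)" by (simp add: real_diag_nth)
  moreover have "(ct P ** P) $ i $ i = complex_of_real (\<Sum>k\<in>UNIV. (norm (P $ k $ i))\<^sup>2)"
    by (simp add: matrix_matrix_mult_def complex_norm_square mult.commute flip: of_real_power)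
  ultimately have di: "d i = (\<Sum>k\<in>UNIV. (norm (P $ k $ i))\<^sup>2)" by (metis of_real_eq_iff)
  have "(ct U ** R) ** P = ct U ** (R ** Q) ** U" by (simp add: P_def matrix_mul_assoc)
  then have "(ct U ** R) ** P = mat 1" by (simp add: inv unitary_ct_mult[OF U])
  then have "((ct U ** R) ** P) $ i $ i = 1" by (simp add: mat_def)
  then have "(\<Sum>k\<in>UNIV. (ct U ** R) $ i $ k * P $ k $ i) = 1"
    by (simp only: matrix_matrix_mult_def[of "ct U ** R"] vec_lambda_beta)
  then obtain k where k: "P $ k $ i \<noteq> 0"
    by (cases "\<exists>k. P $ k $ i \<noteq> 0") auto
  show ?thesis
    unfolding xd di by (rule sum_pos2[of UNIV k]) (use k in auto)
qed

lemma trace_mat_fun_real: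
  assumes "hermitian_mat A"
  shows "trace (mat_fun f A) = complex_of_real (Re (trace (mat_fun f A)))"
proof -
  obtain U d where d: "diagonalizes U d A" using hermitian_diagonalizable[OF assms] .
  show ?thesis by (simp add: trace_mat_fun[OF d])
qed

lemma trace_mat_fun_pos:
  fixes A :: "'n::finite cmat"
  assumes "hermitian_mat A" "\<And>x. x \<in> eigvals A \<Longrightarrow> f x > 0"
  shows "Re (trace (mat_fun f A)) > 0"
proof -
  obtain U d where d: "diagonalizes U d A" using hermitian_diagonalizable[OF assms(1)] .
  then have "f (d i) > 0" for i by (intro assms(2)) (auto simp: eigvals_def)
  then show ?thesis by (simp add: trace_mat_fun[OF d] sum_pos)
qed

lemma bounded_linear_Re_trace: "bounded_linear (\<lambda>X :: 'n::finite cmat. Re (trace X))"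
proof -
  have "linear (\<lambda>X :: 'n cmat. Re (trace X))"
    by (intro linearI) (simp_all add: trace_def sum.distrib sum_distrib_left)
  then show ?thesis by (simp add: linear_conv_bounded_linear)
qed

lemma has_real_derivative_Re_trace:
  fixes M :: "real \<Rightarrow> 'n::finite cmat"
  assumes "(M has_vector_derivative D) (at a)"
  shows "((\<lambda>t. Re (trace (M t))) has_real_derivative Re (trace D)) (at a)"
  using bounded_linear.has_vector_derivative[OF bounded_linear_Re_trace assms]
  by (simp add: has_real_derivative_iff_has_vector_derivative)

text \<open>A function of \<open>A\<close> is diagonal in its eigenbasis and so meets only the
  diagonal of the divided difference. This collapse is what makes the derivatives at the base point
  explicit.\<close>

lemma schur_divdiff_mat_fun:
  assumes A: "hermitian_mat A"
  shows "schur (divdiff f f') A A (mat_fun g A) = mat_fun (\<lambda>x. f' x * g x) A"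
proof -
  obtain U d where d: "diagonalizes U d A" using hermitian_diagonalizable[OF A] .
  note U = diagonalizes_unitary[OF d]
  have "ct U ** schur (divdiff f f') A A (mat_fun g A) ** U = ct U ** mat_fun (\<lambda>x. f' x * g x) A ** U"
    by (simp add: vec_eq_iff schur_nth[OF d] mat_fun_nth[OF d] divdiff_def)
  then have "U ** (ct U ** schur (divdiff f f') A A (mat_fun g A) ** U) ** ct U = U ** (ct U ** mat_fun (\<lambda>x. f' x * g x) A ** U) ** ct U"
    by simp
  then show ?thesis
    by (simp add: matrix_mul_assoc unitary_mult_ct[OF U] unitary_cancel_right[OF U])
qed

lemma exp_diff_sinh: "exp (- (c * x)) - exp (- (c * y)) = - 2 * exp (- (c * (x + y) / 2)) * sinh (c * (x - y) / 2)"
  for c x y :: real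
proof -
  have "- 2 * exp (- (c * (x + y) / 2)) * sinh (c * (x - y) / 2)
     = exp (- (c * (x + y) / 2)) * exp (- (c * (x - y) / 2)) - exp (- (c * (x + y) / 2)) * exp (c * (x - y) / 2)"
    by (simp add: sinh_def field_simps)
  also have "\<dots> = exp (- (c * x)) - exp (- (c * y))"
    unfolding exp_add[symmetric] by (simp add: field_simps)
  finally show ?thesis by simp
qed

lemma exp_add_cosh: "exp (- x) + exp (- y) = 2 * exp (- ((x + y) / 2)) * cosh ((x - y) / 2)"
  for x y :: real
proof -
  have "2 * exp (- ((x + y) / 2)) * cosh ((x - y) / 2)
     = exp (- ((x + y) / 2)) * exp (- ((x - y) / 2)) + exp (- ((x + y) / 2)) * exp ((x - y) / 2)"
    by (simp add: cosh_def field_simps)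
  also have "\<dots> = exp (- x) + exp (- y)"
    unfolding exp_add[symmetric] by (simp add: field_simps)
  finally show ?thesis by simp
qed

text \<open>Applied to the Hamiltonian, and up to normalization, \<open>az_f\<close> gives \<open>\<sigma>\<close> to the power
  \<open>(1 - \<alpha>) / z\<close> and \<open>az_root\<close> gives \<open>\<rho>\<close> to the power \<open>\<alpha> / (2 z)\<close>; \<open>az_g\<close> is the value of the
  operator \<open>B\<close> below at the base point. Primes denote derivatives.\<close>
definition az_f :: "real \<Rightarrow> real \<Rightarrow> real \<Rightarrow> real" where
  "az_f \<alpha> z x = exp (- ((1 - \<alpha>) / z * x))"
definition az_f' :: "real \<Rightarrow> real \<Rightarrow> real \<Rightarrow> real" where
  "az_f' \<alpha> z x = - ((1 - \<alpha>) / z) * exp (- ((1 - \<alpha>) / z * x))"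
definition az_g :: "real \<Rightarrow> real \<Rightarrow> real \<Rightarrow> real" where
  "az_g \<alpha> z x = z * exp (- ((\<alpha> + z - 1) / z * x))"
definition az_g' :: "real \<Rightarrow> real \<Rightarrow> real \<Rightarrow> real" where
  "az_g' \<alpha> z x = - (\<alpha> + z - 1) * exp (- ((\<alpha> + z - 1) / z * x))"
definition az_root :: "real \<Rightarrow> real \<Rightarrow> real \<Rightarrow> real" where
  "az_root \<alpha> z x = exp (- (\<alpha> / (2 * z) * x))"

lemma az_root_squared: "(az_root \<alpha> z x)\<^sup>2 = exp (- (\<alpha> / z * x))"
  by (simp add: az_root_def power2_eq_square flip: exp_add)

text \<open>The scalar core of the theorem: at the eigenvalues \<open>x, y\<close> of the Hamiltonian, the left side is
  the second-order coefficient of the trace functional, and all divided differences collapse to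
  the Fourier transform of \<open>q\<close>.\<close>
lemma az_divdiff_identity:
  fixes x y \<alpha> z :: real
  assumes \<alpha>: "0 < \<alpha>" "\<alpha> < 1" and z: "0 < z"
  defines "\<phi> \<equiv> divdiff (az_f \<alpha> z) (az_f' \<alpha> z) x y"
  shows "\<phi> * ((az_root \<alpha> z x)\<^sup>2 * (az_root \<alpha> z y)\<^sup>2
        * divdiff (\<lambda>u. z * u powr (z - 1)) (\<lambda>u. z * (z - 1) * u powr (z - 2)) (exp (- (1 / z * x))) (exp (- (1 / z * y))) * \<phi>
        - divdiff (az_g \<alpha> z) (az_g' \<alpha> z) x y)
    = \<alpha> * (\<alpha> - 1) * (1 / 2 * (p_az_hat (1/2) (1/2) (x - y) * p_az_hat \<alpha> z (x - y)) * (exp (- x) + exp (- y)))"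
proof (cases "x = y")
  case True
  define u where "u = exp (- (1 / z * x))"
  define A F where "A = exp (- (\<alpha> / z * x))" and "F = exp (- ((1 - \<alpha>) / z * x))"
  have AF: "A * F = u"
    unfolding A_def F_def u_def exp_add[symmetric] using z by (simp add: field_simps)
  have u: "u > 0" by (simp add: u_def)
  have uz: "u powr z = exp (- x)"
    using z by (simp add: u_def exp_powr_real)
  \<comment> \<open>In this confluent case the divided differences are derivatives. All powers of
    \<open>u\<close> become multiples of \<open>c\<close>: \<open>c * u\<close> is
    \<open>u powr (z - 1)\<close> and \<open>c * u^2\<close> is \<open>exp (- x)\<close>.\<close>
  define c where "c = u powr (z - 2)"
  have c: "c * u\<^sup>2 = exp (- x)"
    unfolding c_def uz[symmetric] using u by (simp add: powr_diff)
  have g': "az_g' \<alpha> z x = - (\<alpha> + z - 1) * (A * (c * u))"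
  proof -
    have "A * (c * u) * u = A * exp (- x)" by (simp add: c[symmetric] power2_eq_square)
    also have "\<dots> = exp (- ((\<alpha> + z - 1) / z * x)) * u"
      unfolding A_def u_def exp_add[symmetric] using z by (simp add: field_simps)
    finally have "A * (c * u) = exp (- ((\<alpha> + z - 1) / z * x))" using u by simp
    then show ?thesis by (simp add: az_g'_def)
  qed
  have gen: "- \<kappa> * F * (A * A * h * (- \<kappa> * F) - (- b * (A * (c * u)))) = - \<kappa> * (- \<kappa> * h * (A * F) * (A * F) + b * ((A * F) * (c * u)))" for \<kappa> h b
    by (simp add: algebra_simps)
  have "\<phi> = - ((1 - \<alpha>) / z) * F" by (simp add: \<phi>_def True divdiff_def az_f'_def F_def)
  then have "\<phi> * (A * A * (z * (z - 1) * c) * \<phi> - az_g' \<alpha> z x)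
     = - ((1 - \<alpha>) / z) * (- ((1 - \<alpha>) / z) * (z * (z - 1) * c) * (A * F) * (A * F) + (\<alpha> + z - 1) * ((A * F) * (c * u)))"
    unfolding g' gen[symmetric] by simp
  also have "\<dots> = - ((1 - \<alpha>) / z) * ((- ((1 - \<alpha>) / z) * (z * (z - 1)) + (\<alpha> + z - 1)) * (c * u\<^sup>2))"
  proof -
    have "- \<kappa> * (- \<kappa> * (w * c) * u * u + b * (u * (c * u))) = - \<kappa> * ((- \<kappa> * w + b) * (c * u\<^sup>2))" for \<kappa> w b
      by (simp add: algebra_simps power2_eq_square)
    then show ?thesis unfolding AF .
  qed
  also have "- ((1 - \<alpha>) / z) * (z * (z - 1)) + (\<alpha> + z - 1) = \<alpha> * z"
    using z by (simp add: field_simps)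
  also have "- ((1 - \<alpha>) / z) * (\<alpha> * z * (c * u\<^sup>2)) = \<alpha> * (\<alpha> - 1) * exp (- x)"
    unfolding c using z by (simp add: field_simps)
  finally show ?thesis
    unfolding az_root_squared A_def[symmetric] True[symmetric] u_def[symmetric]
    by (simp add: divdiff_def p_az_hat_def c_def flip: A_def)
next
  case False
  define D where "D = x - y"
  have D: "D \<noteq> 0" using False by (simp add: D_def)
  define Ax Ay where "Ax = exp (- (\<alpha> / z * x))" and "Ay = exp (- (\<alpha> / z * y))"
  define Fx Fy where "Fx = exp (- ((1 - \<alpha>) / z * x))" and "Fy = exp (- ((1 - \<alpha>) / z * y))"
  define nx ny where "nx = exp (- (1 / z * x))" and "ny = exp (- (1 / z * y))"
  define px py where "px = nx powr (z - 1)" and "py = ny powr (z - 1)"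
  have AF: "Ax * Fx = nx" "Ay * Fy = ny"
    unfolding Ax_def Ay_def Fx_def Fy_def nx_def ny_def exp_add[symmetric] using z by (simp_all add: field_simps)
  have np: "nx * px = exp (- x)" "ny * py = exp (- y)"
    unfolding px_def py_def nx_def ny_def exp_powr_real exp_add[symmetric] using z by (simp_all add: field_simps)
  have n_ne: "nx \<noteq> ny" using False z by (simp add: nx_def ny_def)
  have g: "az_g \<alpha> z x = z * (Ax * px)" "az_g \<alpha> z y = z * (Ay * py)"
    unfolding az_g_def Ax_def Ay_def px_def py_def nx_def ny_def exp_powr_real exp_add[symmetric] using z
    by (simp_all add: field_simps)
  have \<phi>: "\<phi> = (Fx - Fy) / D"
    using False by (simp add: \<phi>_def divdiff_def az_f_def Fx_def Fy_def D_def)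
  \<comment> \<open>The decisive cancellation: after \<open>Ax * Fx = nx\<close> and
    \<open>Ay * Fy = ny\<close> the terms \<open>nx * Ay * py\<close> and
    \<open>ny * Ax * px\<close> drop out, and what remains factors.\<close>
  have alg: "(Ax * Fx * Ay - Ay * Fy * Ax) * (px - py) - (nx - ny) * (Ax * px - Ay * py) = - ((Ax - Ay) * (nx * px - ny * py))"
    unfolding AF by (simp add: algebra_simps)
  have "Ax * Ay * (z * ((px - py) / (nx - ny))) * \<phi> - z * ((Ax * px - Ay * py) / D)
     = z / ((nx - ny) * D) * ((Ax * Fx * Ay - Ay * Fy * Ax) * (px - py) - (nx - ny) * (Ax * px - Ay * py))"
    using D n_ne unfolding \<phi> by (simp add: field_simps)
  also have "\<dots> = - (z / ((nx - ny) * D) * ((Ax - Ay) * (exp (- x) - exp (- y))))"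
    unfolding alg np by simp
  finally have bracket: "Ax * Ay * (z * ((px - py) / (nx - ny))) * \<phi> - z * ((Ax * px - Ay * py) / D)
     = - (z / ((nx - ny) * D) * ((Ax - Ay) * (exp (- x) - exp (- y))))" .
  define shF shA shn sh1 where "shF = sinh ((1 - \<alpha>) * D / (2 * z))" and "shA = sinh (\<alpha> * D / (2 * z))"
    and "shn = sinh (D / (2 * z))" and "sh1 = sinh (D / 2)"
  define ch where "ch = cosh (D / 2)"
  define EF EA En E where "EF = exp (- ((1 - \<alpha>) / z * (x + y) / 2))" and "EA = exp (- (\<alpha> / z * (x + y) / 2))"
    and "En = exp (- (1 / z * (x + y) / 2))" and "E = exp (- ((x + y) / 2))"
  have dF: "Fx - Fy = - 2 * EF * shF" and dA: "Ax - Ay = - 2 * EA * shA" and dn: "nx - ny = - 2 * En * shn"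
    and d1: "exp (- x) - exp (- y) = - 2 * E * sh1"
    using exp_diff_sinh[of "(1 - \<alpha>) / z" x y] exp_diff_sinh[of "\<alpha> / z" x y] exp_diff_sinh[of "1 / z" x y] exp_diff_sinh[of 1 x y]
    by (simp_all add: Fx_def Fy_def Ax_def Ay_def nx_def ny_def EF_def EA_def En_def E_def shF_def shA_def shn_def sh1_def D_def)
  have s1: "exp (- x) + exp (- y) = 2 * E * ch"
    using exp_add_cosh[of x y] by (simp add: E_def ch_def D_def)
  \<comment> \<open>The exponential prefactors taken at the midpoint cancel, so that only
    \<open>E\<close> survives; together with \<open>ch\<close> it forms the arithmetic mean of the
    two weights.\<close>
  have EE: "EF * EA = En"
    unfolding EF_def EA_def En_def exp_add[symmetric] using z by (simp add: field_simps)
  have nz: "shn \<noteq> 0" "sh1 \<noteq> 0" "ch \<noteq> 0" "En \<noteq> 0"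
    using D z by (simp_all add: shn_def sh1_def ch_def En_def cosh_real_pos less_imp_neq[symmetric])
  have sD: "sinh D = 2 * sh1 * ch"
    using sinh_double[of "D / 2"] by (simp add: sh1_def ch_def)
  have h1: "p_az_hat (1/2) (1/2) D = 4 / D * (sh1 * sh1 / (2 * sh1 * ch))"
    using D by (simp add: p_az_hat_def sh1_def sD[unfolded sh1_def])
  have h2: "p_az_hat \<alpha> z D = 2 * z / (\<alpha> * (1 - \<alpha>) * D) * shF * shA / shn"
    using D by (simp add: p_az_hat_def shF_def shA_def shn_def)
  have "\<phi> * (Ax * Ay * (z * ((px - py) / (nx - ny))) * \<phi> - z * ((Ax * px - Ay * py) / D))
     = - (z / D\<^sup>2 * ((- 2 * EF * shF) * (- 2 * EA * shA) * (- 2 * E * sh1) / (- 2 * En * shn)))"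
    unfolding bracket unfolding \<phi> dF dA dn d1 by (simp add: power2_eq_square mult_ac)
  also have "\<dots> = - (z / D\<^sup>2 * (4 * (EF * EA) * shF * shA * E * sh1 / (En * shn)))"
    by simp
  also have "\<dots> = - (4 * z / D\<^sup>2 * (shF * shA * E * sh1 / shn))"
    unfolding EE using nz by simp
  also have "\<dots> = \<alpha> * (\<alpha> - 1) * (1 / 2 * (p_az_hat (1/2) (1/2) D * p_az_hat \<alpha> z D) * (exp (- x) + exp (- y)))"
    unfolding h1 h2 s1 using nz D \<alpha> by (simp add: field_simps power2_eq_square)
  finally show ?thesis
    unfolding az_root_squared Ax_def[symmetric] Ay_def[symmetric] nx_def[symmetric] ny_def[symmetric] D_def[symmetric]
    using n_ne False by (simp add: divdiff_def g px_def[symmetric] py_def[symmetric] right_diff_distrib[symmetric] D_def[symmetric])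
qed

section \<open>Derivatives of the divergence\<close>

lemma hamiltonian_shift: "hamiltonian H (y + t *\<^sub>R axis j 1) = hamiltonian H y + t *\<^sub>R H j"
proof -
  have "hamiltonian H (y + t *\<^sub>R axis j 1) = (\<Sum>k\<in>UNIV. (y $ k) *\<^sub>R H k + (if k = j then t *\<^sub>R H k else 0))"
    unfolding hamiltonian_def by (intro sum.cong refl) (auto simp: axis_def scaleR_left_distrib)
  then show ?thesis by (simp add: sum.distrib hamiltonian_def)
qed

lemma exp_scaled_derivative:
  "((\<lambda>x. c * exp (- (k * x))) has_real_derivative - (c * k) * exp (- (k * x))) (at x)" for c k x :: real
  by (auto intro!: derivative_eq_intros)

lemma has_vector_derivative_matrix_mult_left:
  fixes M :: "real \<Rightarrow> 'n::finite cmat" and A :: "'n cmat"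
  assumes "(M has_vector_derivative M') F"
  shows "((\<lambda>t. A ** M t) has_vector_derivative A ** M') F"
  by (rule bounded_linear.has_vector_derivative[OF bounded_bilinear.bounded_linear_right[OF bounded_bilinear_matrix_mult] assms])

lemma has_vector_derivative_matrix_mult_right:
  fixes M :: "real \<Rightarrow> 'n::finite cmat" and A :: "'n cmat"
  assumes "(M has_vector_derivative M') F"
  shows "((\<lambda>t. M t ** A) has_vector_derivative M' ** A) F"
  by (rule bounded_linear.has_vector_derivative[OF bounded_bilinear.bounded_linear_left[OF bounded_bilinear_matrix_mult] assms])

lemma matrix_inverse_mult:
  fixes A B A' B' :: "'n::finite cmat"
  assumes "A' ** A = mat 1" "B' ** B = mat 1"
  shows "(B' ** A') ** (A ** B) = mat 1"
proof -
  have "(B' ** A') ** (A ** B) = B' ** (A' ** A) ** B" by (simp only: matrix_mul_assoc)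
  then show ?thesis using assms by simp
qed

locale gibbs_family =
  fixes H :: "'l::finite \<Rightarrow> 'n::finite cmat" and \<theta> :: "real ^ 'l" and \<alpha> z :: real
  assumes H: "\<And>j. hermitian_mat (H j)"
    and \<alpha>: "0 < \<alpha>" "\<alpha> < 1" and z: "0 < z"
begin

definition K :: "real ^ 'l \<Rightarrow> 'n cmat" where "K y = hamiltonian H y"
definition G :: "'n cmat" where "G = mat_fun (az_root \<alpha> z) (K \<theta>)"
definition N :: "real ^ 'l \<Rightarrow> 'n cmat" where "N y = G ** mat_fun (az_f \<alpha> z) (K y) ** G"
definition Z :: "real ^ 'l \<Rightarrow> real" where "Z y = Re (trace (mat_fun (\<lambda>x. exp (- x)) (K y)))"
definition T :: "real ^ 'l \<Rightarrow> real" where "T y = Re (trace (mat_fun (\<lambda>u. u powr z) (N y)))"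
text \<open>The gradient of \<open>T\<close> with respect to the factor
  \<open>mat_fun (az_f \<alpha> z) (K y)\<close>: a small change of this factor changes
  \<open>T\<close> by the real part of the trace of its product with \<open>B y\<close>.\<close>

definition B :: "real ^ 'l \<Rightarrow> 'n cmat" where "B y = G ** mat_fun (\<lambda>u. z * u powr (z - 1)) (N y) ** G"
definition gradT :: "'l \<Rightarrow> real ^ 'l \<Rightarrow> real" where
  "gradT j y = Re (trace (H j ** schur (divdiff (az_f \<alpha> z) (az_f' \<alpha> z)) (K y) (K y) (B y)))"
definition gradZ :: "'l \<Rightarrow> real ^ 'l \<Rightarrow> real" where
  "gradZ j y = Re (trace (mat_fun (\<lambda>x. - exp (- x)) (K y) ** H j))"

lemma hermitian_K: "hermitian_mat (K y)"
  using H by (simp add: K_def hamiltonian_def hermitian_mat_def ct_sum ct_scaleR)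

lemma K_shift: "K (y + t *\<^sub>R axis j 1) = K y + t *\<^sub>R H j"
  by (simp add: K_def hamiltonian_shift)

lemma K_derivative: "((\<lambda>t. K (y + t *\<^sub>R axis j 1)) has_vector_derivative H j) (at 0)"
  unfolding K_shift by (auto intro!: derivative_eq_intros)

lemma mat_fun_K_derivative:
  assumes "\<And>x. (f has_real_derivative f' x) (at x)" "\<And>x. isCont f' x"
  shows "((\<lambda>t. mat_fun f (K (y + t *\<^sub>R axis j 1))) has_vector_derivative schur (divdiff f f') (K y) (K y) (H j)) (at 0)"
  using mat_fun_has_vector_derivative[OF hermitian_K K_derivative, of UNIV y j f f'] assms by simp

lemma az_f_derivative: "(az_f \<alpha> z has_real_derivative az_f' \<alpha> z x) (at x)" and isCont_az_f': "isCont (az_f' \<alpha> z) x"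
  unfolding az_f_def[abs_def] az_f'_def[abs_def]
  using exp_scaled_derivative[of 1 "(1 - \<alpha>) / z" x]
    DERIV_isCont[OF exp_scaled_derivative[of "- ((1 - \<alpha>) / z)" "(1 - \<alpha>) / z" x]] by simp_all

lemma az_g_derivative: "(az_g \<alpha> z has_real_derivative az_g' \<alpha> z x) (at x)" and isCont_az_g': "isCont (az_g' \<alpha> z) x"
  unfolding az_g_def[abs_def] az_g'_def[abs_def]
  using exp_scaled_derivative[of z "(\<alpha> + z - 1) / z" x] z
    DERIV_isCont[OF exp_scaled_derivative[of "- (\<alpha> + z - 1)" "(\<alpha> + z - 1) / z" x]] by simp_all

lemma hermitian_G: "hermitian_mat G"
  by (simp add: G_def hermitian_mat_fun hermitian_K)

text \<open>Half the exponent of \<open>az_f\<close>: up to normalization this is the outer factor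
  of the divergence. It exhibits \<open>N y\<close> as \<open>ct Q ** Q\<close> with
  \<open>Q = S y ** G\<close>.\<close>

definition S :: "real ^ 'l \<Rightarrow> 'n cmat" where "S y = mat_fun (\<lambda>x. exp (- ((1 - \<alpha>) / (2 * z) * x))) (K y)"

lemma hermitian_S: "hermitian_mat (S y)"
  by (simp add: S_def hermitian_mat_fun hermitian_K)

lemma S_squared: "S y ** S y = mat_fun (az_f \<alpha> z) (K y)"
  unfolding S_def mat_fun_mult[OF hermitian_K] az_f_def[abs_def] exp_add[symmetric]
  by (rule arg_cong[where f = "\<lambda>f. mat_fun f (K y)"]) (use z in \<open>auto simp: field_simps\<close>)

lemma G_squared: "G ** G = mat_fun (\<lambda>x. exp (- (\<alpha> / z * x))) (K \<theta>)"
  unfolding G_def mat_fun_mult[OF hermitian_K] az_root_def exp_add[symmetric]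
  by (rule arg_cong[where f = "\<lambda>f. mat_fun f (K \<theta>)"]) (use z in \<open>auto simp: field_simps\<close>)

definition SI :: "real ^ 'l \<Rightarrow> 'n cmat" where "SI y = mat_fun (\<lambda>x. exp ((1 - \<alpha>) / (2 * z) * x)) (K y)"
definition GI :: "'n cmat" where "GI = mat_fun (\<lambda>x. exp (\<alpha> / (2 * z) * x)) (K \<theta>)"

lemma SI: "SI y ** S y = mat 1" "S y ** SI y = mat 1"
  unfolding SI_def S_def mat_fun_mult[OF hermitian_K] exp_add[symmetric] using mat_fun_1[OF hermitian_K] by simp_all

lemma GI: "GI ** G = mat 1" "G ** GI = mat 1"
  unfolding GI_def G_def az_root_def mat_fun_mult[OF hermitian_K] exp_add[symmetric] using mat_fun_1[OF hermitian_K] by simp_all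

lemma N_eq: "N y = ct (S y ** G) ** (S y ** G)"
  using hermitian_S hermitian_G by (simp add: ct_mult hermitian_mat_def N_def S_squared[symmetric] matrix_mul_assoc)

lemma hermitian_N: "hermitian_mat (N y)"
  unfolding N_eq by (rule hermitian_ct_mult_self)

text \<open>Positivity keeps the spectrum in the open half-line on which real powers are
  smooth.\<close>

lemma eigvals_N_pos: "x \<in> eigvals (N y) \<Longrightarrow> x > 0"
  unfolding N_eq by (rule eigvals_ct_mult_self_pos[OF matrix_inverse_mult[OF SI(1) GI(1)]])

lemma N_derivative:
  "((\<lambda>t. N (y + t *\<^sub>R axis j 1)) has_vector_derivative
     G ** schur (divdiff (az_f \<alpha> z) (az_f' \<alpha> z)) (K y) (K y) (H j) ** G) (at 0)"
  unfolding N_def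
  by (intro bounded_linear.has_vector_derivative[OF bounded_linear_sandwich]
      mat_fun_K_derivative az_f_derivative isCont_az_f')

lemma mat_fun_N_derivative:
  assumes "\<And>u. u > 0 \<Longrightarrow> (f has_real_derivative f' u) (at u)" "\<And>u. u > 0 \<Longrightarrow> isCont f' u"
  shows "((\<lambda>t. mat_fun f (N (y + t *\<^sub>R axis j 1))) has_vector_derivative
    schur (divdiff f f') (N y) (N y) (G ** schur (divdiff (az_f \<alpha> z) (az_f' \<alpha> z)) (K y) (K y) (H j) ** G)) (at 0)"
  using mat_fun_has_vector_derivative[OF hermitian_N N_derivative, of "{0<..}" y j f f'] assms eigvals_N_pos by auto

text \<open>The trace collapses the outer divided difference, cyclicity gathers the two factors
  \<open>G\<close> around the function of \<open>N y\<close> into \<open>B y\<close>, and symmetry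
  moves the inner divided difference onto \<open>B y\<close>.\<close>

lemma T_derivative: "((\<lambda>t. T (y + t *\<^sub>R axis j 1)) has_real_derivative gradT j y) (at 0)"
proof -
  let ?X = "schur (divdiff (az_f \<alpha> z) (az_f' \<alpha> z)) (K y) (K y) (H j)"
  let ?h = "\<lambda>u. z * u powr (z - 1)"
  have "((\<lambda>t. T (y + t *\<^sub>R axis j 1)) has_real_derivative
      Re (trace (schur (divdiff (\<lambda>u. u powr z) ?h) (N y) (N y) (G ** ?X ** G)))) (at 0)"
    unfolding T_def
    by (intro has_real_derivative_Re_trace mat_fun_N_derivative)
      (auto intro!: derivative_eq_intros continuous_intros)
  also have "trace (schur (divdiff (\<lambda>u. u powr z) ?h) (N y) (N y) (G ** ?X ** G)) = trace (mat_fun ?h (N y) ** (G ** ?X ** G))"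
    by (rule trace_schur_divdiff[OF hermitian_N])
  also have "\<dots> = trace ((mat_fun ?h (N y) ** G ** ?X) ** G)" by (simp add: matrix_mul_assoc)
  also have "\<dots> = trace (G ** (mat_fun ?h (N y) ** G ** ?X))" by (rule trace_mul_sym)
  also have "\<dots> = trace (B y ** ?X)" by (simp add: B_def matrix_mul_assoc)
  also have "\<dots> = trace (H j ** schur (divdiff (az_f \<alpha> z) (az_f' \<alpha> z)) (K y) (K y) (B y))"
    by (rule trace_schur_symmetric[OF hermitian_K divdiff_commute])
  finally show ?thesis by (simp only: gradT_def)
qed

lemma Z_derivative: "((\<lambda>t. Z (y + t *\<^sub>R axis j 1)) has_real_derivative gradZ j y) (at 0)"
proof -
  have "((\<lambda>t. Z (y + t *\<^sub>R axis j 1)) has_real_derivative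
      Re (trace (schur (divdiff (\<lambda>x. exp (- x)) (\<lambda>x. - exp (- x))) (K y) (K y) (H j)))) (at 0)"
    unfolding Z_def
    by (intro has_real_derivative_Re_trace mat_fun_K_derivative) (auto intro!: derivative_eq_intros continuous_intros)
  then show ?thesis unfolding trace_schur_divdiff[OF hermitian_K] gradZ_def .
qed

lemma Z_pos: "Z y > 0"
  unfolding Z_def by (rule trace_mat_fun_pos[OF hermitian_K]) simp

lemma T_pos: "T y > 0"
  unfolding T_def by (rule trace_mat_fun_pos[OF hermitian_N]) (use eigvals_N_pos in force)

lemma gibbs_eq: "gibbs H y = mat_fun (\<lambda>x. exp (- x) / Z y) (K y)"
proof -
  have "mat_exp (- hamiltonian H y) = mat_fun (\<lambda>x. exp (- x)) (K y)"
    using mat_exp_uminus[OF hermitian_K[of y]] by (simp add: K_def)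
  moreover have "trace (mat_fun (\<lambda>x. exp (- x)) (K y)) = complex_of_real (Z y)"
    unfolding Z_def by (rule trace_mat_fun_real[OF hermitian_K])
  ultimately have "gibbs H y = smult_mat (complex_of_real (1 / Z y)) (mat_fun (\<lambda>x. exp (- x)) (K y))"
    by (simp add: gibbs_def)
  also have "\<dots> = (1 / Z y) *\<^sub>R mat_fun (\<lambda>x. exp (- x)) (K y)" by (rule smult_mat_of_real)
  also have "\<dots> = mat_fun (\<lambda>x. 1 / Z y * exp (- x)) (K y)" by (rule mat_fun_scaleR[OF hermitian_K])
  finally show ?thesis by simp
qed

lemma mat_powr_gibbs: "mat_powr (gibbs H y) r = Z y powr (- r) *\<^sub>R mat_fun (\<lambda>x. exp (- (r * x))) (K y)"
proof -
  have "(exp (- x) / Z y) powr r = Z y powr (- r) * exp (- (r * x))" for x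
    using Z_pos[of y] by (simp add: powr_divide exp_powr_real powr_minus_divide mult.commute)
  then show ?thesis
    unfolding mat_powr_def gibbs_eq mat_fun_compose[OF hermitian_K] mat_fun_scaleR[OF hermitian_K] by simp
qed

definition D :: "real ^ 'l \<Rightarrow> real" where "D y = renyi_az \<alpha> z (gibbs H \<theta>) (gibbs H y)"

text \<open>The partition functions scale out of the powers, and the remaining matrix
  \<open>S y ** (G ** G) ** S y\<close> is similar to \<open>N y\<close>. What involves
  \<open>Z \<theta>\<close> is constant in \<open>y\<close>.\<close>

lemma D_eq: "D y = ln (T y) / (\<alpha> - 1) + ln (Z y) - \<alpha> / (\<alpha> - 1) * ln (Z \<theta>)"
proof -
  define c where "c = Z y powr (- ((1 - \<alpha>) / z)) * Z \<theta> powr (- (\<alpha> / z))"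
  have c: "c > 0" using Z_pos[of y] Z_pos[of \<theta>] by (simp add: c_def)
  define M where "M = S y ** (G ** G) ** S y"
  have M_eq: "M = ct (G ** S y) ** (G ** S y)"
    using hermitian_S hermitian_G by (simp add: M_def ct_mult hermitian_mat_def matrix_mul_assoc)
  have hM: "hermitian_mat M" unfolding M_eq by (rule hermitian_ct_mult_self)
  have M_pos: "x > 0" if "x \<in> eigvals M" for x
    using that unfolding M_eq by (rule eigvals_ct_mult_self_pos[OF matrix_inverse_mult[OF GI(1) SI(1)]])
  have "mat_powr (gibbs H y) ((1 - \<alpha>) / (2 * z)) = Z y powr (- ((1 - \<alpha>) / (2 * z))) *\<^sub>R S y"
    by (simp add: mat_powr_gibbs S_def)
  moreover have "mat_powr (gibbs H \<theta>) (\<alpha> / z) = Z \<theta> powr (- (\<alpha> / z)) *\<^sub>R (G ** G)"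
    by (simp add: mat_powr_gibbs G_squared)
  moreover have "Z y powr (- ((1 - \<alpha>) / (2 * z))) * Z y powr (- ((1 - \<alpha>) / (2 * z))) = Z y powr (- ((1 - \<alpha>) / z))"
  proof -
    have "- ((1 - \<alpha>) / (2 * z)) + - ((1 - \<alpha>) / (2 * z)) = - ((1 - \<alpha>) / z)" using z by (simp add: field_simps)
    then show ?thesis by (simp only: powr_add[symmetric])
  qed
  ultimately have "mat_powr (gibbs H y) ((1 - \<alpha>) / (2 * z)) ** mat_powr (gibbs H \<theta>) (\<alpha> / z) ** mat_powr (gibbs H y) ((1 - \<alpha>) / (2 * z)) = c *\<^sub>R M"
    by (simp add: matrix_mult_scaleR_left matrix_mult_scaleR_right M_def c_def mult_ac)
  moreover have "mat_powr (c *\<^sub>R M) z = (c powr z) *\<^sub>R mat_fun (\<lambda>u. u powr z) M"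
  proof -
    have "mat_powr (c *\<^sub>R M) z = mat_fun (\<lambda>u. (c * u) powr z) M"
      unfolding mat_powr_def by (rule mat_fun_scaled_arg[OF hM])
    also have "\<dots> = mat_fun (\<lambda>u. c powr z * u powr z) M"
      using c M_pos by (intro mat_fun_cong[OF hM]) (simp add: powr_mult less_imp_le)
    finally show ?thesis by (simp add: mat_fun_scaleR[OF hM])
  qed
  moreover have "trace (mat_fun (\<lambda>u. u powr z) M) = trace (mat_fun (\<lambda>u. u powr z) (N y))"
  proof -
    \<comment> \<open>\<open>?X\<close> intertwines \<open>M\<close> with \<open>N y\<close>, hence
      also their functions, and it is invertible with inverse \<open>?Y\<close>; cyclicity of the
      trace then finishes the comparison.\<close>
    let ?X = "S y ** G" and ?Y = "GI ** SI y" and ?f = "\<lambda>u. u powr z"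
    have "M ** ?X = ?X ** N y"
      by (simp add: M_def N_def S_squared[symmetric] matrix_mul_assoc)
    then have *: "mat_fun ?f M ** ?X = ?X ** mat_fun ?f (N y)"
      by (rule mat_fun_intertwine[OF hM hermitian_N])
    have XY: "?X ** ?Y = mat 1" by (rule matrix_inverse_mult[OF GI(2) SI(2)])
    have YX: "?Y ** ?X = mat 1" by (rule matrix_inverse_mult[OF SI(1) GI(1)])
    have "mat_fun ?f M = mat_fun ?f M ** (?X ** ?Y)" by (simp only: XY matrix_mul_rid)
    also have "\<dots> = (mat_fun ?f M ** ?X) ** ?Y" by (simp only: matrix_mul_assoc)
    finally have "trace (mat_fun ?f M) = trace ((?X ** mat_fun ?f (N y)) ** ?Y)" by (simp only: *)
    also have "\<dots> = trace (?Y ** (?X ** mat_fun ?f (N y)))" by (rule trace_mul_sym)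
    also have "?Y ** (?X ** mat_fun ?f (N y)) = (?Y ** ?X) ** mat_fun ?f (N y)" by (simp only: matrix_mul_assoc)
    also have "\<dots> = mat_fun ?f (N y)" by (simp only: YX matrix_mul_lid)
    finally show ?thesis .
  qed
  ultimately have "D y = 1 / (\<alpha> - 1) * ln (c powr z * T y)"
    unfolding D_def renyi_az_def
    by (simp add: T_def linear_cmul[OF bounded_linear.linear[OF bounded_linear_Re_trace], simplified])
  also have "ln (c powr z * T y) = z * ln c + ln (T y)"
    using c T_pos[of y] by (simp add: ln_mult ln_powr)
  also have "z * ln c = - (1 - \<alpha>) * ln (Z y) - \<alpha> * ln (Z \<theta>)"
    using Z_pos[of y] Z_pos[of \<theta>] z by (simp add: c_def ln_mult ln_powr field_simps)
  finally have "D y = 1 / (\<alpha> - 1) * (- (1 - \<alpha>) * ln (Z y) - \<alpha> * ln (Z \<theta>) + ln (T y))" .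
  also have "1 / (\<alpha> - 1) * (- (1 - \<alpha>) * a - \<alpha> * b + t) = t / (\<alpha> - 1) + a - \<alpha> / (\<alpha> - 1) * b" for a b t
  proof -
    have "1 / (\<alpha> - 1) * (- (1 - \<alpha>) * a) = a" using \<alpha> by simp
    then show ?thesis by (simp add: diff_divide_distrib add_divide_distrib)
  qed
  finally show ?thesis .
qed

section \<open>First and second derivatives of the divergence\<close>

definition gradD :: "'l \<Rightarrow> real ^ 'l \<Rightarrow> real" where
  "gradD j y = gradT j y / T y / (\<alpha> - 1) + gradZ j y / Z y"

lemma D_derivative: "((\<lambda>t. D (y + t *\<^sub>R axis j 1)) has_real_derivative gradD j y) (at 0)"
proof -
  have "((\<lambda>t. ln (T (y + t *\<^sub>R axis j 1))) has_real_derivative gradT j y / T y) (at 0)"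
    using DERIV_chain'[OF T_derivative DERIV_ln_divide, of y j] T_pos[of y] by simp
  moreover have "((\<lambda>t. ln (Z (y + t *\<^sub>R axis j 1))) has_real_derivative gradZ j y / Z y) (at 0)"
    using DERIV_chain'[OF Z_derivative DERIV_ln_divide, of y j] Z_pos[of y] by simp
  ultimately have "((\<lambda>t. ln (T (y + t *\<^sub>R axis j 1)) / (\<alpha> - 1) + ln (Z (y + t *\<^sub>R axis j 1)) - \<alpha> / (\<alpha> - 1) * ln (Z \<theta>))
     has_real_derivative gradT j y / T y / (\<alpha> - 1) + gradZ j y / Z y - 0) (at 0)"
    by (intro DERIV_add DERIV_diff DERIV_cdivide DERIV_const)
  then show ?thesis by (simp add: D_eq gradD_def)
qed

definition gradB :: "'l \<Rightarrow> 'n cmat" where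
  "gradB i = G ** schur (divdiff (\<lambda>u. z * u powr (z - 1)) (\<lambda>u. z * (z - 1) * u powr (z - 2))) (N \<theta>) (N \<theta>)
     (G ** schur (divdiff (az_f \<alpha> z) (az_f' \<alpha> z)) (K \<theta>) (K \<theta>) (H i) ** G) ** G"

lemma B_derivative: "((\<lambda>t. B (\<theta> + t *\<^sub>R axis i 1)) has_vector_derivative gradB i) (at 0)"
  unfolding B_def gradB_def
proof (intro bounded_linear.has_vector_derivative[OF bounded_linear_sandwich] mat_fun_N_derivative)
  fix u :: real assume u: "u > 0"
  have "((\<lambda>u. u powr (z - 1)) has_real_derivative (z - 1) * u powr (z - 1 - 1)) (at u)"
    using has_real_derivative_powr[OF u] .
  from DERIV_cmult[OF this, of z]
  show "((\<lambda>u. z * u powr (z - 1)) has_real_derivative z * (z - 1) * u powr (z - 2)) (at u)"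
    by (simp add: mult.assoc)
  show "isCont (\<lambda>u. z * (z - 1) * u powr (z - 2)) u"
    using u by (intro continuous_intros) auto
qed

lemma N_\<theta>: "N \<theta> = mat_fun (\<lambda>x. exp (- (1 / z * x))) (K \<theta>)"
  unfolding N_def G_def az_root_def[abs_def] az_f_def[abs_def] mat_fun_mult[OF hermitian_K] exp_add[symmetric]
  by (rule arg_cong[where f = "\<lambda>f. mat_fun f (K \<theta>)"]) (use z in \<open>auto simp: field_simps\<close>)

lemma B_\<theta>: "B \<theta> = mat_fun (az_g \<alpha> z) (K \<theta>)"
proof -
  have "az_root \<alpha> z x * (z * exp (- (1 / z * x)) powr (z - 1)) * az_root \<alpha> z x = az_g \<alpha> z x" for x
  proof -
    have "az_root \<alpha> z x * (z * exp (- (1 / z * x)) powr (z - 1)) * az_root \<alpha> z x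
      = z * (exp (- (\<alpha> / (2 * z) * x)) * exp (- (1 / z * x) * (z - 1)) * exp (- (\<alpha> / (2 * z) * x)))"
      by (simp add: az_root_def exp_powr_real)
    also have "\<dots> = az_g \<alpha> z x"
      unfolding exp_add[symmetric] az_g_def using z by (simp add: field_simps)
    finally show ?thesis .
  qed
  then show ?thesis
    unfolding B_def N_\<theta> mat_fun_compose[OF hermitian_K] G_def mat_fun_mult[OF hermitian_K] by simp
qed

lemma az_f'_mult_az_g: "az_f' \<alpha> z x * az_g \<alpha> z x = (1 - \<alpha>) * (- exp (- x))"
proof -
  have "exp (- ((1 - \<alpha>) / z * x)) * exp (- ((\<alpha> + z - 1) / z * x)) = exp (- x)"
    unfolding exp_add[symmetric] using z by (simp add: field_simps)
  then have "az_f' \<alpha> z x * az_g \<alpha> z x = - ((1 - \<alpha>) / z) * z * exp (- x)"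
    unfolding az_f'_def az_g_def by (metis (no_types, opaque_lifting) mult.assoc mult.commute)
  moreover have "- ((1 - \<alpha>) / z) * z = - (1 - \<alpha>)" using z by simp
  ultimately show ?thesis by simp
qed

lemma T_\<theta>: "T \<theta> = Z \<theta>"
  unfolding T_def Z_def N_\<theta> mat_fun_compose[OF hermitian_K] using z by (simp add: exp_powr_real)

lemma mat_fun_az_fg: "mat_fun (\<lambda>x. az_f' \<alpha> z x * az_g \<alpha> z x) (K y) = (1 - \<alpha>) *\<^sub>R mat_fun (\<lambda>x. - exp (- x)) (K y)"
  unfolding az_f'_mult_az_g mat_fun_scaleR[OF hermitian_K] ..

text \<open>\<open>B \<theta>\<close> is a function of \<open>K \<theta>\<close>, so the divided
  difference reduces to the product of \<open>az_f'\<close> and \<open>az_g\<close>, a multiple of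
  \<open>exp (- x)\<close>. With \<open>T_\<theta>\<close> the two terms of
  \<open>gradD j \<theta>\<close> cancel.\<close>

lemma gradT_\<theta>: "gradT j \<theta> = (1 - \<alpha>) * gradZ j \<theta>"
  unfolding gradT_def B_\<theta> schur_divdiff_mat_fun[OF hermitian_K] mat_fun_az_fg gradZ_def
  by (simp add: matrix_mult_scaleR_right linear_cmul[OF bounded_linear.linear[OF bounded_linear_Re_trace], simplified] trace_mul_sym[of "H j"])

definition hessZ :: "'l \<Rightarrow> 'l \<Rightarrow> real" where
  "hessZ i j = Re (trace (schur (divdiff (\<lambda>x. - exp (- x)) (\<lambda>x. exp (- x))) (K \<theta>) (K \<theta>) (H i) ** H j))"

text \<open>The part of the second derivative of \<open>T\<close> that is due to \<open>B y\<close>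
  departing to first order from \<open>mat_fun (az_g \<alpha> z) (K y)\<close>, the function of
  \<open>K y\<close> with which it agrees at the base point.\<close>

definition defect :: "'l \<Rightarrow> 'l \<Rightarrow> real" where
  "defect i j = Re (trace (H j ** schur (divdiff (az_f \<alpha> z) (az_f' \<alpha> z)) (K \<theta>) (K \<theta>)
     (gradB i - schur (divdiff (az_g \<alpha> z) (az_g' \<alpha> z)) (K \<theta>) (K \<theta>) (H i))))"

lemma exp_K_derivative:
  "((\<lambda>t. mat_fun (\<lambda>x. - exp (- x)) (K (\<theta> + t *\<^sub>R axis i 1))) has_vector_derivative
     schur (divdiff (\<lambda>x. - exp (- x)) (\<lambda>x. exp (- x))) (K \<theta>) (K \<theta>) (H i)) (at 0)"
  by (rule mat_fun_K_derivative) (auto intro!: derivative_eq_intros continuous_intros)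

lemma gradZ_derivative: "((\<lambda>t. gradZ j (\<theta> + t *\<^sub>R axis i 1)) has_real_derivative hessZ i j) (at 0)"
  unfolding gradZ_def hessZ_def
  by (intro has_real_derivative_Re_trace has_vector_derivative_matrix_mult_right exp_K_derivative)

text \<open>Replacing \<open>B y\<close> by a function of \<open>K y\<close> up to first order makes the remaining divided
  difference collapse to a function of \<open>K y\<close> and so avoids second-order divided differences.\<close>
lemma gradT_derivative:
  "((\<lambda>t. gradT j (\<theta> + t *\<^sub>R axis i 1)) has_real_derivative defect i j + (1 - \<alpha>) * hessZ i j) (at 0)"
proof -
  let ?\<phi> = "divdiff (az_f \<alpha> z) (az_f' \<alpha> z)" and ?\<gamma> = "divdiff (az_g \<alpha> z) (az_g' \<alpha> z)"
  let ?k = "\<lambda>t. K (\<theta> + t *\<^sub>R axis i 1)"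
  let ?X = "\<lambda>t. B (\<theta> + t *\<^sub>R axis i 1) - mat_fun (az_g \<alpha> z) (?k t)"
  let ?e = "\<lambda>t. mat_fun (\<lambda>x. - exp (- x)) (?k t)"
  have split: "schur ?\<phi> (?k t) (?k t) (B (\<theta> + t *\<^sub>R axis i 1)) = schur ?\<phi> (?k t) (?k t) (?X t) + (1 - \<alpha>) *\<^sub>R ?e t" for t
  proof -
    have "schur ?\<phi> (?k t) (?k t) (?X t + mat_fun (az_g \<alpha> z) (?k t)) = schur ?\<phi> (?k t) (?k t) (?X t) + (1 - \<alpha>) *\<^sub>R ?e t"
      by (simp only: schur_add[OF hermitian_K hermitian_K] schur_divdiff_mat_fun[OF hermitian_K] mat_fun_az_fg)
    then show ?thesis by simp
  qed
  have "((\<lambda>t. schur ?\<phi> (?k t) (?k t) (?X t)) has_vector_derivative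
      schur ?\<phi> (?k 0) (?k 0) (gradB i - schur ?\<gamma> (K \<theta>) (K \<theta>) (H i))) (at 0)"
  proof (rule schur_has_vector_derivative_zero)
    show "(?k \<longlongrightarrow> ?k 0) (at 0)"
      using has_vector_derivative_continuous[OF K_derivative] by (simp add: continuous_at)
    show "?X 0 = 0" by (simp add: B_\<theta>)
    show "(?X has_vector_derivative (gradB i - schur ?\<gamma> (K \<theta>) (K \<theta>) (H i))) (at 0)"
      by (intro has_vector_derivative_diff B_derivative mat_fun_K_derivative az_g_derivative isCont_az_g')
    show "isCont (\<lambda>p. ?\<phi> (fst p) (snd p)) (x, y)" for x y
      by (rule isCont_divdiff[OF open_UNIV az_f_derivative isCont_az_f']) auto
  qed (rule hermitian_K)
  then have 1: "((\<lambda>t. schur ?\<phi> (?k t) (?k t) (?X t)) has_vector_derivative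
      schur ?\<phi> (K \<theta>) (K \<theta>) (gradB i - schur ?\<gamma> (K \<theta>) (K \<theta>) (H i))) (at 0)" by simp
  have 2: "((\<lambda>t. Re (trace (H j ** schur ?\<phi> (?k t) (?k t) (?X t))) + (1 - \<alpha>) * Re (trace (?e t ** H j)))
      has_real_derivative defect i j + (1 - \<alpha>) * hessZ i j) (at 0)"
    unfolding defect_def hessZ_def
    by (intro DERIV_add DERIV_cmult has_real_derivative_Re_trace has_vector_derivative_matrix_mult_left
        has_vector_derivative_matrix_mult_right 1 exp_K_derivative)
  moreover have "gradT j (\<theta> + t *\<^sub>R axis i 1) = Re (trace (H j ** schur ?\<phi> (?k t) (?k t) (?X t))) + (1 - \<alpha>) * Re (trace (?e t ** H j))" for t
    unfolding gradT_def split trace_mul_sym[of "?e t"]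
    by (simp add: matrix_add_ldistrib trace_add matrix_mult_scaleR_right
        linear_cmul[OF bounded_linear.linear[OF bounded_linear_Re_trace], simplified])
  ultimately show ?thesis by simp
qed

definition hessD :: "'l \<Rightarrow> 'l \<Rightarrow> real" where
  "hessD i j = 1 / (\<alpha> - 1) * (defect i j / Z \<theta>) - \<alpha> * (gradZ i \<theta> / Z \<theta>) * (gradZ j \<theta> / Z \<theta>)"

lemma gradD_derivative: "((\<lambda>t. gradD j (\<theta> + t *\<^sub>R axis i 1)) has_real_derivative hessD i j) (at 0)"
proof -
  have nz: "T (\<theta> + 0 *\<^sub>R axis i 1) \<noteq> 0" "Z (\<theta> + 0 *\<^sub>R axis i 1) \<noteq> 0" using T_pos Z_pos by (metis less_irrefl)+
  have "((\<lambda>t. gradD j (\<theta> + t *\<^sub>R axis i 1)) has_real_derivative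
     ((defect i j + (1 - \<alpha>) * hessZ i j) * T \<theta> - gradT j \<theta> * gradT i \<theta>) / (T \<theta> * T \<theta>) / (\<alpha> - 1)
       + (hessZ i j * Z \<theta> - gradZ j \<theta> * gradZ i \<theta>) / (Z \<theta> * Z \<theta>)) (at 0)"
    unfolding gradD_def
    using DERIV_add[OF DERIV_cdivide[OF DERIV_divide[OF gradT_derivative[of j i] T_derivative[of \<theta> i] nz(1)]]
        DERIV_divide[OF gradZ_derivative[of j i] Z_derivative[of \<theta> i] nz(2)], of "\<alpha> - 1"] by simp
  \<comment> \<open>Division by \<open>\<alpha> - 1\<close> turns the term
    \<open>(1 - \<alpha>) * hessZ i j\<close> into the negative of the one from \<open>ln Z\<close>.
    The products of gradients carry the coefficients \<open>1 - \<alpha>\<close> and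
    \<open>- 1\<close>, which leaves \<open>- \<alpha>\<close>.\<close>
  also have "((defect i j + (1 - \<alpha>) * hessZ i j) * T \<theta> - gradT j \<theta> * gradT i \<theta>) / (T \<theta> * T \<theta>) / (\<alpha> - 1)
       + (hessZ i j * Z \<theta> - gradZ j \<theta> * gradZ i \<theta>) / (Z \<theta> * Z \<theta>) = hessD i j"
  proof -
    have "((d + (1 - \<alpha>) * h) * w - ((1 - \<alpha>) * gj) * ((1 - \<alpha>) * gi)) / (w * w) / (\<alpha> - 1) + (h * w - gj * gi) / (w * w)
       = 1 / (\<alpha> - 1) * (d / w) - \<alpha> * (gi / w) * (gj / w)" if "w \<noteq> 0" for d h w gi gj :: real
    proof -
      define b where "b = \<alpha> - 1"
      have b: "b \<noteq> 0" "1 - \<alpha> = - b" "\<alpha> = 1 + b" using \<alpha> by (simp_all add: b_def)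
      show ?thesis unfolding b(2) b_def[symmetric] unfolding b(3) using b(1) that by (simp add: field_simps)
    qed
    then show ?thesis using Z_pos[of \<theta>] unfolding T_\<theta> gradT_\<theta> hessD_def by simp
  qed
  finally show ?thesis .
qed

end

section \<open>Evaluation at the base point\<close>

lemma trace_scaleR: "trace (c *\<^sub>R A) = c *\<^sub>R trace A" for A :: "'n::finite cmat"
  by (simp add: trace_def scaleR_sum_right)

lemma trace_ct: "trace (ct A) = cnj (trace A)"
  by (simp add: trace_def)

lemma trace_mult_hermitian_real:
  assumes "hermitian_mat A" "hermitian_mat B"
  shows "trace (A ** B) = complex_of_real (Re (trace (A ** B)))"
proof -
  have "cnj (trace (A ** B)) = trace (B ** A)"
    using assms by (simp add: ct_mult hermitian_mat_def flip: trace_ct)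
  also have "\<dots> = trace (A ** B)" by (rule trace_mul_sym)
  finally show ?thesis by (simp add: complex_eq_iff)
qed

lemma p_az_hat_uminus: "p_az_hat \<alpha> z (- w) = p_az_hat \<alpha> z w"
  by (simp add: p_az_hat_def)

context gibbs_family
begin

lemma expect_H: "expect (gibbs H \<theta>) (H j) = complex_of_real (- (gradZ j \<theta> / Z \<theta>))"
proof -
  let ?E = "mat_fun (\<lambda>x. - exp (- x)) (K \<theta>)"
  have "gibbs H \<theta> = (- 1 / Z \<theta>) *\<^sub>R ?E"
    unfolding gibbs_eq mat_fun_scaleR[OF hermitian_K] by simp
  then have "expect (gibbs H \<theta>) (H j) = (- 1 / Z \<theta>) *\<^sub>R trace (H j ** ?E)"
    by (simp only: expect_def matrix_mult_scaleR_right trace_scaleR)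
  also have "trace (H j ** ?E) = trace (?E ** H j)" by (rule trace_mul_sym)
  also have "\<dots> = complex_of_real (gradZ j \<theta>)"
    unfolding gradZ_def by (rule trace_mult_hermitian_real[OF hermitian_mat_fun[OF hermitian_K] H])
  finally show ?thesis by (simp add: scaleR_conv_of_real)
qed

definition qhat :: "real \<Rightarrow> real" where
  "qhat w = p_az_hat (1/2) (1/2) w * p_az_hat \<alpha> z w"

lemma q_fourier: "has_bochner_integral lborel (\<lambda>t. of_real (q_az \<alpha> z t) * cis (- (w * t))) (of_real (qhat w))"
  unfolding qhat_def by (rule q_az_fourier[OF \<alpha> z])

lemma qhat_commute: "qhat (x - y) = qhat (y - x)"
  using p_az_hat_uminus[of _ _ "y - x"] by (simp add: qhat_def)

text \<open>\<open>Z \<theta>\<close> times the first term of the formula: the channel contributes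
  \<open>qhat\<close> and the anticommutator the mean of the two Gibbs weights.\<close>

definition covar :: "'l \<Rightarrow> 'l \<Rightarrow> complex" where
  "covar i j = trace (H j ** schur (\<lambda>x y. 1 / 2 * qhat (x - y) * (exp (- x) + exp (- y))) (K \<theta>) (K \<theta>) (H i))"

text \<open>Complex conjugation exchanges the two summation indices, because the matrices are
  Hermitian, and the real multiplier is symmetric. This lets the real Hessian match the complex
  trace expression.\<close>

lemma covar_real: "covar i j = complex_of_real (Re (covar i j))"
proof -
  let ?\<psi> = "\<lambda>x y. 1 / 2 * qhat (x - y) * (exp (- x) + exp (- y))"
  obtain U d where d: "diagonalizes U d (K \<theta>)" using hermitian_diagonalizable[OF hermitian_K] .
  note U = diagonalizes_unitary[OF d]
  let ?h = "\<lambda>i. ct U ** H i ** U"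
  have h: "?h i $ b $ a = cnj (?h i $ a $ b)" for i a b
  proof -
    have "ct (?h i) = ?h i" using H[of i] by (simp add: ct_mult hermitian_mat_def matrix_mul_assoc)
    then have "ct (?h i) $ b $ a = ?h i $ b $ a" by (simp only:)
    then show ?thesis by simp
  qed
  have eq: "covar i j = (\<Sum>a\<in>UNIV. \<Sum>b\<in>UNIV. ?h j $ a $ b * (complex_of_real (?\<psi> (d b) (d a)) * ?h i $ b $ a))"
    unfolding covar_def trace_mult_unitary_conj[OF U] schur_nth[OF d] ..
  have "cnj (covar i j) = (\<Sum>a\<in>UNIV. \<Sum>b\<in>UNIV. ?h j $ b $ a * (complex_of_real (?\<psi> (d b) (d a)) * ?h i $ a $ b))"
    unfolding eq cnj_sum complex_cnj_mult complex_cnj_complex_of_real h[symmetric] ..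
  also have "\<dots> = (\<Sum>b\<in>UNIV. \<Sum>a\<in>UNIV. ?h j $ b $ a * (complex_of_real (?\<psi> (d b) (d a)) * ?h i $ a $ b))"
    by (rule sum.swap)
  also have "\<dots> = covar i j"
  proof -
    have "?\<psi> (d b) (d a) = ?\<psi> (d a) (d b)" for a b
      using qhat_commute[of "d b" "d a"] by (simp add: add.commute)
    then show ?thesis unfolding eq by simp
  qed
  finally show ?thesis by (simp add: complex_eq_iff)
qed

text \<open>At the base point \<open>G\<close>, \<open>K \<theta>\<close> and
  \<open>N \<theta>\<close> are diagonal in the same basis, so the nested multipliers in
  \<open>gradB\<close> multiply entrywise and \<open>az_divdiff_identity\<close> applies to each
  entry.\<close>

lemma defect_eq: "defect i j = \<alpha> * (\<alpha> - 1) * Re (covar i j)"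
proof -
  let ?\<psi> = "\<lambda>x y. 1 / 2 * qhat (x - y) * (exp (- x) + exp (- y))"
  let ?\<phi> = "divdiff (az_f \<alpha> z) (az_f' \<alpha> z)" and ?\<gamma> = "divdiff (az_g \<alpha> z) (az_g' \<alpha> z)"
  let ?\<eta> = "divdiff (\<lambda>u. z * u powr (z - 1)) (\<lambda>u. z * (z - 1) * u powr (z - 2))"
  let ?n = "\<lambda>x. exp (- (1 / z * x))"
  obtain U d where d: "diagonalizes U d (K \<theta>)" using hermitian_diagonalizable[OF hermitian_K] .
  note U = diagonalizes_unitary[OF d]
  have dN: "diagonalizes U (\<lambda>i. ?n (d i)) (N \<theta>)"
    unfolding N_\<theta> by (rule diagonalizes_mat_fun[OF d])
  let ?h = "\<lambda>i. ct U ** H i ** U"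
  have G_nth: "(ct U ** (G ** X ** G) ** U) $ b $ a = complex_of_real (az_root \<alpha> z (d b) * az_root \<alpha> z (d a)) * (ct U ** X ** U) $ b $ a" for X a b
  proof -
    have "ct U ** G ** U = real_diag (\<lambda>i. az_root \<alpha> z (d i))"
      unfolding G_def by (rule diagonalizes_conj[OF diagonalizes_mat_fun[OF d]])
    then show ?thesis
      unfolding unitary_conj_mult[OF U] by (simp add: real_diag_mult_left_nth real_diag_mult_right_nth)
  qed
  have entry: "(ct U ** schur ?\<phi> (K \<theta>) (K \<theta>) (gradB i - schur ?\<gamma> (K \<theta>) (K \<theta>) (H i)) ** U) $ b $ a
     = complex_of_real (\<alpha> * (\<alpha> - 1)) * (complex_of_real (?\<psi> (d b) (d a)) * ?h i $ b $ a)" for a b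
  proof -
    let ?x = "d b" and ?y = "d a"
    have "(ct U ** gradB i ** U) $ b $ a
      = complex_of_real (az_root \<alpha> z ?x * az_root \<alpha> z ?y * ?\<eta> (?n ?x) (?n ?y) * (az_root \<alpha> z ?x * az_root \<alpha> z ?y) * ?\<phi> ?x ?y) * ?h i $ b $ a"
      unfolding gradB_def G_nth schur_nth[OF dN] schur_nth[OF d] by (simp add: mult_ac)
    moreover have "(ct U ** schur ?\<phi> (K \<theta>) (K \<theta>) (gradB i - schur ?\<gamma> (K \<theta>) (K \<theta>) (H i)) ** U) $ b $ a
      = complex_of_real (?\<phi> ?x ?y) * ((ct U ** gradB i ** U) $ b $ a - complex_of_real (?\<gamma> ?x ?y) * ?h i $ b $ a)"
      unfolding schur_nth[OF d] matrix_mult_diff_left matrix_mult_diff_right vector_minus_component ..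
    ultimately have "(ct U ** schur ?\<phi> (K \<theta>) (K \<theta>) (gradB i - schur ?\<gamma> (K \<theta>) (K \<theta>) (H i)) ** U) $ b $ a
      = complex_of_real (?\<phi> ?x ?y * ((az_root \<alpha> z ?x)\<^sup>2 * (az_root \<alpha> z ?y)\<^sup>2 * ?\<eta> (?n ?x) (?n ?y) * ?\<phi> ?x ?y - ?\<gamma> ?x ?y)) * ?h i $ b $ a"
      by (simp add: power2_eq_square algebra_simps)
    then show ?thesis
      unfolding az_divdiff_identity[OF \<alpha> z] qhat_def by (simp add: mult.assoc)
  qed
  have "trace (H j ** schur ?\<phi> (K \<theta>) (K \<theta>) (gradB i - schur ?\<gamma> (K \<theta>) (K \<theta>) (H i)))
     = (\<Sum>a\<in>UNIV. \<Sum>b\<in>UNIV. ?h j $ a $ b * (complex_of_real (\<alpha> * (\<alpha> - 1)) * (complex_of_real (?\<psi> (d b) (d a)) * ?h i $ b $ a)))"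
    unfolding trace_mult_unitary_conj[OF U] entry ..
  also have "\<dots> = complex_of_real (\<alpha> * (\<alpha> - 1)) * covar i j"
    unfolding covar_def trace_mult_unitary_conj[OF U] schur_nth[OF d] sum_distrib_left
    by (simp only: mult_ac)
  finally have "trace (H j ** schur ?\<phi> (K \<theta>) (K \<theta>) (gradB i - schur ?\<gamma> (K \<theta>) (K \<theta>) (H i)))
     = complex_of_real (\<alpha> * (\<alpha> - 1)) * covar i j" .
  then show ?thesis by (simp add: defect_def)
qed

text \<open>The two orders of the product place the Gibbs weight at one or the other end of each
  entry, and half of their sum is the mean appearing in \<open>covar\<close>.\<close>

lemma expect_anticomm:
  "1 / 2 * expect (gibbs H \<theta>) (anticomm (Phi (q_az \<alpha> z) (hamiltonian H \<theta>) (H i)) (H j)) = covar i j / complex_of_real (Z \<theta>)"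
proof -
  let ?\<psi> = "\<lambda>x y. 1 / 2 * qhat (x - y) * (exp (- x) + exp (- y))"
  let ?\<rho> = "gibbs H \<theta>" and ?F = "schur (\<lambda>x y. qhat (x - y)) (K \<theta>) (K \<theta>) (H i)"
  obtain U d where d: "diagonalizes U d (K \<theta>)" using hermitian_diagonalizable[OF hermitian_K] .
  note U = diagonalizes_unitary[OF d]
  let ?h = "\<lambda>i. ct U ** H i ** U"
  have \<rho>: "ct U ** ?\<rho> ** U = real_diag (\<lambda>i. exp (- d i) / Z \<theta>)"
    unfolding gibbs_eq by (rule diagonalizes_conj[OF diagonalizes_mat_fun[OF d]])
  have "Phi (q_az \<alpha> z) (hamiltonian H \<theta>) (H i) = ?F"
    using Phi_eq_schur[OF hermitian_K[of \<theta>] q_fourier] by (simp add: K_def)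
  then have "expect ?\<rho> (anticomm (Phi (q_az \<alpha> z) (hamiltonian H \<theta>) (H i)) (H j)) = trace ((?F ** H j) ** ?\<rho>) + trace ((H j ** ?F) ** ?\<rho>)"
    by (simp add: expect_def anticomm_def matrix_add_rdistrib' trace_add)
  also have "trace ((?F ** H j) ** ?\<rho>) = trace (?F ** (H j ** ?\<rho>))"
    by (simp only: matrix_mul_assoc)
  also have "\<dots> = trace ((H j ** ?\<rho>) ** ?F)"
    by (rule trace_mul_sym)
  also have "\<dots> = (\<Sum>a\<in>UNIV. \<Sum>b\<in>UNIV. ?h j $ a $ b * complex_of_real (exp (- d b) / Z \<theta>) * (complex_of_real (qhat (d b - d a)) * ?h i $ b $ a))"
    unfolding trace_mult_unitary_conj[OF U] unitary_conj_mult[OF U] \<rho> real_diag_mult_right_nth schur_nth[OF d] ..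
  also have "trace ((H j ** ?F) ** ?\<rho>) = trace (H j ** (?F ** ?\<rho>))"
    by (simp only: matrix_mul_assoc)
  also have "\<dots> = (\<Sum>a\<in>UNIV. \<Sum>b\<in>UNIV. ?h j $ a $ b * (complex_of_real (qhat (d b - d a)) * ?h i $ b $ a * complex_of_real (exp (- d a) / Z \<theta>)))"
    unfolding trace_mult_unitary_conj[OF U] unitary_conj_mult[OF U] \<rho> real_diag_mult_right_nth schur_nth[OF d] ..
  finally have "1 / 2 * expect ?\<rho> (anticomm (Phi (q_az \<alpha> z) (hamiltonian H \<theta>) (H i)) (H j))
     = (\<Sum>a\<in>UNIV. \<Sum>b\<in>UNIV. 1 / 2 * (?h j $ a $ b * complex_of_real (exp (- d b) / Z \<theta>) * (complex_of_real (qhat (d b - d a)) * ?h i $ b $ a)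
         + ?h j $ a $ b * (complex_of_real (qhat (d b - d a)) * ?h i $ b $ a * complex_of_real (exp (- d a) / Z \<theta>))))"
    by (simp only: sum.distrib sum_distrib_left distrib_left)
  also have "\<dots> = (\<Sum>a\<in>UNIV. \<Sum>b\<in>UNIV. ?h j $ a $ b * (complex_of_real (?\<psi> (d b) (d a)) * ?h i $ b $ a) / complex_of_real (Z \<theta>))"
  proof (intro sum.cong refl)
    fix a b
    have "1 / 2 * (u * (eb / w) * (q * v) + u * (q * v * (ea / w))) = u * (1 / 2 * q * (eb + ea) * v) / w" for u v eb ea q w :: complex
      by (simp add: add_divide_distrib algebra_simps)
    then show "1 / 2 * (?h j $ a $ b * complex_of_real (exp (- d b) / Z \<theta>) * (complex_of_real (qhat (d b - d a)) * ?h i $ b $ a)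
         + ?h j $ a $ b * (complex_of_real (qhat (d b - d a)) * ?h i $ b $ a * complex_of_real (exp (- d a) / Z \<theta>)))
       = ?h j $ a $ b * (complex_of_real (?\<psi> (d b) (d a)) * ?h i $ b $ a) / complex_of_real (Z \<theta>)"
      by (simp only: of_real_divide of_real_mult of_real_add of_real_1 of_real_numeral)
  qed
  also have "\<dots> = covar i j / complex_of_real (Z \<theta>)"
    unfolding covar_def trace_mult_unitary_conj[OF U] schur_nth[OF d] sum_divide_distrib ..
  finally show ?thesis .
qed

lemma divergence_derivative:
  "((\<lambda>s. renyi_az \<alpha> z (gibbs H \<theta>) (gibbs H (\<theta> + (\<epsilon> + s *\<^sub>R axis j 1)))) has_real_derivative gradD j (\<theta> + \<epsilon>)) (at 0)"
  using D_derivative[of "\<theta> + \<epsilon>" j] by (simp add: D_def add.assoc)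

lemma partial_deriv_divergence:
  "partial_deriv j (\<lambda>\<epsilon>. renyi_az \<alpha> z (gibbs H \<theta>) (gibbs H (\<theta> + \<epsilon>))) = (\<lambda>\<epsilon>. gradD j (\<theta> + \<epsilon>))"
  unfolding partial_deriv_def using divergence_derivative by (intro ext DERIV_imp_deriv)

lemma second_partials: "has_second_partials (\<lambda>\<epsilon>. renyi_az \<alpha> z (gibbs H \<theta>) (gibbs H (\<theta> + \<epsilon>))) 0"
proof -
  have "partial_differentiable j (\<lambda>\<epsilon>. renyi_az \<alpha> z (gibbs H \<theta>) (gibbs H (\<theta> + \<epsilon>))) \<epsilon>" for j \<epsilon>
    unfolding partial_differentiable_def field_differentiable_def using divergence_derivative by blast
  moreover have "partial_differentiable i (\<lambda>\<epsilon>. gradD j (\<theta> + \<epsilon>)) 0" for i j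
    unfolding partial_differentiable_def field_differentiable_def using gradD_derivative by auto
  ultimately show ?thesis
    by (simp add: has_second_partials_def partial_deriv_divergence)
qed

lemma info_matrix_eq: "info_matrix \<alpha> z (gibbs H) \<theta> $ i $ j = 1 / \<alpha> * hessD i j"
proof -
  have "partial_deriv i (\<lambda>\<epsilon>. gradD j (\<theta> + \<epsilon>)) 0 = hessD i j"
    unfolding partial_deriv_def using gradD_derivative by (intro DERIV_imp_deriv) simp
  then show ?thesis by (simp add: info_matrix_def partial_deriv_divergence)
qed

theorem info_matrix_formula:
  "complex_of_real (info_matrix \<alpha> z (gibbs H) \<theta> $ i $ j) =
     1 / 2 * expect (gibbs H \<theta>) (anticomm (Phi (q_az \<alpha> z) (hamiltonian H \<theta>) (H i)) (H j))
     - expect (gibbs H \<theta>) (H i) * expect (gibbs H \<theta>) (H j)"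
proof -
  have "1 / \<alpha> * hessD i j = Re (covar i j) / Z \<theta> - gradZ i \<theta> / Z \<theta> * (gradZ j \<theta> / Z \<theta>)"
  proof -
    have "1 / \<alpha> * (1 / (\<alpha> - 1) * (\<alpha> * (\<alpha> - 1) * c / w) - \<alpha> * a * b) = c / w - a * b" for a b c w
    proof -
      have "1 / \<alpha> * (1 / \<beta> * (\<alpha> * \<beta> * c / w) - \<alpha> * a * b) = c / w - a * b" if "\<beta> \<noteq> 0" for \<beta>
        using that \<alpha> by (simp add: field_simps)
      from this[of "\<alpha> - 1"] show ?thesis using \<alpha> by simp
    qed
    then show ?thesis unfolding hessD_def defect_eq .
  qed
  then have "complex_of_real (info_matrix \<alpha> z (gibbs H) \<theta> $ i $ j)
     = complex_of_real (Re (covar i j)) / complex_of_real (Z \<theta>)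
       - complex_of_real (- (gradZ i \<theta> / Z \<theta>)) * complex_of_real (- (gradZ j \<theta> / Z \<theta>))"
    unfolding info_matrix_eq by simp
  then show ?thesis
    unfolding expect_anticomm expect_H covar_real[symmetric] .
qed

lemma channel: "quantum_channel (Phi (q_az \<alpha> z) (hamiltonian H \<theta>))"
proof (rule quantum_channel_Phi[OF _ _ _ q_fourier])
  show "hermitian_mat (hamiltonian H \<theta>)" using hermitian_K[of \<theta>] by (simp add: K_def)
  show "q_az \<alpha> z t \<ge> 0" for t using prob_density_q_az[OF \<alpha> z] by (simp add: prob_density_def)
  show "qhat 0 = 1" by (simp add: qhat_def p_az_hat_def)
qed

end

theorem theorem32:
  fixes H :: "'l::finite \<Rightarrow> complex ^ 'n::finite ^ 'n"
    and \<theta> :: "real ^ 'l" and \<alpha> z :: real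
  assumes "\<forall>j. hermitian_mat (H j)"
    and "0 < \<alpha>" and "\<alpha> < 1" and "0 < z"
  shows "prob_density p_dens \<and> prob_density (p_az \<alpha> z) \<and> prob_density (q_az \<alpha> z)
    \<and> quantum_channel (Phi (q_az \<alpha> z) (hamiltonian H \<theta>))
    \<and> has_second_partials (\<lambda>\<epsilon>. renyi_az \<alpha> z (gibbs H \<theta>) (gibbs H (\<theta> + \<epsilon>))) 0
    \<and> (\<forall>i j. complex_of_real (info_matrix \<alpha> z (gibbs H) \<theta> $ i $ j) =
         1 / 2 * expect (gibbs H \<theta>)
                   (anticomm (Phi (q_az \<alpha> z) (hamiltonian H \<theta>) (H i)) (H j))
         - expect (gibbs H \<theta>) (H i) * expect (gibbs H \<theta>) (H j))"
proof -
  interpret gibbs_family H \<theta> \<alpha> z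
    using assms by unfold_locales auto
  show ?thesis
    using prob_density_p_dens prob_density_p_az[OF assms(2-4)] prob_density_q_az[OF assms(2-4)]
      channel second_partials info_matrix_formula by blast
qed

end
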